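(* Let $B$ be a bounded neighborhood of $\psi=0$ in $X$. (1) Uniformly on $B$, $\nu^i_n(\psi)=\nu^i_n(0)+\ell^{\infty,1}_n$ for $i=1,2$, i.e. $$\sup_{\psi\in B}\ \sup_{n\in\mathbb{Z}}\ (1+n^2)^{1/2}\,|\nu^i_n(\psi)-\nu^i_n(0)|<\infty,\qquad i=1,2,$$ where $\nu^i_n(0)=\operatorname{sgn}(n)\sqrt{(-1)^{i-1}|n|\pi/2}$. (2) There exists a neighborhood $W\subseteq B$ of the zero potential such that for all $\psi\in W$ and $i=1,2$: $\nu^i_n(\psi)\in D^i_n$ for all $|n|\ge1$, and $\nu^i_0(\psi)\in D_0$. (3) Let $W\subseteq B$ be an open neighborhood of the zero potential such that the property in (2) holds for all $\psi\in W$. Then the Neumann eigenvalues $\nu^i_n$ are analytic on $W$ for all $n\in\mathbb{Z}\setminus\{0\}$, $i=1,2$. Furthermore, for every $\psi\in W$ and every sequence $(\psi_k)_{k\in\mathbb{N}}$ in $W$ with $\psi_k\to\psi$ as $k\to\infty$, $$\lim_{k\to\infty}\Big(\sup_{n\in\mathbb{Z}\setminus\{0\}}(1+n^2)^{1/2}\big|\nu^i_n(\psi_k)-\nu^i_n(\psi)\big|\Big)=0,\qquad i=1,2.$$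
   Context: $X=H^1(\mathbb{T},\mathbb{C})^4$, $\mathbb{T}=\mathbb{R}/\mathbb{Z}$, with its Hilbert norm; $\psi=(\psi^1,\dots,\psi^4)\in X$. Let $\sigma_3=\mathrm{diag}(1,-1)$ and $V=\begin{pmatrix}-i\psi^1\psi^2 & 2\lambda\psi^1+i\psi^3\\ 2\lambda\psi^2-i\psi^4 & i\psi^1\psi^2\end{pmatrix}$. $M(t,\lambda,\psi)$ is the unique matrix solution of $\partial_tM=(-2i\lambda^2\sigma_3+V)M$, $M(0)=I$, and $\begin{pmatrix}\grave m_1&\grave m_2\\ \grave m_3&\grave m_4\end{pmatrix}=M(1,\lambda,\psi)$. The Neumann eigenvalues of $\psi$ are the roots (with multiplicity) of the entire function $\chi_N(\lambda,\psi)=\frac{1}{2i}(\grave m_4-\grave m_3+\grave m_2-\grave m_1)$ of $\lambda$; $\chi_N(\lambda,0)=\sin 2\lambda^2$. Discs: for $m\in\mathbb{Z}\setminus\{0\}$ let $U_m=\{\lambda\in\mathbb{C}:|2\lambda^2-m\pi|<\pi/4\}$. For $n\ge1$: $D^1_n=U_n\cap\{\operatorname{Re}\lambda>0\}$, $D^1_{-n}=U_n\cap\{\operatorname{Re}\lambda<0\}$, $D^2_n=U_{-n}\cap\{\operatorname{Im}\lambda>0\}$, $D^2_{-n}=U_{-n}\cap\{\operatorname{Im}\lambda<0\}$. Also $D_0=D^1_0=D^2_0=B_0=\{|\lambda|<\sqrt{\pi/8}\}$, and for $N\ge1$, $B_N=\{|\lambda|<\sqrt{(N+1/4)\pi/2}\}$.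 Convention: $\sqrt{-x}=i\sqrt{x}$ for $x\geq0$; $\operatorname{sgn}(0)=0$. Labeling: for each $\psi\in X$ there is a minimal integer $N\ge0$ such that for all $|n|>N$ and $i=1,2$ the disc $D^i_n$ contains precisely one Neumann eigenvalue, of multiplicity one, denoted $\nu^i_n(\psi)$, and $B_N$ contains the remaining $2(2N+1)$ eigenvalues counted with multiplicity. The latter are listed with multiplicity and labeled so that $\nu^1_{-N}\preceq\cdots\preceq\nu^1_{-1}\preceq\nu^2_{-N}\preceq\cdots\preceq\nu^2_{-1}\preceq\nu^1_0\preceq\nu^2_0\preceq\nu^2_1\preceq\cdots\preceq\nu^2_N\preceq\nu^1_1\preceq\cdots\preceq\nu^1_N$, where $\preceq$ is the lexicographic order ($z_1\preceq z_2$ iff $\operatorname{Re}z_1<\operatorname{Re}z_2$, or $\operatorname{Re}z_1=\operatorname{Re}z_2$ and $\operatorname{Im}z_1\le\operatorname{Im}z_2$). *)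

theory Defs
  imports "HOL-Complex_Analysis.Complex_Analysis"
begin

section \<open>The Sobolev space on the circle\<close>

text \<open>
  In one dimension every class in $H^1(\mathbb{T},\mathbb{C})$ has a unique continuous
  representative, namely a 1-periodic function that is an indefinite integral of a square
  integrable function, its weak derivative.  The elements of the type below are these
  representatives.
\<close>

definition has_L2_derivative :: "(real \<Rightarrow> complex) \<Rightarrow> (real \<Rightarrow> complex) \<Rightarrow> bool" where
  "has_L2_derivative f g \<longleftrightarrow>
     g \<in> borel_measurable borel \<and>
     set_integrable lborel {0..1} (\<lambda>s. (norm (g s))\<^sup>2) \<and>
     (\<forall>t\<in>{0..1}. f t = f 0 + (LINT s:{0..t}|lborel. g s))"

lemma L2_imp_integrable:
  assumes "g \<in> borel_measurable borel" "set_integrable lborel {0..1} (\<lambda>s. (norm (g s :: complex))\<^sup>2)"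
  shows "set_integrable lborel {0..1::real} g"
proof -
  have 1: "set_integrable lborel {0..1::real} (\<lambda>s. 1 + (norm (g s))\<^sup>2)"
    by (intro set_integral_add assms) (auto simp: set_integrable_def)
  show ?thesis
    unfolding set_integrable_def
  proof (rule Bochner_Integration.integrable_bound[OF 1[unfolded set_integrable_def]])
    show "(\<lambda>x. indicat_real {0..1} x *\<^sub>R g x) \<in> borel_measurable lborel"
      using assms(1) by measurable
    have "norm (g x) \<le> 1 + (norm (g x))\<^sup>2" for x
    proof -
      have "0 \<le> (norm (g x) - 1)\<^sup>2 + norm (g x)" by simp
      then show ?thesis by (simp add: power2_eq_square algebra_simps)
    qed
    then show "AE x in lborel. norm (indicat_real {0..1} x *\<^sub>R g x)
                 \<le> norm (indicat_real {0..1} x *\<^sub>R (1 + (norm (g x))\<^sup>2))"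
      by (auto simp: indicator_def abs_of_nonneg add_nonneg_nonneg)
  qed
qed

lemma L2_inner_integrable:
  assumes "g \<in> borel_measurable borel" "set_integrable lborel {0..1} (\<lambda>s. (norm (g s :: complex))\<^sup>2)"
    and "h \<in> borel_measurable borel" "set_integrable lborel {0..1} (\<lambda>s. (norm (h s :: complex))\<^sup>2)"
  shows "set_integrable lborel {0..1::real} (\<lambda>s. inner (g s) (h s))"
proof -
  have 1: "set_integrable lborel {0..1::real} (\<lambda>s. (norm (g s))\<^sup>2 + (norm (h s))\<^sup>2)"
    by (intro set_integral_add assms)
  show ?thesis
    unfolding set_integrable_def
  proof (rule Bochner_Integration.integrable_bound[OF 1[unfolded set_integrable_def]])
    show "(\<lambda>x. indicat_real {0..1} x *\<^sub>R (g x \<bullet> h x)) \<in> borel_measurable lborel"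
      using assms(1,3) by measurable
    have "\<bar>g x \<bullet> h x\<bar> \<le> (norm (g x))\<^sup>2 + (norm (h x))\<^sup>2" for x
    proof -
      have "\<bar>g x \<bullet> h x\<bar> \<le> norm (g x) * norm (h x)" by (rule Cauchy_Schwarz_ineq2)
      moreover have "0 \<le> (norm (g x) - norm (h x))\<^sup>2 + (norm (g x))\<^sup>2 + (norm (h x))\<^sup>2" by simp
      ultimately show ?thesis by (simp add: power2_eq_square algebra_simps)
    qed
    then show "AE x in lborel. norm (indicat_real {0..1} x *\<^sub>R (g x \<bullet> h x))
                 \<le> norm (indicat_real {0..1} x *\<^sub>R ((norm (g x))\<^sup>2 + (norm (h x))\<^sup>2))"
      by (auto simp: indicator_def abs_of_nonneg add_nonneg_nonneg)
  qed
qed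

lemma L2_add:
  assumes "g \<in> borel_measurable borel" "set_integrable lborel {0..1} (\<lambda>s. (norm (g s :: complex))\<^sup>2)"
    and "h \<in> borel_measurable borel" "set_integrable lborel {0..1} (\<lambda>s. (norm (h s :: complex))\<^sup>2)"
  shows "set_integrable lborel {0..1::real} (\<lambda>s. (norm (g s + h s))\<^sup>2)"
proof -
  have "(\<lambda>s. (norm (g s + h s))\<^sup>2) = (\<lambda>s. ((norm (g s))\<^sup>2 + (norm (h s))\<^sup>2) + 2 * (g s \<bullet> h s))"
    by (auto simp: power2_norm_eq_inner inner_add_left inner_add_right inner_commute)
  then show ?thesis
    using assms L2_inner_integrable[OF assms] by (auto intro!: set_integral_add)
qed

lemma has_L2_derivative_add:
  assumes "has_L2_derivative f1 g1" "has_L2_derivative f2 g2"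
  shows "has_L2_derivative (\<lambda>t. f1 t + f2 t) (\<lambda>t. g1 t + g2 t)"
proof -
  have i: "set_integrable lborel {0..t} g1" "set_integrable lborel {0..t} g2" if "t \<in> {0..1}" for t
    using assms that
    by (auto intro!: set_integrable_subset[OF L2_imp_integrable] simp: has_L2_derivative_def)
  show ?thesis
    unfolding has_L2_derivative_def
  proof (intro conjI ballI)
    show "(\<lambda>t. g1 t + g2 t) \<in> borel_measurable borel"
      using assms by (auto simp: has_L2_derivative_def)
    show "set_integrable lborel {0..1} (\<lambda>s. (norm (g1 s + g2 s))\<^sup>2)"
      using assms by (auto simp: has_L2_derivative_def intro: L2_add)
    fix t :: real assume t: "t \<in> {0..1}"
    have "f1 t = f1 0 + (LINT s:{0..t}|lborel. g1 s)" "f2 t = f2 0 + (LINT s:{0..t}|lborel. g2 s)"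
      using assms t unfolding has_L2_derivative_def by blast+
    then show "f1 t + f2 t = f1 0 + f2 0 + (LINT s:{0..t}|lborel. g1 s + g2 s)"
      using i[OF t] by (simp add: set_integral_add algebra_simps)
  qed
qed

lemma has_L2_derivative_cmult:
  assumes "has_L2_derivative f g"
  shows "has_L2_derivative (\<lambda>t. c * f t) (\<lambda>t. c * g t)"
  unfolding has_L2_derivative_def
proof (intro conjI ballI)
  show "(\<lambda>t. c * g t) \<in> borel_measurable borel"
    using assms by (auto simp: has_L2_derivative_def)
  show "set_integrable lborel {0..1} (\<lambda>s. (norm (c * g s))\<^sup>2)"
    using assms by (auto simp: has_L2_derivative_def norm_mult power_mult_distrib)
  fix t :: real assume t: "t \<in> {0..1}"
  have "f t = f 0 + (LINT s:{0..t}|lborel. g s)"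
    using assms t unfolding has_L2_derivative_def by blast
  then show "c * f t = c * f 0 + (LINT s:{0..t}|lborel. c * g s)"
    by (simp add: algebra_simps)
qed

lemma has_L2_derivative_zero: "has_L2_derivative (\<lambda>_. c) (\<lambda>_. 0)"
  by (auto simp: has_L2_derivative_def set_integrable_def)

text \<open>The derivative is determined up to a null set.\<close>

lemma real_zero_primitive_AE:
  fixes h :: "real \<Rightarrow> real"
  assumes h: "integrable lborel h" and z: "\<And>x. (LINT s:{x<..}|lborel. h s) = 0"
  shows "AE x in lborel. h x = 0"
proof -
  have [measurable]: "h \<in> borel_measurable borel" using h by auto
  let ?p = "\<lambda>s. max 0 (h s)" and ?n = "\<lambda>s. max 0 (- h s)"
  have ip: "integrable lborel ?p" and "integrable lborel ?n" using h by auto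
  have E: "emeasure (density lborel (\<lambda>s. ennreal (u s))) A = ennreal (LINT s:A|lborel. u s)"
    if "integrable lborel u" "\<And>s. 0 \<le> u s" "A \<in> sets borel" for u :: "real \<Rightarrow> real" and A
  proof -
    have "emeasure (density lborel (\<lambda>s. ennreal (u s))) A = (\<integral>\<^sup>+ s. ennreal (u s) * indicator A s \<partial>lborel)"
      using that by (subst emeasure_density) auto
    also have "\<dots> = (\<integral>\<^sup>+ s. ennreal (indicator A s *\<^sub>R u s) \<partial>lborel)"
      by (intro nn_integral_cong) (auto simp: indicator_def)
    also have "\<dots> = ennreal (LINT s:A|lborel. u s)"
      unfolding set_lebesgue_integral_def using that
      by (intro nn_integral_eq_integral integrable_mult_indicator) auto
    finally show ?thesis .
  qed
  have "density lborel (\<lambda>s. ennreal (?p s)) = density lborel (\<lambda>s. ennreal (?n s))"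
  proof (rule measure_eqI_lessThan)
    fix x
    show "emeasure (density lborel (\<lambda>s. ennreal (?p s))) {x<..} < \<infinity>"
      using ip by (subst E) auto
    have "(LINT s:{x<..}|lborel. ?p s) - (LINT s:{x<..}|lborel. ?n s) = (LINT s:{x<..}|lborel. ?p s - ?n s)"
      using h by (subst set_integral_diff(2)) (auto simp: set_integrable_def intro!: integrable_mult_indicator[where 'b=real, simplified])
    also have "(\<lambda>s. ?p s - ?n s) = h" by auto
    finally have "(LINT s:{x<..}|lborel. ?p s) = (LINT s:{x<..}|lborel. ?n s)" using z by simp
    then show "emeasure (density lborel (\<lambda>s. ennreal (?p s))) {x<..} = emeasure (density lborel (\<lambda>s. ennreal (?n s))) {x<..}"
      using h by (subst (1 2) E) auto
  qed auto
  then have "AE x in lborel. ennreal (?p x) = ennreal (?n x)"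
    using ip by (subst (asm) finite_density_unique) (auto simp: nn_integral_eq_integral)
  then show ?thesis by eventually_elim (auto simp: max_def split: if_splits)
qed

lemma zero_primitive_AE:
  fixes h :: "real \<Rightarrow> complex"
  assumes h: "set_integrable lborel {0..1} h"
    and z: "\<And>t. t \<in> {0..1} \<Longrightarrow> (LINT s:{0..t}|lborel. h s) = 0"
  shows "AE x in lborel. x \<in> {0..1} \<longrightarrow> h x = 0"
proof -
  let ?h = "\<lambda>s. indicat_real {0..1} s *\<^sub>R h s"
  have i: "integrable lborel ?h" using h by (simp add: set_integrable_def)
  have z': "(LINT s:{x<..}|lborel. ?h s) = 0" for x
  proof -
    consider "x < 0" | "x \<in> {0..1}" | "x > 1" by force
    then show ?thesis
    proof cases
      case 1
      have "(LINT s:{x<..}|lborel. ?h s) = (LINT s:{0..1}|lborel. h s)"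
        unfolding set_lebesgue_integral_def using 1
        by (intro Bochner_Integration.integral_cong) (auto simp: indicator_def)
      then show ?thesis using z[of 1] by simp
    next
      case 2
      have "(LINT s:{0..1}|lborel. h s) = (LINT s:{0..x} \<union> {x<..1}|lborel. h s)"
        using 2 by (intro arg_cong[where f="\<lambda>A. set_lebesgue_integral lborel A h"]) auto
      also have "\<dots> = (LINT s:{0..x}|lborel. h s) + (LINT s:{x<..1}|lborel. h s)"
        using 2 by (intro set_integral_Un set_integrable_subset[OF h]) auto
      finally have "(LINT s:{x<..1}|lborel. h s) = 0" using z[of 1] z[OF 2] by simp
      moreover have "(LINT s:{x<..}|lborel. ?h s) = (LINT s:{x<..1}|lborel. h s)"
        unfolding set_lebesgue_integral_def using 2
        by (intro Bochner_Integration.integral_cong) (auto simp: indicator_def)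
      ultimately show ?thesis by simp
    next
      case 3
      have "(LINT s:{x<..}|lborel. ?h s) = (LINT s:{}|lborel. h s)"
        unfolding set_lebesgue_integral_def using 3
        by (intro Bochner_Integration.integral_cong) (auto simp: indicator_def)
      then show ?thesis by (simp add: set_lebesgue_integral_def)
    qed
  qed
  have i2: "integrable lborel (\<lambda>s. indicat_real {x<..} s *\<^sub>R ?h s)" for x
    by (rule integrable_mult_indicator[OF _ i]) simp
  have "AE x in lborel. Re (?h x) = 0"
  proof (rule real_zero_primitive_AE)
    show "integrable lborel (\<lambda>x. Re (?h x))" using i by (rule integrable_Re)
    fix x
    have "(LINT s:{x<..}|lborel. Re (?h s)) = Re (LINT s:{x<..}|lborel. ?h s)"
      unfolding set_lebesgue_integral_def
      by (subst integral_Re[OF i2, symmetric]) (simp add: mult.assoc)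
    then show "(LINT s:{x<..}|lborel. Re (?h s)) = 0" by (simp only: z') simp
  qed
  moreover have "AE x in lborel. Im (?h x) = 0"
  proof (rule real_zero_primitive_AE)
    show "integrable lborel (\<lambda>x. Im (?h x))" using i by (rule integrable_Im)
    fix x
    have "(LINT s:{x<..}|lborel. Im (?h s)) = Im (LINT s:{x<..}|lborel. ?h s)"
      unfolding set_lebesgue_integral_def
      by (subst integral_Im[OF i2, symmetric]) (simp add: mult.assoc)
    then show "(LINT s:{x<..}|lborel. Im (?h s)) = 0" by (simp only: z') simp
  qed
  ultimately show ?thesis
    by eventually_elim (auto simp: complex_eq_iff)
qed

lemma has_L2_derivative_unique:
  assumes "has_L2_derivative f g1" "has_L2_derivative f g2"
  shows "AE x in lborel. x \<in> {0..1} \<longrightarrow> g1 x = g2 x"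
proof -
  have 0: "has_L2_derivative (\<lambda>_. 0) (\<lambda>t. g1 t + (-1) * g2 t)"
    using has_L2_derivative_add[OF assms(1) has_L2_derivative_cmult[OF assms(2), of "-1"]] by simp
  have "AE x in lborel. x \<in> {0..1} \<longrightarrow> g1 x + (-1) * g2 x = 0"
    using 0 by (intro zero_primitive_AE L2_imp_integrable) (auto simp: has_L2_derivative_def)
  then show ?thesis by eventually_elim auto
qed

typedef h1 = "{f :: real \<Rightarrow> complex. (\<forall>t. f (t + 1) = f t) \<and> (\<exists>g. has_L2_derivative f g)}"
  morphisms h1_fun Abs_h1
  using has_L2_derivative_zero by (intro exI[of _ "\<lambda>_. 0"]) auto

setup_lifting type_definition_h1

definition h1_deriv :: "h1 \<Rightarrow> real \<Rightarrow> complex" where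
  "h1_deriv f = (SOME g. has_L2_derivative (h1_fun f) g)"

lemma h1_deriv: "has_L2_derivative (h1_fun f) (h1_deriv f)"
proof -
  have "\<exists>g. has_L2_derivative (h1_fun f) g" using h1_fun[of f] by blast
  then show ?thesis unfolding h1_deriv_def by (rule someI_ex)
qed

lemma h1_deriv_L2:
  shows "h1_deriv f \<in> borel_measurable borel"
    and "set_integrable lborel {0..1} (\<lambda>s. (norm (h1_deriv f s))\<^sup>2)"
  by (rule h1_deriv[of f, unfolded has_L2_derivative_def, THEN conjunct1]
           h1_deriv[of f, unfolded has_L2_derivative_def, THEN conjunct2, THEN conjunct1])+

lemma h1_fun_continuous: "continuous_on {0..1} (h1_fun f)"
proof -
  have i: "set_integrable lborel {0..1} (h1_deriv f)"
    by (intro L2_imp_integrable h1_deriv_L2)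
  then have hk: "h1_deriv f integrable_on {0..1}"
    by (rule set_borel_integral_eq_integral)
  have "continuous_on {0..1} (\<lambda>t. h1_fun f 0 + integral {0..t} (h1_deriv f))"
    by (intro continuous_intros indefinite_integral_continuous_1 hk)
  moreover have "h1_fun f 0 + integral {0..t} (h1_deriv f) = h1_fun f t" if t: "t \<in> {0..1}" for t
  proof -
    have "(LINT s:{0..t}|lborel. h1_deriv f s) = integral {0..t} (h1_deriv f)"
      using t by (intro set_borel_integral_eq_integral set_integrable_subset[OF i]) auto
    then show ?thesis using h1_deriv[of f] t unfolding has_L2_derivative_def by metis
  qed
  ultimately show ?thesis using continuous_on_eq by blast
qed

text \<open>Complex scalar multiplication.\<close>

lift_definition h1_scaleC :: "complex \<Rightarrow> h1 \<Rightarrow> h1" is "\<lambda>c f t. c * f t"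
  using has_L2_derivative_cmult by fastforce

instantiation h1 :: real_vector
begin

lift_definition zero_h1 :: h1 is "\<lambda>_. 0"
  using has_L2_derivative_zero by auto

lift_definition plus_h1 :: "h1 \<Rightarrow> h1 \<Rightarrow> h1" is "\<lambda>f g t. f t + g t"
  using has_L2_derivative_add by fastforce

lift_definition uminus_h1 :: "h1 \<Rightarrow> h1" is "\<lambda>f t. - f t"
  using has_L2_derivative_cmult[where c = "-1"] by fastforce

definition minus_h1 :: "h1 \<Rightarrow> h1 \<Rightarrow> h1" where "f - g = f + (- g)" for f g :: h1

definition scaleR_h1 :: "real \<Rightarrow> h1 \<Rightarrow> h1" where "scaleR_h1 r f = h1_scaleC (of_real r) f"

instance
proof
  fix f g h :: h1 and a b :: real
  show "f + g + h = f + (g + h)" by transfer (simp add: add.assoc)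
  show "f + g = g + f" by transfer (simp add: add.commute)
  show "0 + f = f" by transfer simp
  show "- f + f = 0" by transfer simp
  show "f - g = f + - g" by (rule minus_h1_def)
  show "a *\<^sub>R (f + g) = a *\<^sub>R f + a *\<^sub>R g"
    unfolding scaleR_h1_def by transfer (simp add: algebra_simps)
  show "(a + b) *\<^sub>R f = a *\<^sub>R f + b *\<^sub>R f"
    unfolding scaleR_h1_def by transfer (simp add: algebra_simps)
  show "a *\<^sub>R b *\<^sub>R f = (a * b) *\<^sub>R f"
    unfolding scaleR_h1_def by transfer (simp add: algebra_simps)
  show "1 *\<^sub>R f = f"
    unfolding scaleR_h1_def by transfer simp
qed

end

instantiation h1 :: real_inner
begin

text \<open>
  \<^term>\<open>inner\<close> on the type \<^typ>\<open>complex\<close> is the real part of the Hermitian product.  So the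
  associated norm is the usual one, $\|f\|^2 = \int_0^1 |f|^2 + \int_0^1 |f'|^2$.
\<close>

definition inner_h1 :: "h1 \<Rightarrow> h1 \<Rightarrow> real" where
  "inner_h1 f g = (LINT t:{0..1}|lborel. inner (h1_fun f t) (h1_fun g t))
                + (LINT t:{0..1}|lborel. inner (h1_deriv f t) (h1_deriv g t))"

definition norm_h1 :: "h1 \<Rightarrow> real" where "norm_h1 f = sqrt (inner f f)"

definition sgn_h1 :: "h1 \<Rightarrow> h1" where "sgn_h1 f = f /\<^sub>R norm f"

definition dist_h1 :: "h1 \<Rightarrow> h1 \<Rightarrow> real" where "dist_h1 f g = norm (f - g)"

definition uniformity_h1 :: "(h1 \<times> h1) filter" where
  "uniformity_h1 = (INF e\<in>{0<..}. principal {(f, g). dist f g < e})"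

definition open_h1 :: "h1 set \<Rightarrow> bool" where
  "open_h1 U \<longleftrightarrow> (\<forall>f\<in>U. eventually (\<lambda>(f', g). f' = f \<longrightarrow> g \<in> U) uniformity)"

instance
proof
  have fun_add: "h1_fun (f + g) t = h1_fun f t + h1_fun g t" for f g t
    by transfer simp
  have fun_scale: "h1_fun (r *\<^sub>R f) t = of_real r * h1_fun f t" for r f t
    unfolding scaleR_h1_def by transfer simp
  have der_add: "AE t in lborel. t \<in> {0..1} \<longrightarrow> h1_deriv (f + g) t = h1_deriv f t + h1_deriv g t" for f g
  proof (rule has_L2_derivative_unique[OF h1_deriv])
    have "h1_fun (f + g) = (\<lambda>t. h1_fun f t + h1_fun g t)" using fun_add by blast
    then show "has_L2_derivative (h1_fun (f + g)) (\<lambda>t. h1_deriv f t + h1_deriv g t)"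
      by (simp add: has_L2_derivative_add h1_deriv)
  qed
  have der_scale: "AE t in lborel. t \<in> {0..1} \<longrightarrow> h1_deriv (r *\<^sub>R f) t = of_real r * h1_deriv f t" for r f
  proof (rule has_L2_derivative_unique[OF h1_deriv])
    have "h1_fun (r *\<^sub>R f) = (\<lambda>t. of_real r * h1_fun f t)" using fun_scale by blast
    then show "has_L2_derivative (h1_fun (r *\<^sub>R f)) (\<lambda>t. of_real r * h1_deriv f t)"
      by (simp add: has_L2_derivative_cmult h1_deriv)
  qed
  have int_fun: "set_integrable lborel {0..1} (\<lambda>t. inner (h1_fun f t) (h1_fun g t))" for f g
    by (intro borel_integrable_atLeastAtMost' continuous_intros h1_fun_continuous)
  have int_der: "set_integrable lborel {0..1} (\<lambda>t. inner (h1_deriv f t) (h1_deriv g t))" for f g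
    by (intro L2_inner_integrable h1_deriv_L2)
  have meas[measurable]: "h1_deriv f \<in> borel_measurable borel" for f
    by (rule h1_deriv_L2)
  fix f g h :: h1 and a b :: real
  show "sgn f = f /\<^sub>R norm f" by (rule sgn_h1_def)
  show "dist f g = norm (f - g)" by (rule dist_h1_def)
  show "(uniformity :: (h1 \<times> h1) filter) = (INF e\<in>{0<..}. principal {(x, y). dist x y < e})"
    by (rule uniformity_h1_def)
  show "open U \<longleftrightarrow> (\<forall>x\<in>U. \<forall>\<^sub>F (x', y) in uniformity. x' = x \<longrightarrow> y \<in> U)" for U :: "h1 set"
    by (rule open_h1_def)
  show "inner f g = inner g f"
    by (simp add: inner_h1_def inner_commute)
  have "(LINT t:{0..1}|lborel. inner (h1_deriv (f + g) t) (h1_deriv h t))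
      = (LINT t:{0..1}|lborel. inner (h1_deriv f t) (h1_deriv h t) + inner (h1_deriv g t) (h1_deriv h t))"
    using der_add[of f g]
    by (intro set_lebesgue_integral_cong_AE) (auto simp: inner_add_left elim!: AE_mp)
  then show "inner (f + g) h = inner f h + inner g h"
    by (simp add: inner_h1_def fun_add inner_add_left set_integral_add int_fun int_der)
  have scale: "inner (a *\<^sub>R f) h = a * inner f h" for a and f h :: h1
  proof -
    have "(LINT t:{0..1}|lborel. inner (h1_deriv (a *\<^sub>R f) t) (h1_deriv h t))
        = (LINT t:{0..1}|lborel. a * inner (h1_deriv f t) (h1_deriv h t))"
      using der_scale[of a f]
      by (intro set_lebesgue_integral_cong_AE)
         (auto simp: scaleR_conv_of_real[symmetric] elim!: AE_mp)
    then show ?thesis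
      by (simp add: inner_h1_def fun_scale scaleR_conv_of_real[symmetric] algebra_simps)
  qed
  then show "inner (a *\<^sub>R f) h = a * inner f h" .
  have n1: "0 \<le> (LINT t:{0..1}|lborel. inner (h1_fun f t) (h1_fun f t))" for f
    unfolding set_lebesgue_integral_def by (intro Bochner_Integration.integral_nonneg) auto
  have n2: "0 \<le> (LINT t:{0..1}|lborel. inner (h1_deriv f t) (h1_deriv f t))" for f
    unfolding set_lebesgue_integral_def by (intro Bochner_Integration.integral_nonneg) auto
  show "0 \<le> inner f f"
    unfolding inner_h1_def using n1 n2 by (rule add_nonneg_nonneg)
  show "inner f f = 0 \<longleftrightarrow> f = 0"
  proof
    assume "inner f f = 0"
    then have z: "(LINT t:{0..1}|lborel. inner (h1_fun f t) (h1_fun f t)) = 0"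
      using n1[of f] n2[of f] unfolding inner_h1_def by linarith
    have c: "continuous_on {0..1} (\<lambda>t. inner (h1_fun f t) (h1_fun f t))"
      by (intro continuous_intros h1_fun_continuous)
    have "integral {0..1} (\<lambda>t. inner (h1_fun f t) (h1_fun f t)) = 0"
      using z set_borel_integral_eq_integral(2)[OF int_fun] by simp
    then have "\<forall>t\<in>{0..1}. inner (h1_fun f t) (h1_fun f t) = 0"
      using integral_eq_0_iff[OF c] by simp
    then have z1: "h1_fun f t = 0" if "t \<in> {0..1}" for t using that by simp
    have per: "h1_fun f (t + 1) = h1_fun f t" for t using h1_fun[of f] by auto
    have pern: "h1_fun f (t + real n) = h1_fun f t" for t n
    proof (induction n)
      case (Suc n)
      show ?case using per[of "t + real n"] Suc by (simp add: add_ac)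
    qed simp
    have peri: "h1_fun f (t + real_of_int k) = h1_fun f t" for t k
    proof (cases "k \<ge> 0")
      case True
      then show ?thesis using pern[of t "nat k"] by simp
    next
      case False
      then show ?thesis using pern[of "t + real_of_int k" "nat (- k)"] by simp
    qed
    have "h1_fun f t = 0" for t
    proof -
      have "h1_fun f (frac t) = 0" by (rule z1) (auto simp: less_imp_le frac_lt_1)
      then show ?thesis using peri[of "frac t" "floor t"] by (simp add: frac_def)
    qed
    then show "f = 0" by (transfer) auto
  next
    assume "f = 0"
    then show "inner f f = 0" using scale[of 0 f f] by simp
  qed
  show "norm f = sqrt (inner f f)" by (rule norm_h1_def)
qed

end


section \<open>Neumann eigenvalues\<close>

text \<open>The phase space $H^1(\mathbb{T},\mathbb{C})^4$; \<^typ>\<open>h1 ^ 4\<close> carries the $\ell^2$ product norm.\<close>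

type_synonym potential = "h1 ^ 4"

definition sigma3 :: "complex ^ 2 ^ 2" where
  "sigma3 = vector [vector [1, 0], vector [0, -1]]"

definition V_mat :: "real \<Rightarrow> complex \<Rightarrow> potential \<Rightarrow> complex ^ 2 ^ 2" where
  "V_mat t z \<psi> = (let p = (\<lambda>j. h1_fun (\<psi> $ j) t) in
     vector [vector [- \<i> * p 1 * p 2, 2 * z * p 1 + \<i> * p 3],
             vector [2 * z * p 2 - \<i> * p 4, \<i> * p 1 * p 2]])"

definition coeff_mat :: "real \<Rightarrow> complex \<Rightarrow> potential \<Rightarrow> complex ^ 2 ^ 2" where
  "coeff_mat t z \<psi> = (\<chi> i j. - 2 * \<i> * z\<^sup>2 * sigma3 $ i $ j + V_mat t z \<psi> $ i $ j)"

definition is_fundamental_solution :: "complex \<Rightarrow> potential \<Rightarrow> (real \<Rightarrow> complex ^ 2 ^ 2) \<Rightarrow> bool" where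
  "is_fundamental_solution z \<psi> M \<longleftrightarrow>
     M 0 = mat 1 \<and> (\<forall>t. (M has_vector_derivative (coeff_mat t z \<psi> ** M t)) (at t))"

definition M_mat :: "real \<Rightarrow> complex \<Rightarrow> potential \<Rightarrow> complex ^ 2 ^ 2" where
  "M_mat t z \<psi> = (THE M. is_fundamental_solution z \<psi> M) t"

definition chi_N :: "complex \<Rightarrow> potential \<Rightarrow> complex" where
  "chi_N z \<psi> = (let m = M_mat 1 z \<psi> in
     (m $ 2 $ 2 - m $ 2 $ 1 + m $ 1 $ 2 - m $ 1 $ 1) / (2 * \<i>))"

definition neumann_spectrum :: "potential \<Rightarrow> complex set" where
  "neumann_spectrum \<psi> = {z. chi_N z \<psi> = 0}"

definition neumann_mult :: "potential \<Rightarrow> complex \<Rightarrow> nat" where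
  "neumann_mult \<psi> z = (if z \<in> neumann_spectrum \<psi> then nat (zorder (\<lambda>w. chi_N w \<psi>) z) else 0)"

definition U_set :: "int \<Rightarrow> complex set" where
  "U_set m = {z. norm (2 * z\<^sup>2 - of_int m * pi) < pi / 4}"

text \<open>\<open>D_disc i n\<close> is $D^i_n$; the upper index is used for \<open>i \<in> {1, 2}\<close> only.\<close>

definition D_disc :: "nat \<Rightarrow> int \<Rightarrow> complex set" where
  "D_disc i n =
     (if n = 0 then {z. norm z < sqrt (pi / 8)}
      else if i = 1 then
        (if n > 0 then U_set n \<inter> {z. Re z > 0} else U_set (- n) \<inter> {z. Re z < 0})
      else
        (if n > 0 then U_set (- n) \<inter> {z. Im z > 0} else U_set n \<inter> {z. Im z < 0}))"

definition B_disc :: "nat \<Rightarrow> complex set" where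
  "B_disc N = {z. norm z < sqrt ((real N + 1 / 4) * pi / 2)}"

definition counting_property :: "potential \<Rightarrow> nat \<Rightarrow> bool" where
  "counting_property \<psi> N \<longleftrightarrow>
     (\<forall>i\<in>{1, 2}. \<forall>n. \<bar>n\<bar> > int N \<longrightarrow>
        (\<exists>!z. z \<in> D_disc i n \<inter> neumann_spectrum \<psi>) \<and>
        (\<forall>z \<in> D_disc i n \<inter> neumann_spectrum \<psi>. neumann_mult \<psi> z = 1)) \<and>
     neumann_spectrum \<psi> - (\<Union>i\<in>{1, 2}. \<Union>n\<in>{n. \<bar>n\<bar> > int N}. D_disc i n) \<subseteq> B_disc N \<and>
     (\<Sum>z \<in> B_disc N \<inter> neumann_spectrum \<psi>. neumann_mult \<psi> z) = 2 * (2 * N + 1)"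

definition neumann_N :: "potential \<Rightarrow> nat" where
  "neumann_N \<psi> = (LEAST N. counting_property \<psi> N)"

definition lex_le :: "complex \<Rightarrow> complex \<Rightarrow> bool" where
  "lex_le z w \<longleftrightarrow> Re z < Re w \<or> (Re z = Re w \<and> Im z \<le> Im w)"

definition neumann_list :: "potential \<Rightarrow> complex list" where
  "neumann_list \<psi> = (THE zs. sorted_wrt lex_le zs \<and>
     (\<forall>z. count_list zs z = (if z \<in> B_disc (neumann_N \<psi>) then neumann_mult \<psi> z else 0)))"

text \<open>
  The position, counted from 0, of $\nu^i_n$ in the chain
  $\nu^1_{-N} \preceq \dots \preceq \nu^1_{-1} \preceq \nu^2_{-N} \preceq \dots \preceq \nu^2_{-1}
   \preceq \nu^1_0 \preceq \nu^2_0 \preceq \nu^2_1 \preceq \dots \preceq \nu^2_N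
   \preceq \nu^1_1 \preceq \dots \preceq \nu^1_N$.
\<close>

definition label_position :: "nat \<Rightarrow> nat \<Rightarrow> int \<Rightarrow> nat" where
  "label_position N i n = nat (
     if i = 1 then
       (if n < 0 then int N + n else if n = 0 then 2 * int N else 3 * int N + 1 + n)
     else
       (if n < 0 then 2 * int N + n else 2 * int N + 1 + n))"

definition neumann_ev :: "nat \<Rightarrow> int \<Rightarrow> potential \<Rightarrow> complex" where
  "neumann_ev i n \<psi> =
     (if \<bar>n\<bar> > int (neumann_N \<psi>) then (THE z. z \<in> D_disc i n \<inter> neumann_spectrum \<psi>)
      else neumann_list \<psi> ! label_position (neumann_N \<psi>) i n)"


section \<open>Analytic functions on the phase space\<close>

definition potential_scaleC :: "complex \<Rightarrow> potential \<Rightarrow> potential" where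
  "potential_scaleC c \<psi> = (\<chi> j. h1_scaleC c (\<psi> $ j))"

text \<open>
  A function on an open subset of a complex Banach space is analytic if it is Frechet
  differentiable over the complex numbers at each point, i.e. if it has a real Frechet
  derivative that is complex linear.
\<close>

definition analytic_on_potentials :: "(potential \<Rightarrow> complex) \<Rightarrow> potential set \<Rightarrow> bool" where
  "analytic_on_potentials f W \<longleftrightarrow>
     (\<forall>\<psi>\<in>W. \<exists>D. (f has_derivative D) (at \<psi>) \<and> (\<forall>c h. D (potential_scaleC c h) = c * D h))"

end

theory Submission
  imports Defs
begin

text \<open>
  The value \<open>chi_N z \<psi>\<close> only depends on the solution \<open>(u, v)\<close> of the $2\times 2$ system with initial value
  \<open>(-1, 1)\<close>.  Duhamel's formula, written with the adjoint solution, makes \<open>chi_N\<close> jointly analytic in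
  \<open>(z, \<psi>)\<close>.  A gauge transformation of size \<open>O(1/z)\<close>, built from smooth approximations of the potential
  whose derivatives are bounded in $L^1$ by the $H^1$ norm, removes the terms of order \<open>z\<close> and \<open>1\<close> that
  couple \<open>u\<close> and \<open>v\<close> and leaves an integrable error of size \<open>O(1/z)\<close>.  Gronwall's inequality then gives
  $|\chi_N - \sin 2 z^2| \le C e^{|\mathrm{Im}\, 2 z^2|} / (1 + |z|)$ on bounded sets of potentials.  Rouche's
  theorem turns this bound into the counting of the eigenvalues, and, since \<open>sin\<close> has simple zeros, into
  $2 (\nu^i_n)^2 = \pm |n| \pi + O(|n|^{-1/2})$, that is $\nu^i_n(\psi) - \nu^i_n(0) = O(1/n)$.  Analyticity of a
  simple root follows from the implicit function theorem.  The uniform \<open>O(1/n)\<close> bound on a larger ball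
  and Cauchy's estimate along complex lines give a Lipschitz bound of size \<open>O(1/n)\<close> for large \<open>n\<close>, hence
  the continuity statement.
\<close>

section \<open>Functions of class H1\<close>

text \<open>A direct Gronwall bound fails: the off-diagonal entries carry the factor z and would
  cost a factor exponential in |z|. The gauge that removes them has to be differentiated, but an
  \<open>h1\<close> element has only a weak derivative; hence the approximations, taken within
  1/|z|^2 so that even the error multiplied by z is O(1/|z|). The same gauge cancels the product of
  the first two components on the diagonal, which is why sin 2z^2 appears without a phase shift. The
  other obstacle is the labeling: \<open>neumann_N\<close> and the sorted list depend on the
  potential and may jump. On a bounded set one N serves all potentials, so labels beyond N are
  unique roots in fixed discs and the others are merely bounded. For the analyticity claim, the disc
  hypothesis on W forces \<open>neumann_N\<close> to be 0, so that every nonzero label is such a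
  unique root. All contours share one threshold: at distance at least pi/4 from the multiples of pi,
  |sin w| is at least exp|Im w| / 8.\<close>

lemma h1_fun_zero [simp]: "h1_fun 0 t = 0"
  by (simp add: zero_h1.rep_eq)

lemma h1_fun_add [simp]: "h1_fun (f + g) t = h1_fun f t + h1_fun g t"
  by (simp add: plus_h1.rep_eq)

lemma h1_fun_scaleC [simp]: "h1_fun (h1_scaleC c f) t = c * h1_fun f t"
  by (simp add: h1_scaleC.rep_eq)

lemma h1_fun_scaleR [simp]: "h1_fun (r *\<^sub>R f) t = of_real r * h1_fun f t"
  unfolding scaleR_h1_def by simp

lemma h1_fun_uminus [simp]: "h1_fun (- f) t = - h1_fun f t"
  by (simp add: uminus_h1.rep_eq)

lemma h1_fun_diff [simp]: "h1_fun (f - g) t = h1_fun f t - h1_fun g t"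
  unfolding minus_h1_def h1_fun_add h1_fun_uminus by (rule diff_conv_add_uminus[symmetric])

lemma h1_fun_periodic: "h1_fun f (t + 1) = h1_fun f t"
  using h1_fun[of f] by auto

lemma h1_fun_periodic_int: "h1_fun f (t + of_int k) = h1_fun f t"
proof -
  have n: "h1_fun f (t + real n) = h1_fun f t" for t n
  proof (induction n)
    case (Suc n)
    show ?case using h1_fun_periodic[of f "t + real n"] Suc by (simp add: add_ac)
  qed simp
  show ?thesis
  proof (cases "k \<ge> 0")
    case True
    then show ?thesis using n[of t "nat k"] by simp
  next
    case False
    then show ?thesis using n[of "t + of_int k" "nat (- k)"] by simp
  qed
qed

text \<open>The integral representation gives continuity on one period only. Periodicity moves it to
  every interval [k, k + 1], and at an integer the two adjacent intervals are glued.\<close>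

lemma continuous_on_h1_fun [continuous_intros]: "continuous_on S (h1_fun f)"
proof -
  have c: "continuous_on {of_int k..of_int k + 1} (h1_fun f)" for k :: int
  proof -
    have "continuous_on {of_int k..of_int k + 1} (\<lambda>t. h1_fun f (t - of_int k))"
      by (rule continuous_on_compose2[OF h1_fun_continuous]) (auto intro!: continuous_intros)
    then show ?thesis using h1_fun_periodic_int[of f _ "- k"] by simp
  qed
  have "isCont (h1_fun f) t" for t
  proof (cases "t \<in> \<int>")
    case True
    then obtain k where k: "t = of_int k" by (auto elim: Ints_cases)
    have "continuous_on ({of_int (k-1)..of_int (k-1) + 1} \<union> {of_int k..of_int k + 1}) (h1_fun f)"
      by (intro continuous_on_closed_Un c) auto
    moreover have "{of_int (k-1)..of_int (k-1) + 1} \<union> {of_int k..of_int k + 1} = {t - 1..t + 1}"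
      using k by auto
    ultimately have "continuous_on {t - 1..t + 1} (h1_fun f)" by simp
    then show ?thesis by (rule continuous_on_interior) simp
  next
    case False
    have "t \<in> interior {of_int \<lfloor>t\<rfloor>..of_int \<lfloor>t\<rfloor> + 1}"
      using False floor_correct[of t] by (auto simp: less_le)
    then show ?thesis using c continuous_on_interior by blast
  qed
  then show ?thesis by (auto intro: continuous_at_imp_continuous_on)
qed

lemma norm_h1_sq:
  "(norm f)\<^sup>2 = (LINT t:{0..1}|lborel. (norm (h1_fun f t))\<^sup>2) + (LINT t:{0..1}|lborel. (norm (h1_deriv f t))\<^sup>2)"
  for f :: h1
  by (simp add: power2_norm_eq_inner[of f] inner_h1_def power2_norm_eq_inner)

text \<open>\<open>h1_deriv\<close> is an arbitrary choice among weak derivatives. Two of them agree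
  almost everywhere on the period, so any convenient one computes the norm.\<close>

lemma has_L2_derivative_norm_sq:
  assumes "has_L2_derivative (h1_fun f) g"
  shows "(LINT t:{0..1}|lborel. (norm (h1_deriv f t))\<^sup>2) = (LINT t:{0..1}|lborel. (norm (g t))\<^sup>2)"
  using has_L2_derivative_unique[OF h1_deriv assms] assms h1_deriv_L2(1)[of f]
  by (intro set_lebesgue_integral_cong_AE) (auto simp: has_L2_derivative_def)

lemma norm_h1_scaleC [simp]: "norm (h1_scaleC c f) = norm c * norm f"
proof -
  have "has_L2_derivative (\<lambda>t. c * h1_fun f t) (\<lambda>t. c * h1_deriv f t)"
    by (rule has_L2_derivative_cmult[OF h1_deriv])
  moreover have "h1_fun (h1_scaleC c f) = (\<lambda>t. c * h1_fun f t)" by auto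
  ultimately have "has_L2_derivative (h1_fun (h1_scaleC c f)) (\<lambda>t. c * h1_deriv f t)" by simp
  from has_L2_derivative_norm_sq[OF this]
  have "(norm (h1_scaleC c f))\<^sup>2 = (norm c * norm f)\<^sup>2"
    by (simp add: norm_h1_sq norm_mult power_mult_distrib algebra_simps)
  then show ?thesis by simp
qed

text \<open>\<open>G\<close> is the primitive of \<open>norm f'\<close>.\<close>

lemma h1_variation:
  fixes f :: h1
  obtains G where "continuous_on {0..1} G" "mono_on {0..1} G" "G 0 = 0" "G 1 \<le> norm f"
    "\<And>s t. 0 \<le> s \<Longrightarrow> s \<le> t \<Longrightarrow> t \<le> 1 \<Longrightarrow> norm (h1_fun f t - h1_fun f s) \<le> G t - G s"
proof -
  define g where "g = h1_deriv f"
  note L2 = h1_deriv_L2[of f, folded g_def]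
  have gi: "set_integrable lborel {0..1} g" by (rule L2_imp_integrable[OF L2])
  have ni: "set_integrable lborel {0..1} (\<lambda>s. norm (g s))"
    using gi by (rule set_integrable_norm)
  have nk: "(\<lambda>s. norm (g s)) integrable_on {0..1}"
    by (rule set_borel_integral_eq_integral[OF ni])
  have gk: "g integrable_on {0..1}" by (rule set_borel_integral_eq_integral[OF gi])
  define G where "G = (\<lambda>t. integral {0..t} (\<lambda>s. norm (g s)))"
  have inc: "G t - G s = integral {s..t} (\<lambda>s. norm (g s))" if "0 \<le> s" "s \<le> t" "t \<le> 1" for s t
    using Henstock_Kurzweil_Integration.integral_combine[of 0 s t "\<lambda>s. norm (g s)"] that
      integrable_on_subinterval[OF nk, of 0 t]
    by (simp add: G_def)
  have finc: "h1_fun f t - h1_fun f s = integral {s..t} g" if "0 \<le> s" "s \<le> t" "t \<le> 1" for s t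
  proof -
    have e: "h1_fun f t = h1_fun f 0 + integral {0..t} g" if "t \<in> {0..1}" for t
    proof -
      have "(LINT s:{0..t}|lborel. g s) = integral {0..t} g"
        using that by (intro set_borel_integral_eq_integral set_integrable_subset[OF gi]) auto
      then show ?thesis using h1_deriv[of f] that unfolding has_L2_derivative_def g_def by metis
    qed
    show ?thesis
      using Henstock_Kurzweil_Integration.integral_combine[of 0 s t g] that
        integrable_on_subinterval[OF gk, of 0 t] e[of s] e[of t]
      by (simp add: algebra_simps)
  qed
  show ?thesis
  proof
    show "continuous_on {0..1} G" unfolding G_def by (rule indefinite_integral_continuous_1[OF nk])
    show "G 0 = 0" by (simp add: G_def)
    have nn: "0 \<le> G t - G s" if "0 \<le> s" "s \<le> t" "t \<le> 1" for s t
      using inc[OF that] by (simp add: integral_nonneg integrable_on_subinterval[OF nk] that)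
    then show "mono_on {0..1} G" by (force intro!: mono_onI)
    show "norm (h1_fun f t - h1_fun f s) \<le> G t - G s" if "0 \<le> s" "s \<le> t" "t \<le> 1" for s t
      unfolding inc[OF that] finc[OF that]
      using that by (intro integral_norm_bound_integral integrable_on_subinterval[OF gk]
        integrable_on_subinterval[OF nk]) auto
    let ?c = "G 1"
    have G1: "?c = (LINT s:{0..1}|lborel. norm (g s))"
      unfolding G_def using set_borel_integral_eq_integral(2)[OF ni] by simp
    \<comment> \<open>Cauchy-Schwarz on an interval of length one, in the form of a nonnegative
      variance: the squared mean of \<open>norm (g s)\<close> is at most the mean of its
      square.\<close>
    have "0 \<le> (LINT s:{0..1}|lborel. (norm (g s) - ?c)\<^sup>2)"
      unfolding set_lebesgue_integral_def by (intro Bochner_Integration.integral_nonneg) auto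
    also have "(\<lambda>s. (norm (g s) - ?c)\<^sup>2) = (\<lambda>s. ((norm (g s))\<^sup>2 - (2 * ?c) * norm (g s)) + ?c\<^sup>2)"
      by (auto simp: power2_diff)
    also have "(LINT s:{0..1}|lborel. ((norm (g s))\<^sup>2 - (2 * ?c) * norm (g s)) + ?c\<^sup>2)
        = (LINT s:{0..1}|lborel. (norm (g s))\<^sup>2) - (2 * ?c) * (LINT s:{0..1}|lborel. norm (g s)) + ?c\<^sup>2"
    proof -
      have k: "set_integrable lborel {0..1::real} (\<lambda>s. ?c\<^sup>2)" by (simp add: set_integrable_def)
      have "(LINT s:{0..1::real}|lborel. (\<lambda>s. ?c\<^sup>2) s) = ?c\<^sup>2"
        unfolding set_lebesgue_integral_def by (simp add: measure_def)
      moreover have i2: "set_integrable lborel {0..1} (\<lambda>s. (2 * ?c) * norm (g s))" using ni by simp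
      ultimately show ?thesis
        using set_integral_add(2)[OF set_integral_diff(1)[OF L2(2) i2] k] set_integral_diff(2)[OF L2(2) i2]
        by simp
    qed
    also have "\<dots> = (LINT s:{0..1}|lborel. (norm (g s))\<^sup>2) - ?c\<^sup>2"
      unfolding G1[symmetric] by (simp add: power2_eq_square)
    finally have "?c\<^sup>2 \<le> (LINT s:{0..1}|lborel. (norm (g s))\<^sup>2)" by simp
    also have "\<dots> \<le> (norm f)\<^sup>2"
      unfolding norm_h1_sq g_def set_lebesgue_integral_def
      by (simp add: Bochner_Integration.integral_nonneg)
    finally show "?c \<le> norm f" by (rule power2_le_imp_le) simp
  qed
qed

text \<open>The oscillation of f over a period is at most \<open>norm f\<close>, because G grows by
  at most that much. If |f| exceeded \<open>2 * norm f\<close> at one point, it would exceed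
  \<open>norm f\<close> on the whole period, and so would the L2 norm of f, which is only a part of
  \<open>norm f\<close>.\<close>

lemma norm_h1_fun_le: "norm (h1_fun f t) \<le> 2 * norm f"
proof -
  obtain G where G: "mono_on {0..1} G" "G 0 = 0" "G 1 \<le> norm f"
    "\<And>s t. 0 \<le> s \<Longrightarrow> s \<le> t \<Longrightarrow> t \<le> 1 \<Longrightarrow> norm (h1_fun f t - h1_fun f s) \<le> G t - G s"
    using h1_variation[of f] by metis
  have osc: "norm (h1_fun f t - h1_fun f s) \<le> norm f" if "s \<in> {0..1}" "t \<in> {0..1}" for s t
  proof -
    have *: "norm (h1_fun f t - h1_fun f s) \<le> norm f" if "0 \<le> s" "s \<le> t" "t \<le> 1" for s t
      using G(4)[OF that] mono_onD[OF G(1), of 0 s] mono_onD[OF G(1), of t 1] G(2,3) that by simp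
    show ?thesis using *[of s t] *[of t s] that by (cases "s \<le> t") (auto simp: norm_minus_commute)
  qed
  have c: "continuous_on {0..1} (\<lambda>t. (norm (h1_fun f t))\<^sup>2)" by (intro continuous_intros)
  have main: "norm (h1_fun f t) \<le> 2 * norm f" if t: "t \<in> {0..1}" for t
  proof (rule ccontr)
    assume contra: "\<not> ?thesis"
    define d where "d = norm (h1_fun f t) - norm f"
    have d: "d > norm f" using contra by (simp add: d_def)
    have low: "d\<^sup>2 \<le> (norm (h1_fun f s))\<^sup>2" if "s \<in> {0..1}" for s
    proof -
      have "d \<le> norm (h1_fun f s)"
        using osc[OF that t] norm_triangle_ineq2[of "h1_fun f t" "h1_fun f s"] by (simp add: d_def)
      then show ?thesis using d norm_ge_zero[of f] by (intro power_mono) linarith+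
    qed
    have "integral {0..1} (\<lambda>_::real. d\<^sup>2) \<le> integral {0..1} (\<lambda>t. (norm (h1_fun f t))\<^sup>2)"
      by (intro integral_le integrable_continuous_real c low) auto
    then have "d\<^sup>2 \<le> integral {0..1} (\<lambda>t. (norm (h1_fun f t))\<^sup>2)" by simp
    also have "\<dots> = (LINT t:{0..1}|lborel. (norm (h1_fun f t))\<^sup>2)"
      by (intro set_borel_integral_eq_integral(2)[symmetric] borel_integrable_atLeastAtMost' c)
    also have "\<dots> \<le> (norm f)\<^sup>2"
      unfolding norm_h1_sq set_lebesgue_integral_def by (simp add: Bochner_Integration.integral_nonneg)
    finally have "d \<le> norm f" by (rule power2_le_imp_le) simp
    then show False using d by simp
  qed
  have "h1_fun f t = h1_fun f (frac t)"
    using h1_fun_periodic_int[of f "frac t" "\<lfloor>t\<rfloor>"] by (simp add: frac_def)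
  then show ?thesis using main[of "frac t"] by (simp add: less_imp_le frac_lt_1)
qed

text \<open>Steklov averages \<open>(1/h) \<integral> f\<close> over \<open>[t, t + h]\<close>, with \<open>f\<close> frozen to the right of \<open>1\<close>.\<close>

lemma h1_smoothing:
  fixes f :: h1
  assumes "\<epsilon> > 0"
  obtains P P' :: "real \<Rightarrow> complex" and G G' :: "real \<Rightarrow> real" where
    "\<And>t. t \<in> {0..1} \<Longrightarrow> norm (h1_fun f t - P t) \<le> \<epsilon>"
    "\<And>t. t \<in> {0..1} \<Longrightarrow> norm (P t) \<le> 2 * norm f"
    "\<And>t. t \<in> {0..1} \<Longrightarrow> (P has_vector_derivative P' t) (at t within {0..1})"
    "\<And>t. t \<in> {0..1} \<Longrightarrow> (G has_real_derivative G' t) (at t within {0..1})"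
    "\<And>t. t \<in> {0..1} \<Longrightarrow> norm (P' t) \<le> G' t"
    "G 1 - G 0 \<le> norm f"
proof -
  obtain A where A: "continuous_on {0..1} A" "mono_on {0..1} A" "A 0 = 0" "A 1 \<le> norm f"
    "\<And>s t. 0 \<le> s \<Longrightarrow> s \<le> t \<Longrightarrow> t \<le> 1 \<Longrightarrow> norm (h1_fun f t - h1_fun f s) \<le> A t - A s"
    using h1_variation[of f] by metis
  \<comment> \<open>Freezing the argument at 1 keeps the averages over [t, t + h] meaningful up to t
    = 1 and makes the variation constant there. Hence \<open>G 1\<close> is exactly
    \<open>A 1\<close>, and the increment of G does not grow with the smoothing.\<close>
  define c :: "real \<Rightarrow> real" where "c t = min 1 t" for t
  define a where "a = (\<lambda>t. A (c t))"
  define p where "p = (\<lambda>t. h1_fun f (c t))"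
  have cc: "continuous_on S c" for S unfolding c_def by (intro continuous_intros)
  have conta: "continuous_on {0..2} a"
    unfolding a_def by (rule continuous_on_compose2[OF A(1) cc]) (auto simp: c_def)
  have contp: "continuous_on {0..2} p"
    unfolding p_def by (rule continuous_on_compose2[OF continuous_on_h1_fun cc]) auto
  have incr: "norm (p t - p s) \<le> a t - a s" if "0 \<le> s" "s \<le> t" for s t
    unfolding a_def p_def using that by (intro A(5)) (auto simp: c_def)
  have amono: "a s \<le> a t" if "0 \<le> s" "s \<le> t" for s t
    unfolding a_def using that by (intro mono_onD[OF A(2)]) (auto simp: c_def)
  have "uniformly_continuous_on {0..2} p"
    by (intro compact_uniformly_continuous contp) auto
  then obtain d where d: "d > 0" "\<And>s t. s \<in> {0..2} \<Longrightarrow> t \<in> {0..2} \<Longrightarrow> dist s t < d \<Longrightarrow> dist (p s) (p t) < \<epsilon>"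
    unfolding uniformly_continuous_on_def using assms by metis
  define h where "h = min (d/2) 1"
  have h: "0 < h" "h \<le> 1" "h < d" using d(1) by (auto simp: h_def)
  define IA where "IA = (\<lambda>t. integral {0..t} a)"
  define IP where "IP = (\<lambda>t. integral {0..t} p)"
  define P where "P t = (IP (t + h) - IP t) /\<^sub>R h" for t
  define P' where "P' t = (p (t + h) - p t) /\<^sub>R h" for t
  \<comment> \<open>The sup norm of \<open>P'\<close> may blow up as h shrinks. G averages the
    variation in the same way as P averages f, so \<open>G'\<close> dominates \<open>P'\<close>
    pointwise while its integral is bounded independently of h.\<close>
  define G where "G t = (IA (t + h) - IA t) / h" for t
  define G' where "G' t = (a (t + h) - a t) / h" for t
  have shift: "((\<lambda>s. s + h) has_vector_derivative 1) (at t within {0..1})" for t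
    by (auto intro!: derivative_eq_intros)
  have dIP: "(IP has_vector_derivative p t) (at t within {0..2})" if "t \<in> {0..2}" for t
    unfolding IP_def by (rule integral_has_vector_derivative[OF contp that])
  have dIA: "(IA has_vector_derivative a t) (at t within {0..2})" if "t \<in> {0..2}" for t
    unfolding IA_def by (rule integral_has_vector_derivative[OF conta that])
  have sub: "(\<lambda>s. s + h) ` {0..1} \<subseteq> {0..2}" using h by auto
  have avgP: "IP (t + h) - IP t = integral {t..t+h} p" if "t \<in> {0..1}" for t
    using Henstock_Kurzweil_Integration.integral_combine[of 0 t "t + h" p] that h
      integrable_continuous_real[OF continuous_on_subset[OF contp, of "{0..t+h}"]]
    by (simp add: IP_def diff_eq_eq add.commute)
  have avgA: "IA (t + h) - IA t = integral {t..t+h} a" if "t \<in> {0..1}" for t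
    using Henstock_Kurzweil_Integration.integral_combine[of 0 t "t + h" a] that h
      integrable_continuous_real[OF continuous_on_subset[OF conta, of "{0..t+h}"]]
    by (simp add: IA_def diff_eq_eq add.commute)
  have bnd: "norm (integral {t..t+h} (\<lambda>s. p s - w)) \<le> r * h"
    if "t \<in> {0..1}" "\<And>s. s \<in> {t..t+h} \<Longrightarrow> norm (p s - w) \<le> r" for t w r
  proof -
    have "norm (integral {t..t+h} (\<lambda>s. p s - w)) \<le> integral {t..t+h} (\<lambda>_. r)"
      using that h
      by (intro integral_norm_bound_integral integrable_continuous_real continuous_intros
           continuous_on_subset[OF contp]) auto
    then show ?thesis using h by (simp add: mult.commute)
  qed
  show ?thesis
  proof
    fix t :: real assume t: "t \<in> {0..1}"
    have ci: "integral {t..t+h} (\<lambda>s. p s - w) = integral {t..t+h} p - h *\<^sub>R w" for w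
      using t h by (subst Henstock_Kurzweil_Integration.integral_diff)
        (auto intro!: integrable_continuous_real continuous_on_subset[OF contp])
    have pt: "p t = h1_fun f t" using t by (simp add: p_def c_def)
    have "norm (integral {t..t+h} (\<lambda>s. p s - p t)) \<le> \<epsilon> * h"
      using t h by (intro bnd) (auto intro!: less_imp_le d(2)[unfolded dist_norm])
    then have "norm (h *\<^sub>R (P t - p t)) \<le> \<epsilon> * h"
      unfolding ci using h by (simp add: P_def avgP[OF t] scaleR_diff_right)
    then have "norm (P t - p t) \<le> \<epsilon>" using h by (simp add: mult.commute)
    then show "norm (h1_fun f t - P t) \<le> \<epsilon>" using pt by (simp add: norm_minus_commute)
    have "norm (integral {t..t+h} (\<lambda>s. p s - 0)) \<le> (2 * norm f) * h"
      using t by (intro bnd) (auto simp: p_def norm_h1_fun_le)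
    then have "norm (h *\<^sub>R P t) \<le> (2 * norm f) * h"
      using h by (simp add: P_def avgP[OF t])
    then show "norm (P t) \<le> 2 * norm f" using h by (simp add: mult.commute)
    have 1: "((\<lambda>s. IP (s + h)) has_vector_derivative p (t + h)) (at t within {0..1})"
      using vector_diff_chain_within[OF shift[of t] has_vector_derivative_within_subset[OF dIP sub]] t h
      by (auto simp: o_def)
    have 2: "((\<lambda>s. IA (s + h)) has_vector_derivative a (t + h)) (at t within {0..1})"
      using vector_diff_chain_within[OF shift[of t] has_vector_derivative_within_subset[OF dIA sub]] t h
      by (auto simp: o_def)
    have 3: "(IP has_vector_derivative p t) (at t within {0..1})"
      using t by (intro has_vector_derivative_within_subset[OF dIP]) auto
    have 4: "(IA has_vector_derivative a t) (at t within {0..1})"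
      using t by (intro has_vector_derivative_within_subset[OF dIA]) auto
    show "(P has_vector_derivative P' t) (at t within {0..1})"
      unfolding P_def P'_def
      by (rule has_vector_derivative_scaleR[OF _ has_vector_derivative_diff[OF 1 3], of "\<lambda>_. inverse h" 0, simplified])
    have "(G has_vector_derivative G' t) (at t within {0..1})"
      using has_vector_derivative_scaleR[OF _ has_vector_derivative_diff[OF 2 4], of "\<lambda>_. inverse h" 0]
      by (simp add: G_def[abs_def] G'_def field_simps)
    then show "(G has_real_derivative G' t) (at t within {0..1})"
      by (simp add: has_real_derivative_iff_has_vector_derivative)
    have "norm (p (t + h) - p t) \<le> a (t + h) - a t" using t h by (intro incr) auto
    then show "norm (P' t) \<le> G' t"
      using h by (simp add: P'_def G'_def divide_inverse mult.commute mult_left_mono)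
  next
    have "integral {1..1+h} a = integral {1..1+h} (\<lambda>_. A 1)"
      by (intro Henstock_Kurzweil_Integration.integral_cong) (auto simp: a_def c_def min_def)
    then have "G 1 = A 1" using avgA[of 1] h by (simp add: G_def)
    moreover have "0 \<le> integral {0..0+h} a"
    proof (intro integral_nonneg integrable_continuous_real continuous_on_subset[OF conta])
      show "0 \<le> a t" if "t \<in> {0..0+h}" for t
        using amono[of 0 t] A(3) that by (simp add: a_def c_def)
    qed (use h in auto)
    then have "G 0 \<ge> 0" using avgA[of 0] h by (simp add: G_def)
    ultimately show "G 1 - G 0 \<le> norm f" using A(4) by simp
  qed
qed

section \<open>Linear differential equations\<close>

lemma continuous_imp_antiderivative:
  fixes f :: "real \<Rightarrow> 'a::euclidean_space"
  assumes "continuous_on UNIV f"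
  shows "\<exists>F. F 0 = 0 \<and> (\<forall>t. (F has_vector_derivative f t) (at t))"
proof -
  obtain F where F: "\<And>t. (F has_vector_derivative f t) (at t)"
    using einterval_antiderivative[of "-\<infinity>" "\<infinity>" f] assms
    by (auto simp: continuous_on_eq_continuous_at)
  have "((\<lambda>t. F t - F 0) has_vector_derivative f t) (at t)" for t
    by (auto intro!: derivative_eq_intros F)
  then show ?thesis by (intro exI[of _ "\<lambda>t. F t - F 0"]) auto
qed

text \<open>One step of the Picard estimate: an integration raises the power of |t| and divides by
  the new exponent, which builds up the factorials. Negative t is reduced to positive t by
  reflection.\<close>

lemma antiderivative_power_bound:
  fixes F :: "real \<Rightarrow> 'a::real_normed_vector"
  assumes F: "F 0 = 0" "\<And>t. (F has_vector_derivative f t) (at t)"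
    and f: "\<And>t. norm (f t) \<le> C * \<bar>t\<bar> ^ k"
  shows "norm (F t) \<le> C * \<bar>t\<bar> ^ Suc k / Suc k"
proof -
  have *: "norm (F t) \<le> C * t ^ Suc k / Suc k"
    if "t > 0" and F: "F 0 = 0" "\<And>t. (F has_vector_derivative f t) (at t)"
      and f: "\<And>t. norm (f t) \<le> C * \<bar>t\<bar> ^ k"
    for t and F f :: "real \<Rightarrow> 'a"
  proof -
    have "norm (F t - F 0) \<le> C * t ^ Suc k / Suc k - C * 0 ^ Suc k / Suc k"
    proof (rule differentiable_bound_general[where f' = f and \<phi>' = "\<lambda>t. C * t ^ k"])
      show "continuous_on {0..t} F"
        using F(2) by (auto intro!: continuous_at_imp_continuous_on has_vector_derivative_continuous)
      show "((\<lambda>t. C * t ^ Suc k / real (Suc k)) has_vector_derivative C * s ^ k) (at s)" for s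
        using DERIV_cdivide[OF DERIV_cmult[OF DERIV_pow[of "Suc k" s]], of C "real (Suc k)"]
        by (simp add: has_real_derivative_iff_has_vector_derivative del: of_nat_Suc power_Suc)
      show "norm (f s) \<le> C * s ^ k" if "0 < s" for s using f[of s] that by simp
    qed (auto intro!: continuous_intros F that)
    then show ?thesis using F(1) by simp
  qed
  consider "t > 0" | "t = 0" | "t < 0" by linarith
  then show ?thesis
  proof cases
    case 1
    then show ?thesis using *[OF 1 F f] by simp
  next
    case 3
    have "((\<lambda>s. F (- s)) has_vector_derivative - f (- s)) (at s)" for s
    proof -
      have "(uminus has_vector_derivative - 1) (at s)" by (auto intro!: derivative_eq_intros)
      from vector_diff_chain_at[OF this F(2)] show ?thesis by (simp add: o_def)
    qed
    then show ?thesis using *[of "- t" "\<lambda>s. F (- s)" "\<lambda>s. - f (- s)"] 3 F(1) f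
      by (metis (no_types, lifting) abs_minus_cancel abs_of_neg neg_0_less_iff_less
          norm_minus_cancel minus_zero minus_minus)
  qed (use F in simp)
qed

text \<open>The solution is the sum of the iterated integrals \<open>P k\<close> of the initial
  value. They are bounded by (K|t|)^k / k! times the norm of \<open>y0\<close>, so the series and
  the series of its derivatives converge uniformly on bounded intervals, and it may be
  differentiated term by term.\<close>

lemma linear_ode_exists_zero:
  fixes L :: "real \<Rightarrow> 'a \<Rightarrow> 'a::euclidean_space"
  assumes lin: "\<And>t. linear (L t)"
    and bound: "\<And>t y. norm (L t y) \<le> K * norm y"
    and cont: "\<And>y. continuous_on UNIV y \<Longrightarrow> continuous_on UNIV (\<lambda>t. L t (y t))"
  shows "\<exists>y. y 0 = y0 \<and> (\<forall>t. (y has_vector_derivative L t (y t)) (at t))"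
proof -
  have K: "0 \<le> K"
  proof -
    obtain b :: 'a where "b \<in> Basis" using nonempty_Basis by blast
    then show ?thesis using order_trans[OF norm_ge_zero bound[of 0 b]] by simp
  qed
  define A where "A f = (SOME F. F 0 = 0 \<and> (\<forall>t. (F has_vector_derivative f t) (at t)))"
    for f :: "real \<Rightarrow> 'a"
  have A: "A f 0 = 0" "(A f has_vector_derivative f t) (at t)" if "continuous_on UNIV f" for f t
    using someI_ex[OF continuous_imp_antiderivative[OF that]] unfolding A_def by auto
  define P where "P k = ((\<lambda>y. A (\<lambda>t. L t (y t))) ^^ k) (\<lambda>_. y0)" for k
  have P0: "P 0 = (\<lambda>_. y0)" and PS: "P (Suc k) = A (\<lambda>t. L t (P k t))" for k
    by (simp_all add: P_def)
  have contP: "continuous_on UNIV (P k)" for k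
  proof (induction k)
    case (Suc k)
    then show ?case
      unfolding PS using A(2)[OF cont[OF Suc]]
      by (auto intro!: continuous_at_imp_continuous_on has_vector_derivative_continuous)
  qed (simp add: P0)
  have dP: "(P (Suc k) has_vector_derivative L t (P k t)) (at t)" for k t
    unfolding PS by (rule A(2)[OF cont[OF contP]])
  have P_0: "P (Suc k) 0 = 0" for k
    unfolding PS by (rule A(1)[OF cont[OF contP]])
  have bP: "norm (P k t) \<le> norm y0 * K ^ k / fact k * \<bar>t\<bar> ^ k" for k t
  proof (induction k arbitrary: t)
    case (Suc k)
    have "norm (P (Suc k) t) \<le> (norm y0 * K ^ Suc k / fact k) * \<bar>t\<bar> ^ Suc k / Suc k"
    proof (rule antiderivative_power_bound[OF P_0 dP])
      fix t
      have "norm (L t (P k t)) \<le> K * (norm y0 * K ^ k / fact k * \<bar>t\<bar> ^ k)"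
        using bound[of t "P k t"] Suc[of t] K by (meson mult_left_mono order_trans)
      then show "norm (L t (P k t)) \<le> norm y0 * K ^ Suc k / fact k * \<bar>t\<bar> ^ k"
        by (simp add: mult_ac)
    qed
    also have "\<dots> = norm y0 * K ^ Suc k / fact (Suc k) * \<bar>t\<bar> ^ Suc k"
      by (simp add: field_simps)
    finally show ?case .
  qed (simp add: P0)
  \<comment> \<open>\<open>D k\<close> is the derivative of \<open>P k\<close>. The shift of the
    index by one turns the sum of the derivatives into L applied to the sum.\<close>
  define D where "D k t = (case k of 0 \<Rightarrow> 0 | Suc j \<Rightarrow> L t (P j t))" for k t
  have dD: "(P k has_vector_derivative D k t) (at t)" for k t
    by (cases k) (simp_all add: D_def dP P0)
  have bT: "norm (P k t) \<le> norm y0 * ((K * T) ^ k / fact k)" if "\<bar>t\<bar> \<le> T" for k t T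
  proof -
    have "norm (P k t) \<le> norm y0 * K ^ k / fact k * T ^ k"
      using bP[of k t] K that
      by (meson order_trans mult_left_mono power_mono abs_ge_zero divide_nonneg_nonneg
          mult_nonneg_nonneg norm_ge_zero zero_le_power fact_ge_zero)
    then show ?thesis by (simp add: power_mult_distrib field_simps)
  qed
  have sumexp: "summable (\<lambda>k. norm y0 * ((K * T) ^ k / fact k))" for T
    using summable_exp[of "K * T"] by (intro summable_mult) (simp add: divide_inverse mult.commute)
  have sumP: "summable (\<lambda>k. P k t)" for t
    by (rule summable_comparison_test'[OF sumexp[of "\<bar>t\<bar>"], of 0]) (use bT[of t] in auto)
  define y where "y t = (\<Sum>k. P k t)" for t
  have sy: "(\<lambda>k. P k t) sums y t" for t
    unfolding y_def using sumP by (rule summable_sums)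
  have bl: "bounded_linear (L t)" for t
    using lin by (simp add: linear_conv_bounded_linear)
  have sD: "(\<lambda>k. D k t) sums L t (y t)" for t
  proof -
    have "(\<lambda>k. L t (P k t)) sums L t (y t)"
      by (rule bounded_linear.sums[OF bl sy])
    then have "(\<lambda>k. D (Suc k) t) sums L t (y t)" by (simp add: D_def)
    then show ?thesis by (subst (asm) sums_Suc_iff) (simp add: D_def)
  qed
  have "(y has_vector_derivative L t (y t)) (at t)" for t
  proof -
    define S where "S = ball (0::real) (\<bar>t\<bar> + 1)"
    have tS: "t \<in> S" by (simp add: S_def)
    have "uniform_limit S (\<lambda>n x. \<Sum>i<n. D i x) (\<lambda>x. suminf (\<lambda>i. D i x)) sequentially"
    proof (rule Weierstrass_m_test)
      define M where "M k = (case k of 0 \<Rightarrow> 0 | Suc j \<Rightarrow> K * (norm y0 * ((K * (\<bar>t\<bar> + 1)) ^ j / fact j)))" for k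
      show "norm (D k s) \<le> M k" if "s \<in> S" for k s
      proof (cases k)
        case (Suc j)
        have "norm (P j s) \<le> norm y0 * ((K * (\<bar>t\<bar> + 1)) ^ j / fact j)"
          using that by (intro bT) (auto simp: S_def)
        from order_trans[OF bound mult_left_mono[OF this K]]
        show ?thesis by (simp add: Suc D_def M_def)
      qed (simp add: D_def M_def)
      have "summable (\<lambda>k. M (Suc k))" unfolding M_def nat.case by (intro summable_mult sumexp)
      then show "summable M" by (simp add: summable_Suc_iff)
    qed
    then have ul: "uniform_limit S (\<lambda>n x. \<Sum>i<n. D i x) (\<lambda>x. L x (y x)) sequentially"
      using sD by (simp add: sums_iff)
    have "\<exists>g. \<forall>x\<in>S. (\<lambda>n. P n x) sums g x \<and> (g has_derivative (\<lambda>h. h *\<^sub>R L x (y x))) (at x within S)"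
    proof (rule has_derivative_series[OF _ _ _ tS sy])
      show "convex S" by (simp add: S_def)
      show "(P n has_derivative (\<lambda>h. h *\<^sub>R D n x)) (at x within S)" for n x
        using dD[of n x] unfolding has_vector_derivative_def by (rule has_derivative_at_withinI)
      fix e :: real assume "e > 0"
      then have "\<forall>\<^sub>F n in sequentially. \<forall>x\<in>S. dist (\<Sum>i<n. D i x) (L x (y x)) < e"
        using ul by (auto simp: uniform_limit_iff)
      then show "\<forall>\<^sub>F n in sequentially. \<forall>x\<in>S. \<forall>h. norm ((\<Sum>i<n. h *\<^sub>R D i x) - h *\<^sub>R L x (y x)) \<le> e * norm h"
        by eventually_elim
          (auto simp: scaleR_sum_right[symmetric] scaleR_diff_right[symmetric] dist_norm mult.commute[of e]
            intro!: mult_left_mono dest!: bspec less_imp_le)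
    qed
    then obtain g where g: "\<And>x. x \<in> S \<Longrightarrow> (\<lambda>n. P n x) sums g x"
        "\<And>x. x \<in> S \<Longrightarrow> (g has_derivative (\<lambda>h. h *\<^sub>R L x (y x))) (at x within S)" by blast
    have gy: "g x = y x" if "x \<in> S" for x using sums_unique2[OF g(1)[OF that] sy] .
    have "(g has_derivative (\<lambda>h. h *\<^sub>R L t (y t))) (at t)"
      using g(2)[OF tS] at_within_open[OF tS] by (simp add: S_def)
    then have "(y has_derivative (\<lambda>h. h *\<^sub>R L t (y t))) (at t)"
      by (rule has_derivative_transform_within_open[of _ _ _ _ S]) (auto simp: tS gy S_def)
    then show ?thesis by (simp add: has_vector_derivative_def)
  qed
  moreover have "y 0 = y0"
  proof -
    have "P k 0 = (if k = 0 then y0 else 0)" for k using P_0 by (cases k) (simp_all add: P0)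
    then have "(\<lambda>k. P k 0) sums y0" using sums_single[of 0 "\<lambda>_. y0"] by simp
    then show ?thesis using sy sums_unique2 by blast
  qed
  ultimately show ?thesis by blast
qed

text \<open>The initial time is left free because the adjoint solution is prescribed at time 1, not
  at time 0.\<close>

lemma linear_ode_exists:
  fixes L :: "real \<Rightarrow> 'a \<Rightarrow> 'a::euclidean_space"
  assumes lin: "\<And>t. linear (L t)"
    and bound: "\<And>t y. norm (L t y) \<le> K * norm y"
    and cont: "\<And>y. continuous_on UNIV y \<Longrightarrow> continuous_on UNIV (\<lambda>t. L t (y t))"
  shows "\<exists>y. y t0 = y0 \<and> (\<forall>t. (y has_vector_derivative L t (y t)) (at t))"
proof -
  have "continuous_on UNIV (\<lambda>t. L (t + t0) (y t))" if "continuous_on UNIV y" for y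
  proof -
    have "continuous_on UNIV (\<lambda>t. L t (y (t - t0)))"
      by (intro cont continuous_on_compose2[OF that] continuous_intros) auto
    then have "continuous_on UNIV (\<lambda>t. (\<lambda>t. L t (y (t - t0))) (t + t0))"
      by (rule continuous_on_compose2) (auto intro!: continuous_intros)
    then show ?thesis by simp
  qed
  then obtain y where y: "y 0 = y0" "\<And>t. (y has_vector_derivative L (t + t0) (y t)) (at t)"
    using linear_ode_exists_zero[of "\<lambda>t. L (t + t0)" K y0] lin bound by blast
  have "((\<lambda>t. y (t - t0)) has_vector_derivative L t (y (t - t0))) (at t)" for t
  proof -
    have "((\<lambda>t. t - t0) has_vector_derivative 1) (at t)" by (auto intro!: derivative_eq_intros)
    from vector_diff_chain_at[OF this y(2)] show ?thesis by (simp add: o_def)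
  qed
  then show ?thesis using y(1) by (intro exI[of _ "\<lambda>t. y (t - t0)"]) auto
qed

text \<open>The function |y|^2 exp(-2k) is nonincreasing. Only the inner product of y and y' is
  constrained, so the part of a generator that is skew or dissipative costs nothing. The rate
  \<open>k'\<close> may be large on short intervals, as only the increment of k enters the
  bound.\<close>

lemma gronwall_inner:
  fixes y :: "real \<Rightarrow> 'a::real_inner"
  assumes ab: "a \<le> b"
    and y: "\<And>t. t \<in> {a..b} \<Longrightarrow> (y has_vector_derivative y' t) (at t within {a..b})"
    and k: "\<And>t. t \<in> {a..b} \<Longrightarrow> (k has_real_derivative k' t) (at t within {a..b})"
    and le: "\<And>t. t \<in> {a..b} \<Longrightarrow> inner (y t) (y' t) \<le> k' t * (norm (y t))\<^sup>2"
  shows "norm (y b) \<le> norm (y a) * exp (k b - k a)"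
proof -
  define \<phi> where "\<phi> t = inner (y t) (y t) * exp (- 2 * k t)" for t
  have "\<phi> b \<le> \<phi> a"
  proof (rule DERIV_nonpos_imp_decreasing_open[OF ab])
    show "continuous_on {a..b} \<phi>"
    proof -
      have "continuous_on {a..b} y" "continuous_on {a..b} k"
        unfolding continuous_on_eq_continuous_within
        using has_vector_derivative_continuous[OF y] DERIV_continuous[OF k] by blast+
      then show ?thesis unfolding \<phi>_def by (intro continuous_intros)
    qed
    fix t assume t: "a < t" "t < b"
    have at: "at t within {a..b} = at t" using t by (simp add: at_within_Icc_at)
    have yt: "(y has_derivative (\<lambda>h. h *\<^sub>R y' t)) (at t)"
      using y[of t] t at by (simp add: has_vector_derivative_def)
    have kt: "(k has_real_derivative k' t) (at t)" using k[of t] t at by simp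
    have "((\<lambda>t. inner (y t) (y t)) has_real_derivative 2 * inner (y t) (y' t)) (at t)"
      unfolding has_field_derivative_def
      by (auto intro!: derivative_eq_intros yt simp: inner_commute algebra_simps)
    then have "(\<phi> has_real_derivative
        2 * inner (y t) (y' t) * exp (- 2 * k t) + (inner (y t) (y t)) * (exp (- 2 * k t) * (- 2 * k' t))) (at t)"
      unfolding \<phi>_def by (auto intro!: derivative_eq_intros kt)
    moreover have "2 * inner (y t) (y' t) * exp (- 2 * k t) + (inner (y t) (y t)) * (exp (- 2 * k t) * (- 2 * k' t))
        = 2 * exp (- 2 * k t) * (inner (y t) (y' t) - k' t * (norm (y t))\<^sup>2)"
      by (simp add: power2_norm_eq_inner algebra_simps)
    moreover have "\<dots> \<le> 0" using le[of t] t by (intro mult_nonneg_nonpos) auto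
    ultimately show "\<exists>d. (\<phi> has_real_derivative d) (at t) \<and> d \<le> 0" by metis
  qed
  then have "inner (y b) (y b) * exp (- 2 * k b) * exp (2 * k b) \<le> inner (y a) (y a) * exp (- 2 * k a) * exp (2 * k b)"
    unfolding \<phi>_def by (intro mult_right_mono) auto
  then have "(norm (y b))\<^sup>2 \<le> (norm (y a) * exp (k b - k a))\<^sup>2"
    by (simp add: power2_norm_eq_inner[symmetric] power_mult_distrib exp_double[symmetric]
      mult.assoc exp_add[symmetric] algebra_simps)
  then show ?thesis by (rule power2_le_imp_le) simp
qed

section \<open>The Neumann characteristic function\<close>

lemma has_vector_derivative_vecI:
  fixes f :: "real \<Rightarrow> 'a::real_normed_vector ^ 'n"
  assumes "\<And>i. ((\<lambda>t. f t $ i) has_vector_derivative f' $ i) F"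
  shows "(f has_vector_derivative f') F"
  using assms unfolding has_vector_derivative_def has_derivative_def
  by (auto intro!: vec_tendstoI bounded_linear_scaleR_left)

lemma has_vector_derivative_entry:
  fixes M :: "real \<Rightarrow> complex^2^2" and M' :: "complex^2^2"
  assumes "(M has_vector_derivative M') F"
  shows "((\<lambda>t. M t $ i $ j) has_vector_derivative M' $ i $ j) F"
  using bounded_linear.has_vector_derivative[OF bounded_linear_vec_nth
      bounded_linear.has_vector_derivative[OF bounded_linear_vec_nth assms]] .

text \<open>The coefficient matrix has trace zero, so three scalar functions describe it: its rows
  are (a, b) and (c, -a).\<close>

definition coef_a :: "complex \<Rightarrow> potential \<Rightarrow> real \<Rightarrow> complex" where
  "coef_a z \<psi> t = - \<i> * (2 * z\<^sup>2 + h1_fun (\<psi> $ 1) t * h1_fun (\<psi> $ 2) t)"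

definition coef_b :: "complex \<Rightarrow> potential \<Rightarrow> real \<Rightarrow> complex" where
  "coef_b z \<psi> t = 2 * z * h1_fun (\<psi> $ 1) t + \<i> * h1_fun (\<psi> $ 3) t"

definition coef_c :: "complex \<Rightarrow> potential \<Rightarrow> real \<Rightarrow> complex" where
  "coef_c z \<psi> t = 2 * z * h1_fun (\<psi> $ 2) t - \<i> * h1_fun (\<psi> $ 4) t"

lemma continuous_on_coef [continuous_intros]:
  "continuous_on S (coef_a z \<psi>)" "continuous_on S (coef_b z \<psi>)" "continuous_on S (coef_c z \<psi>)"
  unfolding coef_a_def coef_b_def coef_c_def by (intro continuous_intros)+

lemma coeff_mat_eq:
  "coeff_mat t z \<psi> $ 1 $ 1 = coef_a z \<psi> t" "coeff_mat t z \<psi> $ 1 $ 2 = coef_b z \<psi> t"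
  "coeff_mat t z \<psi> $ 2 $ 1 = coef_c z \<psi> t" "coeff_mat t z \<psi> $ 2 $ 2 = - coef_a z \<psi> t"
  by (simp_all add: coeff_mat_def V_mat_def sigma3_def coef_a_def coef_b_def coef_c_def
      Let_def algebra_simps)

lemma norm_h1_fun_component: "norm (h1_fun (\<psi> $ j) t) \<le> 2 * norm (\<psi> :: potential)"
  using norm_h1_fun_le[of "\<psi> $ j" t] Finite_Cartesian_Product.norm_nth_le[of \<psi> j] by linarith

lemma norm_coef_le:
  assumes "norm \<psi> \<le> R" "norm z \<le> r"
  shows "norm (coef_a z \<psi> t) \<le> 2 * r\<^sup>2 + 4 * R\<^sup>2 + 4 * r * R + 2 * R"
    "norm (coef_b z \<psi> t) \<le> 2 * r\<^sup>2 + 4 * R\<^sup>2 + 4 * r * R + 2 * R"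
    "norm (coef_c z \<psi> t) \<le> 2 * r\<^sup>2 + 4 * R\<^sup>2 + 4 * r * R + 2 * R"
proof -
  have R: "0 \<le> R" "0 \<le> r" using assms norm_ge_zero order_trans by blast+
  have h: "norm (h1_fun (\<psi> $ j) t) \<le> 2 * R" for j
    using norm_h1_fun_component[of \<psi> j t] assms(1) by linarith
  have hh: "norm (h1_fun (\<psi> $ 1) t) * norm (h1_fun (\<psi> $ 2) t) \<le> 2 * R * (2 * R)"
    by (intro mult_mono h) (use R in auto)
  have zh: "norm z * norm (h1_fun (\<psi> $ j) t) \<le> r * (2 * R)" for j
    by (intro mult_mono h assms) (use R in auto)
  have zz: "(norm z)\<^sup>2 \<le> r\<^sup>2" using assms by (intro power_mono) auto
  have p: "0 \<le> r\<^sup>2" "0 \<le> R\<^sup>2" "0 \<le> r * R" using R by auto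
  have "norm (coef_a z \<psi> t) \<le> 2 * (norm z)\<^sup>2 + norm (h1_fun (\<psi> $ 1) t) * norm (h1_fun (\<psi> $ 2) t)"
    using norm_triangle_ineq[of "2 * z\<^sup>2" "h1_fun (\<psi> $ 1) t * h1_fun (\<psi> $ 2) t"]
    by (simp add: coef_a_def norm_mult norm_power)
  moreover have "2 * R * (2 * R) = 4 * R\<^sup>2" by (simp add: power2_eq_square)
  ultimately show "norm (coef_a z \<psi> t) \<le> 2 * r\<^sup>2 + 4 * R\<^sup>2 + 4 * r * R + 2 * R"
    using hh zz p R by linarith
  have "norm (coef_b z \<psi> t) \<le> 2 * (norm z * norm (h1_fun (\<psi> $ 1) t)) + norm (h1_fun (\<psi> $ 3) t)"
    using norm_triangle_ineq[of "2 * z * h1_fun (\<psi> $ 1) t" "\<i> * h1_fun (\<psi> $ 3) t"]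
    by (simp add: coef_b_def norm_mult)
  then show "norm (coef_b z \<psi> t) \<le> 2 * r\<^sup>2 + 4 * R\<^sup>2 + 4 * r * R + 2 * R"
    using zh[of 1] h[of 3] p R by linarith
  have "norm (coef_c z \<psi> t) \<le> 2 * (norm z * norm (h1_fun (\<psi> $ 2) t)) + norm (h1_fun (\<psi> $ 4) t)"
    using norm_triangle_ineq4[of "2 * z * h1_fun (\<psi> $ 2) t" "\<i> * h1_fun (\<psi> $ 4) t"]
    by (simp add: coef_c_def norm_mult)
  then show "norm (coef_c z \<psi> t) \<le> 2 * r\<^sup>2 + 4 * R\<^sup>2 + 4 * r * R + 2 * R"
    using zh[of 2] h[of 4] p R by linarith
qed

definition zs_solution ::
  "complex \<Rightarrow> potential \<Rightarrow> (real \<Rightarrow> complex) \<Rightarrow> (real \<Rightarrow> complex) \<Rightarrow> bool" where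
  "zs_solution z \<psi> u v \<longleftrightarrow>
     (\<forall>t. (u has_vector_derivative coef_a z \<psi> t * u t + coef_b z \<psi> t * v t) (at t)) \<and>
     (\<forall>t. (v has_vector_derivative coef_c z \<psi> t * u t - coef_a z \<psi> t * v t) (at t))"

lemma norm_fst_snd_bound:
  fixes a b c u v :: complex
  assumes "norm a \<le> K" "norm b \<le> K" "norm c \<le> K"
  shows "norm (a * u + b * v, c * u - a * v) \<le> 4 * K * norm (u, v)"
proof -
  have K: "0 \<le> K" using assms(1) norm_ge_zero order_trans by blast
  have uv: "norm u \<le> norm (u, v)" "norm v \<le> norm (u, v)"
    using norm_fst_le[of u v] norm_snd_le[of v u] by simp_all
  have m: "norm (x * y) \<le> K * norm (u, v)" if "norm x \<le> K" "norm y \<le> norm (u, v)" for x y :: complex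
    unfolding norm_mult using that K by (intro mult_mono) auto
  have "norm (a * u + b * v, c * u - a * v) \<le> norm (a * u + b * v) + norm (c * u - a * v)"
    by (rule norm_Pair_le)
  also have "\<dots> \<le> norm (a * u) + norm (b * v) + (norm (c * u) + norm (a * v))"
    by (intro add_mono norm_triangle_ineq norm_triangle_ineq4)
  also have "\<dots> \<le> 4 * (K * norm (u, v))"
    using m[OF assms(1) uv(1)] m[OF assms(2) uv(2)] m[OF assms(3) uv(1)] m[OF assms(1) uv(2)] by linarith
  finally show ?thesis by simp
qed

lemma zs_solution_exists: "\<exists>u v. zs_solution z \<psi> u v \<and> u t0 = x \<and> v t0 = y"
proof -
  define L where "L t = (\<lambda>(u, v). (coef_a z \<psi> t * u + coef_b z \<psi> t * v, coef_c z \<psi> t * u - coef_a z \<psi> t * v))"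
    for t
  have "\<exists>w. w t0 = (x, y) \<and> (\<forall>t. (w has_vector_derivative L t (w t)) (at t))"
  proof (rule linear_ode_exists)
    show "linear (L t)" for t
      by (rule linearI) (auto simp: L_def algebra_simps)
    show "norm (L t w) \<le> 4 * (2 * (norm z)\<^sup>2 + 4 * (norm \<psi>)\<^sup>2 + 4 * norm z * norm \<psi> + 2 * norm \<psi>) * norm w" for t w
      using norm_fst_snd_bound[OF norm_coef_le[OF order_refl order_refl, where z = z and \<psi> = \<psi> and t = t], of "fst w" "snd w"]
      by (cases w) (simp add: L_def)
    show "continuous_on UNIV (\<lambda>t. L t (w t))" if "continuous_on UNIV w" for w
      unfolding L_def case_prod_unfold by (intro continuous_intros that)
  qed
  then obtain w where w: "w t0 = (x, y)" "\<And>t. (w has_vector_derivative L t (w t)) (at t)" by blast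
  have "zs_solution z \<psi> (\<lambda>t. fst (w t)) (\<lambda>t. snd (w t))"
    unfolding zs_solution_def
    using bounded_linear.has_vector_derivative[OF bounded_linear_fst w(2)]
      bounded_linear.has_vector_derivative[OF bounded_linear_snd w(2)]
    by (auto simp: L_def case_prod_unfold)
  then show ?thesis using w(1) by (metis fst_conv snd_conv)
qed

text \<open>Gronwall's inequality forward in time, and for the reflected solution when t is
  negative. Negative times matter because a fundamental solution is a function on the whole line and
  has to be unique there.\<close>

lemma zs_solution_bound:
  assumes "zs_solution z \<psi> u v" "\<And>t. norm (coef_a z \<psi> t) \<le> K" "\<And>t. norm (coef_b z \<psi> t) \<le> K"
    "\<And>t. norm (coef_c z \<psi> t) \<le> K"
  shows "norm (u t, v t) \<le> norm (u 0, v 0) * exp (4 * K * \<bar>t\<bar>)"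
proof -
  define y where "y s = (u s, v s)" for s
  define y' where "y' s = (coef_a z \<psi> s * u s + coef_b z \<psi> s * v s, coef_c z \<psi> s * u s - coef_a z \<psi> s * v s)" for s
  have dy: "(y has_vector_derivative y' s) (at s within S)" for s S
    unfolding y_def y'_def using assms(1) unfolding zs_solution_def
    by (intro has_vector_derivative_Pair) (auto intro: has_vector_derivative_at_within)
  have "\<bar>inner (y s) (y' s)\<bar> \<le> 4 * K * (norm (y s))\<^sup>2" for s
  proof -
    have "\<bar>inner (y s) (y' s)\<bar> \<le> norm (y s) * norm (y' s)" by (rule Cauchy_Schwarz_ineq2)
    also have "\<dots> \<le> norm (y s) * (4 * K * norm (y s))"
      unfolding y_def y'_def by (intro mult_left_mono norm_fst_snd_bound assms) auto
    finally show ?thesis by (simp add: power2_eq_square mult_ac)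
  qed
  then have in1: "inner (y s) (y' s) \<le> 4 * K * (norm (y s))\<^sup>2" and in2: "- inner (y s) (y' s) \<le> 4 * K * (norm (y s))\<^sup>2" for s
    by (simp_all add: abs_le_iff)
  have kd: "((\<lambda>t. 4 * K * t) has_real_derivative 4 * K) (at s within S)" for s S
    by (auto intro!: derivative_eq_intros)
  have "norm (y t) \<le> norm (y 0) * exp (4 * K * \<bar>t\<bar>)"
  proof (cases "t \<ge> 0")
    case True
    show ?thesis using gronwall_inner[OF True dy kd in1] True by simp
  next
    case False
    have "(uminus has_vector_derivative - 1) (at s within S)" for s :: real and S
      by (auto intro!: derivative_eq_intros)
    from vector_diff_chain_within[OF this dy]
    have "((\<lambda>s. y (- s)) has_vector_derivative - y' (- s)) (at s within S)" for s S
      by (simp add: o_def)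
    then show ?thesis using gronwall_inner[of 0 "- t" "\<lambda>s. y (- s)" "\<lambda>s. - y' (- s)", OF _ _ kd] in2 False
      by simp
  qed
  then show ?thesis by (simp add: y_def)
qed

lemma zs_solution_diff:
  assumes "zs_solution z \<psi> u v" "zs_solution z \<psi> u' v'"
  shows "zs_solution z \<psi> (\<lambda>t. u t - u' t) (\<lambda>t. v t - v' t)"
  using assms unfolding zs_solution_def
  by (auto intro!: derivative_eq_intros simp: algebra_simps)

lemma zs_solution_unique:
  assumes "zs_solution z \<psi> u v" "zs_solution z \<psi> u' v'" "u 0 = u' 0" "v 0 = v' 0"
  shows "u t = u' t \<and> v t = v' t"
  using zs_solution_bound[OF zs_solution_diff[OF assms(1,2)]
      norm_coef_le[OF order_refl order_refl], of t] assms(3,4)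
  by (simp add: norm_prod_def sum_power2_le_zero_iff)

lemma fundamental_columns:
  fixes M :: "real \<Rightarrow> complex^2^2"
  assumes "is_fundamental_solution z \<psi> M"
  shows "zs_solution z \<psi> (\<lambda>t. M t $ 1 $ j) (\<lambda>t. M t $ 2 $ j)"
proof -
  have "((\<lambda>t. M t $ i $ j) has_vector_derivative (coeff_mat t z \<psi> ** M t) $ i $ j) (at t)" for i t
    using assms by (intro has_vector_derivative_entry) (simp add: is_fundamental_solution_def)
  from this[of 1] this[of 2] show ?thesis
    by (simp add: zs_solution_def matrix_matrix_mult_def sum_2 coeff_mat_eq)
qed

text \<open>\<open>M_mat\<close> is a definite description, so existence and uniqueness come before
  any use of its entries. The columns are the solutions with the unit vectors as initial
  values.\<close>

lemma fundamental_solution: "is_fundamental_solution z \<psi> (\<lambda>t. M_mat t z \<psi>)"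
proof -
  obtain u1 v1 where 1: "zs_solution z \<psi> u1 v1" "u1 0 = 1" "v1 0 = 0"
    using zs_solution_exists[of z \<psi> 0 1 0] by blast
  obtain u2 v2 where 2: "zs_solution z \<psi> u2 v2" "u2 0 = 0" "v2 0 = 1"
    using zs_solution_exists[of z \<psi> 0 0 1] by blast
  define M :: "real \<Rightarrow> complex^2^2" where "M t = vector [vector [u1 t, u2 t], vector [v1 t, v2 t]]" for t
  have M: "is_fundamental_solution z \<psi> M"
    unfolding is_fundamental_solution_def
  proof (intro conjI allI)
    show "M 0 = mat 1"
      using 1 2 by (simp add: vec_eq_iff forall_2 M_def mat_def)
    fix t
    show "(M has_vector_derivative coeff_mat t z \<psi> ** M t) (at t)"
    proof (intro has_vector_derivative_vecI)
      have "\<forall>i j. ((\<lambda>t. M t $ i $ j) has_vector_derivative (coeff_mat t z \<psi> ** M t) $ i $ j) (at t)"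
        using 1(1) 2(1)
        by (simp add: forall_2 M_def zs_solution_def matrix_matrix_mult_def sum_2 coeff_mat_eq)
      then show "((\<lambda>t. M t $ i $ j) has_vector_derivative (coeff_mat t z \<psi> ** M t) $ i $ j) (at t)" for i j
        by blast
    qed
  qed
  have "M' = M" if "is_fundamental_solution z \<psi> M'" for M'
  proof
    fix t
    have "M' t $ 1 $ j = M t $ 1 $ j \<and> M' t $ 2 $ j = M t $ 2 $ j" for j
      using M that
      by (intro zs_solution_unique[OF fundamental_columns fundamental_columns])
        (auto simp: is_fundamental_solution_def)
    then show "M' t = M t" by (simp add: vec_eq_iff forall_2)
  qed
  then have "(THE M. is_fundamental_solution z \<psi> M) = M" using M by (intro the_equality)
  then show ?thesis using M by (simp add: M_mat_def)
qed

text \<open>\<open>chi_N\<close> only involves the solution \<open>M (-1, 1)\<^sup>T\<close>.\<close>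

lemma chi_N_eq:
  assumes "zs_solution z \<psi> u v" "u 0 = -1" "v 0 = 1"
  shows "chi_N z \<psi> = (u 1 + v 1) / (2 * \<i>)"
proof -
  let ?M = "\<lambda>t. M_mat t z \<psi>"
  have "zs_solution z \<psi> (\<lambda>t. ?M t $ 1 $ 2 - ?M t $ 1 $ 1) (\<lambda>t. ?M t $ 2 $ 2 - ?M t $ 2 $ 1)"
    by (intro zs_solution_diff fundamental_columns fundamental_solution)
  from zs_solution_unique[OF this assms(1), of 1] assms(2,3) fundamental_solution[of z \<psi>]
  have "?M 1 $ 1 $ 2 - ?M 1 $ 1 $ 1 = u 1" "?M 1 $ 2 $ 2 - ?M 1 $ 2 $ 1 = v 1"
    by (auto simp: is_fundamental_solution_def mat_def)
  then show ?thesis by (simp add: chi_N_def Let_def algebra_simps)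
qed

lemma chi_N_solution:
  obtains u v where "zs_solution z \<psi> u v" "u 0 = -1" "v 0 = 1" "chi_N z \<psi> = (u 1 + v 1) / (2 * \<i>)"
  using zs_solution_exists[of z \<psi> 0 "-1" 1] chi_N_eq by metis

subsection \<open>Joint analyticity\<close>

lemma has_derivative_quadratic_remainder:
  fixes f :: "'a::real_normed_vector \<Rightarrow> 'b::real_normed_vector"
  assumes D: "bounded_linear D"
    and le: "\<And>h. norm h \<le> 1 \<Longrightarrow> norm (f (x + h) - f x - D h) \<le> C * (norm h)\<^sup>2"
  shows "(f has_derivative D) (at x)"
proof -
  have "((\<lambda>h. norm (f (x + h) - f x - D h) / norm h) \<longlongrightarrow> 0) (at 0)"
  proof (rule tendsto_sandwich[where f = "\<lambda>_. 0" and h = "\<lambda>h. C * norm h"])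
    have "\<forall>\<^sub>F h in at (0::'a). norm h \<le> 1"
      unfolding eventually_at by (rule exI[of _ 1]) auto
    then show "\<forall>\<^sub>F h in at 0. norm (f (x + h) - f x - D h) / norm h \<le> C * norm h"
    proof eventually_elim
      case (elim h)
      show ?case using le[OF elim]
        by (cases "h = 0") (auto simp: divide_le_eq power2_eq_square mult.assoc linear_0 D
            bounded_linear.linear)
    qed
    show "((\<lambda>h::'a. C * norm h) \<longlongrightarrow> 0) (at 0)" by (auto intro!: tendsto_eq_intros)
  qed auto
  then show ?thesis using D by (simp add: has_derivative_at)
qed

lemma has_vector_derivative_imp_continuous_on:
  assumes "\<And>t. (f has_vector_derivative f' t) (at t)"
  shows "continuous_on S f"
  by (intro continuous_at_imp_continuous_on ballI has_vector_derivative_continuous[OF assms])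

lemma continuous_Icc_bound:
  fixes f :: "real \<Rightarrow> 'a::real_normed_vector"
  assumes "continuous_on {a..b} f"
  obtains S where "0 \<le> S" "\<And>t. t \<in> {a..b} \<Longrightarrow> norm (f t) \<le> S"
proof -
  have "bounded (f ` {a..b})" using assms by (intro compact_imp_bounded compact_continuous_image) auto
  then obtain S where "\<forall>x\<in>f ` {a..b}. norm x \<le> S" by (auto simp: bounded_iff)
  then show ?thesis using that[of "max 0 S"] by (auto simp: le_max_iff_disj)
qed

text \<open>The derivative of \<open>chi_N\<close> in the potential consists of integrals of this
  form, with \<beta> built from a solution and an adjoint solution. The second claim is the complex
  linearity that \<open>analytic_on_potentials\<close> demands.\<close>

lemma integral_pairing:
  assumes "continuous_on {0..1} \<beta>"
  shows "bounded_linear (\<lambda>h :: h1. integral {0..1} (\<lambda>t. \<beta> t * h1_fun h t))"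
    and "integral {0..1} (\<lambda>t. \<beta> t * h1_fun (h1_scaleC c h) t) = c * integral {0..1} (\<lambda>t. \<beta> t * h1_fun h t)"
proof -
  have i: "(\<lambda>t. \<beta> t * h1_fun h t) integrable_on {0..1}" for h
    by (intro integrable_continuous_real continuous_intros assms)
  have s: "integral {0..1} (\<lambda>t. \<beta> t * (c * h1_fun h t)) = c * integral {0..1} (\<lambda>t. \<beta> t * h1_fun h t)" for c h
    by (subst integral_mult_right[symmetric]) (simp add: mult_ac)
  then show "integral {0..1} (\<lambda>t. \<beta> t * h1_fun (h1_scaleC c h) t) = c * integral {0..1} (\<lambda>t. \<beta> t * h1_fun h t)"
    by simp
  obtain S where S: "0 \<le> S" "\<And>t. t \<in> {0..1} \<Longrightarrow> norm (\<beta> t) \<le> S"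
    using continuous_Icc_bound[OF assms] by blast
  show "bounded_linear (\<lambda>h :: h1. integral {0..1} (\<lambda>t. \<beta> t * h1_fun h t))"
  proof (rule bounded_linear_intro)
    show "integral {0..1} (\<lambda>t. \<beta> t * h1_fun (f + g) t) =
        integral {0..1} (\<lambda>t. \<beta> t * h1_fun f t) + integral {0..1} (\<lambda>t. \<beta> t * h1_fun g t)" for f g
      by (simp add: distrib_left Henstock_Kurzweil_Integration.integral_add i)
    show "integral {0..1} (\<lambda>t. \<beta> t * h1_fun (r *\<^sub>R f) t) = r *\<^sub>R integral {0..1} (\<lambda>t. \<beta> t * h1_fun f t)" for r f
      using s[of "of_real r" f] by (simp add: scaleR_conv_of_real)
    show "norm (integral {0..1} (\<lambda>t. \<beta> t * h1_fun f t)) \<le> norm f * (2 * S)" for f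
    proof -
      have "norm (integral {0..1} (\<lambda>t. \<beta> t * h1_fun f t)) \<le> (2 * S * norm f) * (1 - 0)"
      proof (rule integral_bound)
        show "continuous_on {0..1} (\<lambda>t. \<beta> t * h1_fun f t)" by (intro continuous_intros assms)
        show "norm (\<beta> t * h1_fun f t) \<le> 2 * S * norm f" if "t \<in> {0..1}" for t
          using mult_mono[OF S(2)[OF that] norm_h1_fun_le[of f t] S(1)] by (simp add: norm_mult)
      qed simp
      then show ?thesis by (simp add: mult_ac)
    qed
  qed
qed

lemma zs_solution_perturb:
  assumes sol: "zs_solution z \<psi> u v" "zs_solution z' \<psi>' u' v'" "u' 0 = u 0" "v' 0 = v 0"
    and K: "\<And>t. norm (coef_a z' \<psi>' t) \<le> K" "\<And>t. norm (coef_b z' \<psi>' t) \<le> K"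
      "\<And>t. norm (coef_c z' \<psi>' t) \<le> K"
    and \<epsilon>: "\<And>t. norm (coef_a z' \<psi>' t - coef_a z \<psi> t) \<le> \<epsilon>" "\<And>t. norm (coef_b z' \<psi>' t - coef_b z \<psi> t) \<le> \<epsilon>"
      "\<And>t. norm (coef_c z' \<psi>' t - coef_c z \<psi> t) \<le> \<epsilon>"
    and Y: "\<And>t. t \<in> {0..1} \<Longrightarrow> norm (u t, v t) \<le> Y"
    and t: "t \<in> {0..1}"
  shows "norm (u' t - u t, v' t - v t) \<le> 4 * \<epsilon> * Y * exp (4 * K + 1)"
proof -
  define \<eta> where "\<eta> = 4 * \<epsilon> * Y"
  have \<epsilon>0: "0 \<le> \<epsilon>" using \<epsilon>(1)[of 0] norm_ge_zero order_trans by blast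
  have K0: "0 \<le> K" using K(1)[of 0] norm_ge_zero order_trans by blast
  have \<eta>0: "0 \<le> \<eta>" using \<epsilon>0 order_trans[OF norm_ge_zero Y[of 0]] by (simp add: \<eta>_def)
  define du where "du s = u' s - u s" for s
  define dv where "dv s = v' s - v s" for s
  define d1 where "d1 s = (coef_a z' \<psi>' s * du s + coef_b z' \<psi>' s * dv s, coef_c z' \<psi>' s * du s - coef_a z' \<psi>' s * dv s)" for s
  define d2 where "d2 s = ((coef_a z' \<psi>' s - coef_a z \<psi> s) * u s + (coef_b z' \<psi>' s - coef_b z \<psi> s) * v s,
      (coef_c z' \<psi>' s - coef_c z \<psi> s) * u s - (coef_a z' \<psi>' s - coef_a z \<psi> s) * v s)" for s
  \<comment> \<open>The bound \<eta> for the source term is carried along as a constant component.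
    This makes the inhomogeneous estimate a homogeneous one for y, to which
    \<open>gronwall_inner\<close> applies; the extra 1 in the exponent pays for the mixed product of
    the difference and \<eta>.\<close>
  define y where "y s = ((du s, dv s), \<eta>)" for s
  have D: "(y has_vector_derivative (d1 s + d2 s, 0)) (at s within S)" for s S
  proof -
    have "(u has_vector_derivative coef_a z \<psi> s * u s + coef_b z \<psi> s * v s) (at s)"
      "(v has_vector_derivative coef_c z \<psi> s * u s - coef_a z \<psi> s * v s) (at s)"
      "(u' has_vector_derivative coef_a z' \<psi>' s * u' s + coef_b z' \<psi>' s * v' s) (at s)"
      "(v' has_vector_derivative coef_c z' \<psi>' s * u' s - coef_a z' \<psi>' s * v' s) (at s)"
      using sol(1,2) unfolding zs_solution_def by blast+
    note d = this[THEN has_vector_derivative_at_within, of S]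
    have "(y has_vector_derivative
        ((coef_a z' \<psi>' s * u' s + coef_b z' \<psi>' s * v' s - (coef_a z \<psi> s * u s + coef_b z \<psi> s * v s),
          coef_c z' \<psi>' s * u' s - coef_a z' \<psi>' s * v' s - (coef_c z \<psi> s * u s - coef_a z \<psi> s * v s)), 0))
        (at s within S)"
      unfolding y_def du_def dv_def
      by (intro has_vector_derivative_Pair has_vector_derivative_diff d has_vector_derivative_const)
    then show ?thesis
      by (rule has_vector_derivative_eq_rhs) (simp add: d1_def d2_def du_def dv_def algebra_simps)
  qed
  have kd: "((\<lambda>t. (4 * K + 1) * t) has_real_derivative 4 * K + 1) (at s within S)" for s S
    by (auto intro!: derivative_eq_intros)
  have ineq: "inner (y s) (d1 s + d2 s, 0) \<le> (4 * K + 1) * (norm (y s))\<^sup>2" if s: "s \<in> {0..t}" for s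
  proof -
    let ?n = "norm (du s, dv s)"
    have n1: "norm (d1 s) \<le> 4 * K * ?n"
      unfolding d1_def by (rule norm_fst_snd_bound[OF K])
    have "norm (d2 s) \<le> 4 * \<epsilon> * norm (u s, v s)"
      unfolding d2_def by (rule norm_fst_snd_bound[OF \<epsilon>])
    also have "\<dots> \<le> \<eta>" unfolding \<eta>_def using \<epsilon>0 s t by (intro mult_left_mono Y) auto
    finally have n2: "norm (d2 s) \<le> \<eta>" .
    have "inner (y s) (d1 s + d2 s, 0) = inner (du s, dv s) (d1 s + d2 s)" by (simp add: y_def)
    also have "\<dots> \<le> ?n * norm (d1 s + d2 s)" by (rule norm_cauchy_schwarz)
    also have "\<dots> \<le> ?n * (4 * K * ?n + \<eta>)"
      using n1 n2 by (intro mult_left_mono order_trans[OF norm_triangle_ineq]) auto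
    also have "\<dots> \<le> 4 * K * ?n\<^sup>2 + (?n\<^sup>2 + \<eta>\<^sup>2)"
    proof -
      have "0 \<le> ?n * \<eta>" using \<eta>0 by simp
      then have "?n * \<eta> \<le> ?n\<^sup>2 + \<eta>\<^sup>2" using sum_squares_bound[of ?n \<eta>] by linarith
      then show ?thesis by (simp add: distrib_left power2_eq_square mult_ac)
    qed
    also have "\<dots> \<le> (4 * K + 1) * (?n\<^sup>2 + \<eta>\<^sup>2)"
      using K0 by (simp add: algebra_simps)
    also have "?n\<^sup>2 + \<eta>\<^sup>2 = (norm (y s))\<^sup>2"
      by (simp add: y_def norm_prod_def)
    finally show ?thesis .
  qed
  have "norm (du t, dv t) \<le> norm (y t)" using norm_fst_le[of "(du t, dv t)" \<eta>] by (simp add: y_def)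
  also have "\<dots> \<le> norm (y 0) * exp ((4 * K + 1) * t - (4 * K + 1) * 0)"
    using t by (intro gronwall_inner[OF _ D kd ineq]) auto
  also have "norm (y 0) = \<eta>" using sol \<eta>0 by (simp add: y_def du_def dv_def norm_prod_def)
  also have "\<eta> * exp ((4 * K + 1) * t - (4 * K + 1) * 0) \<le> \<eta> * exp (4 * K + 1)"
    using t K0 mult_left_le[of t "4 * K + 1"] \<eta>0 by (intro mult_left_mono) auto
  finally show ?thesis by (simp add: \<eta>_def du_def dv_def)
qed

text \<open>The adjoint solution is a rotated solution because the coefficient matrix has trace zero.\<close>

lemma adjoint_solution:
  obtains \<zeta>1 \<zeta>2 where "\<zeta>1 1 = 1" "\<zeta>2 1 = 1"
    "\<And>t. (\<zeta>1 has_vector_derivative - (coef_a z \<psi> t * \<zeta>1 t + coef_c z \<psi> t * \<zeta>2 t)) (at t)"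
    "\<And>t. (\<zeta>2 has_vector_derivative - (coef_b z \<psi> t * \<zeta>1 t - coef_a z \<psi> t * \<zeta>2 t)) (at t)"
proof -
  obtain p q where pq: "zs_solution z \<psi> p q" "p 1 = 1" "q 1 = -1"
    using zs_solution_exists by blast
  show ?thesis
  proof (rule that[of "\<lambda>t. - q t" p])
    show "((\<lambda>t. - q t) has_vector_derivative - (coef_a z \<psi> t * - q t + coef_c z \<psi> t * p t)) (at t)" for t
      using pq(1) unfolding zs_solution_def by (auto intro!: derivative_eq_intros)
    show "(p has_vector_derivative - (coef_b z \<psi> t * - q t - coef_a z \<psi> t * p t)) (at t)" for t
      using pq(1) unfolding zs_solution_def by (auto simp: algebra_simps)
  qed (use pq in auto)
qed

text \<open>The pairing of adjoint solution and solution is constant in t if both belong to the same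
  coefficients. For perturbed coefficients its derivative contains only the coefficient differences,
  so the increment of 2i \<open>chi_N\<close> is exactly one integral. Replacing there the
  differences by their linear parts and the perturbed solution by the old one leaves errors of
  second order.\<close>

lemma chi_N_joint_derivative:
  "\<exists>c D. (\<forall>k h. D (potential_scaleC k h) = k * D h) \<and>
     ((\<lambda>x. chi_N (fst x) (snd x)) has_derivative (\<lambda>x. c * fst x + D (snd x))) (at (z, \<psi>))"
proof -
  obtain \<zeta>1 \<zeta>2 where \<zeta>: "\<zeta>1 1 = 1" "\<zeta>2 1 = 1"
    "\<And>t. (\<zeta>1 has_vector_derivative - (coef_a z \<psi> t * \<zeta>1 t + coef_c z \<psi> t * \<zeta>2 t)) (at t)"
    "\<And>t. (\<zeta>2 has_vector_derivative - (coef_b z \<psi> t * \<zeta>1 t - coef_a z \<psi> t * \<zeta>2 t)) (at t)"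
    using adjoint_solution by blast
  obtain u v where uv: "zs_solution z \<psi> u v" "u 0 = -1" "v 0 = 1" "chi_N z \<psi> = (u 1 + v 1) / (2 * \<i>)"
    using chi_N_solution by blast
  have c\<zeta>: "continuous_on S \<zeta>1" "continuous_on S \<zeta>2" for S
    by (rule has_vector_derivative_imp_continuous_on, rule \<zeta>(3) \<zeta>(4))+
  have csol: "continuous_on S u" "continuous_on S v" if "zs_solution z' \<psi>' u v" for z' \<psi>' u v S
    by (rule has_vector_derivative_imp_continuous_on,
        use that in \<open>auto simp: zs_solution_def\<close>)+
  note cuv = csol[OF uv(1)]
  let ?p = "\<lambda>j t. h1_fun (\<psi> $ j) t"
  \<comment> \<open>The coefficients of w and of the four components of h in the linearized
    integrand, which is called G below.\<close>
  define \<alpha> where "\<alpha> t = \<zeta>1 t * (- 4 * \<i> * z * u t + 2 * ?p 1 t * v t) + \<zeta>2 t * (2 * ?p 2 t * u t + 4 * \<i> * z * v t)" for t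
  define \<beta>1 where "\<beta>1 t = \<zeta>1 t * (- \<i> * ?p 2 t * u t + 2 * z * v t) + \<zeta>2 t * (\<i> * ?p 2 t * v t)" for t
  define \<beta>2 where "\<beta>2 t = \<zeta>1 t * (- \<i> * ?p 1 t * u t) + \<zeta>2 t * (2 * z * u t + \<i> * ?p 1 t * v t)" for t
  define \<beta>3 where "\<beta>3 t = \<zeta>1 t * (\<i> * v t)" for t
  define \<beta>4 where "\<beta>4 t = \<zeta>2 t * (- \<i> * u t)" for t
  have cont: "continuous_on {0..1} \<alpha>" "continuous_on {0..1} \<beta>1" "continuous_on {0..1} \<beta>2"
      "continuous_on {0..1} \<beta>3" "continuous_on {0..1} \<beta>4"
    unfolding \<alpha>_def \<beta>1_def \<beta>2_def \<beta>3_def \<beta>4_def by (intro continuous_intros c\<zeta> cuv)+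
  define J where "J \<beta> h = integral {0..1} (\<lambda>t. \<beta> t * h1_fun h t)" for \<beta> h
  have Jbl: "bounded_linear (J \<beta>)" if "continuous_on {0..1} \<beta>" for \<beta>
    unfolding J_def[abs_def] by (rule integral_pairing(1)[OF that])
  define c where "c = integral {0..1} \<alpha> / (2 * \<i>)"
  define D where "D h = (J \<beta>1 (h $ 1) + J \<beta>2 (h $ 2) + J \<beta>3 (h $ 3) + J \<beta>4 (h $ 4)) / (2 * \<i>)" for h :: potential
  have Dbl: "bounded_linear (\<lambda>x. c * fst x + D (snd x))"
    unfolding D_def
    by (intro bounded_linear_add bounded_linear_const_mult bounded_linear_fst
        bounded_linear_compose[OF bounded_linear_divide]
        bounded_linear_compose[OF Jbl] cont bounded_linear_compose[OF bounded_linear_vec_nth] bounded_linear_snd)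
  have Dc: "D (potential_scaleC k h) = k * D h" for k h
  proof -
    have "J \<beta> (h1_scaleC k f) = k * J \<beta> f" if "continuous_on {0..1} \<beta>" for \<beta> f
      unfolding J_def by (rule integral_pairing(2)[OF that])
    then show ?thesis using cont by (simp add: D_def potential_scaleC_def algebra_simps add_divide_distrib)
  qed
  obtain S1 where S1: "0 \<le> S1" "\<And>t. t \<in> {0..1} \<Longrightarrow> norm (\<zeta>1 t) \<le> S1"
    using continuous_Icc_bound[OF c\<zeta>(1)] by blast
  obtain S2 where S2: "0 \<le> S2" "\<And>t. t \<in> {0..1} \<Longrightarrow> norm (\<zeta>2 t) \<le> S2"
    using continuous_Icc_bound[OF c\<zeta>(2)] by blast
  define Z where "Z = norm z"
  define P where "P = norm \<psi>"
  have ZP: "0 \<le> Z" "0 \<le> P" by (simp_all add: Z_def P_def)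
  \<comment> \<open>K bounds the coefficients and Y the solutions for all parameters within distance
    1. C1 bounds the linear part of the coefficient change and C2 the change of the solution, each
    per unit of N. The number 6 comes from the quadratic part, which is at most 2 N^2 + 4
    N^2.\<close>
  define K where "K = 2 * (Z + 1)\<^sup>2 + 4 * (P + 1)\<^sup>2 + 4 * (Z + 1) * (P + 1) + 2 * (P + 1)"
  define Y where "Y = 2 * exp (4 * K)"
  define C1 where "C1 = 4 * Z + 8 * P + 2"
  define C2 where "C2 = 4 * (C1 + 6) * Y * exp (4 * K + 1)"
  have K0: "0 \<le> K" using ZP by (auto simp: K_def intro!: add_nonneg_nonneg mult_nonneg_nonneg)
  have C1: "0 \<le> C1" "0 \<le> Y" using ZP by (auto simp: C1_def Y_def)
  have C2: "0 \<le> C2" using C1 by (simp add: C2_def)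
  have solbound: "norm (u' t, v' t) \<le> Y"
    if "zs_solution z' \<psi>' u' v'" "u' 0 = -1" "v' 0 = 1" "norm z' \<le> Z + 1" "norm \<psi>' \<le> P + 1" "t \<in> {0..1}"
    for z' \<psi>' u' v' t
  proof -
    have "norm (u' t, v' t) \<le> norm (-1::complex, 1::complex) * exp (4 * K * \<bar>t\<bar>)"
      using zs_solution_bound[OF that(1) norm_coef_le[OF that(5,4)]] that(2,3) by (simp add: K_def)
    also have "\<dots> \<le> 2 * exp (4 * K)"
      using that(6) K0 norm_Pair_le[of "-1::complex" "1::complex"]
      by (intro mult_mono) (auto simp: mult_left_le)
    finally show ?thesis by (simp add: Y_def)
  qed
  have uvY: "norm (u t, v t) \<le> Y" if "t \<in> {0..1}" for t
    using that by (intro solbound[OF uv(1-3)]) (auto simp: Z_def P_def)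
  define C where "C = (2 * S1 + 2 * S2) * (6 * Y + C1 * C2)"
  have "((\<lambda>x. chi_N (fst x) (snd x)) has_derivative (\<lambda>x. c * fst x + D (snd x))) (at (z, \<psi>))"
  proof (rule has_derivative_quadratic_remainder[OF Dbl, where C = C])
    fix x :: "complex \<times> potential"
    obtain w h where x: "x = (w, h)" by (cases x)
    define N where "N = norm x"
    assume "norm x \<le> 1"
    then have N: "0 \<le> N" "N \<le> 1" by (auto simp: N_def)
    have N2: "N\<^sup>2 \<le> N" using N by (simp add: power2_eq_square mult_left_le)
    have wN: "norm w \<le> N" and hN: "norm h \<le> N"
      using norm_fst_le[of w h] norm_snd_le[of h w] by (auto simp: N_def x)
    have hj: "norm (h1_fun (h $ j) t) \<le> 2 * N" for j t
      using norm_h1_fun_component[of h j t] hN by linarith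
    have pj: "norm (?p j t) \<le> 2 * P" for j t
      using norm_h1_fun_component[of \<psi> j t] by (simp add: P_def)
    obtain u' v' where uv': "zs_solution (z + w) (\<psi> + h) u' v'" "u' 0 = -1" "v' 0 = 1"
        "chi_N (z + w) (\<psi> + h) = (u' 1 + v' 1) / (2 * \<i>)"
      using chi_N_solution by blast
    have small: "norm (z + w) \<le> Z + 1" "norm (\<psi> + h) \<le> P + 1"
      using norm_triangle_ineq[of z w] norm_triangle_ineq[of \<psi> h] wN hN N by (auto simp: Z_def P_def)
    have u'Y: "norm (u' t, v' t) \<le> Y" if "t \<in> {0..1}" for t
      using that by (intro solbound[OF uv'(1-3)] small)
    let ?h = "\<lambda>j t. h1_fun (h $ j) t"
    define la where "la t = - \<i> * (4 * z * w + ?p 1 t * ?h 2 t + ?h 1 t * ?p 2 t)" for t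
    define lb where "lb t = 2 * z * ?h 1 t + 2 * w * ?p 1 t + \<i> * ?h 3 t" for t
    define lc where "lc t = 2 * z * ?h 2 t + 2 * w * ?p 2 t - \<i> * ?h 4 t" for t
    define qa where "qa t = - \<i> * (2 * w\<^sup>2 + ?h 1 t * ?h 2 t)" for t
    define qb where "qb t = 2 * w * ?h 1 t" for t
    define qc where "qc t = 2 * w * ?h 2 t" for t
    define \<delta>a where "\<delta>a t = coef_a (z + w) (\<psi> + h) t - coef_a z \<psi> t" for t
    define \<delta>b where "\<delta>b t = coef_b (z + w) (\<psi> + h) t - coef_b z \<psi> t" for t
    define \<delta>c where "\<delta>c t = coef_c (z + w) (\<psi> + h) t - coef_c z \<psi> t" for t
    have dl: "\<delta>a t = la t + qa t" "\<delta>b t = lb t + qb t" "\<delta>c t = lc t + qc t" for t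
      by (simp_all add: \<delta>a_def \<delta>b_def \<delta>c_def la_def lb_def lc_def qa_def qb_def qc_def
          coef_a_def coef_b_def coef_c_def power2_eq_square algebra_simps)
    have zw: "norm z * norm w \<le> Z * N" using wN ZP by (simp add: Z_def mult_left_mono)
    have ph: "norm (?p i t) * norm (?h j t) \<le> (2 * P) * (2 * N)" for i j t
      using pj hj ZP N by (intro mult_mono) auto
    have hh: "norm (?h i t) * norm (?h j t) \<le> (2 * N) * (2 * N)" for i j t
      using hj N by (intro mult_mono) auto
    have zh: "norm z * norm (?h j t) \<le> Z * (2 * N)" for j t
      using hj by (simp add: Z_def mult_left_mono)
    have wp: "norm w * norm (?p j t) \<le> N * (2 * P)" for j t
      using pj wN N by (intro mult_mono) auto
    have wh: "norm w * norm (?h j t) \<le> N * (2 * N)" for j t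
      using hj wN N by (intro mult_mono) auto
    have ww: "(norm w)\<^sup>2 \<le> N\<^sup>2" using wN by (intro power_mono) auto
    have ZN: "0 \<le> Z * N" "0 \<le> P * N" using ZP N by auto
    have l: "norm (la t) \<le> C1 * N" "norm (lb t) \<le> C1 * N" "norm (lc t) \<le> C1 * N" for t
    proof -
      have e: "C1 * N = 4 * (Z * N) + 8 * (P * N) + 2 * N" by (simp add: C1_def algebra_simps)
      have "norm (la t) = norm (4 * z * w + ?p 1 t * ?h 2 t + ?h 1 t * ?p 2 t)"
        by (simp add: la_def norm_mult)
      also have "\<dots> \<le> 4 * (norm z * norm w) + norm (?p 1 t) * norm (?h 2 t) + norm (?p 2 t) * norm (?h 1 t)"
        by (rule order_trans[OF norm_triangle_ineq], rule add_mono, rule order_trans[OF norm_triangle_ineq])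
          (simp_all add: norm_mult)
      finally show "norm (la t) \<le> C1 * N" using zw ph[of 1 t 2] ph[of 2 t 1] ZN N e by linarith
      have "norm (lb t) \<le> 2 * (norm z * norm (?h 1 t)) + 2 * (norm w * norm (?p 1 t)) + norm (?h 3 t)"
        unfolding lb_def
        by (rule order_trans[OF norm_triangle_ineq], rule add_mono, rule order_trans[OF norm_triangle_ineq])
          (simp_all add: norm_mult)
      then show "norm (lb t) \<le> C1 * N" using zh[of 1 t] wp[of 1 t] hj[of 3 t] ZN N e
        by (simp add: mult_ac)
      have "norm (lc t) \<le> 2 * (norm z * norm (?h 2 t)) + 2 * (norm w * norm (?p 2 t)) + norm (?h 4 t)"
        unfolding lc_def
        by (rule order_trans[OF norm_triangle_ineq4], rule add_mono, rule order_trans[OF norm_triangle_ineq])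
          (simp_all add: norm_mult)
      then show "norm (lc t) \<le> C1 * N" using zh[of 2 t] wp[of 2 t] hj[of 4 t] ZN N e
        by (simp add: mult_ac)
    qed
    have q: "norm (qa t) \<le> 6 * N\<^sup>2" "norm (qb t) \<le> 6 * N\<^sup>2" "norm (qc t) \<le> 6 * N\<^sup>2" for t
    proof -
      have "norm (qa t) \<le> 2 * (norm w)\<^sup>2 + norm (?h 1 t) * norm (?h 2 t)"
        using norm_triangle_ineq[of "2 * w\<^sup>2" "?h 1 t * ?h 2 t"] by (simp add: qa_def norm_mult norm_power)
      then show "norm (qa t) \<le> 6 * N\<^sup>2" using ww hh[of 1 t 2] by (simp add: power2_eq_square)
      show "norm (qb t) \<le> 6 * N\<^sup>2" "norm (qc t) \<le> 6 * N\<^sup>2"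
        using wh[of 1 t] wh[of 2 t] zero_le_power2[of N] unfolding qb_def qc_def norm_mult
        by (simp_all only: norm_numeral power2_eq_square mult.left_commute[of N 2 N])
    qed
    have lq: "norm (l + q) \<le> (C1 + 6) * N" if "norm l \<le> C1 * N" "norm q \<le> 6 * N\<^sup>2" for l q :: complex
      using that N2 norm_triangle_ineq[of l q] by (simp add: algebra_simps)
    have diff: "norm (u' t - u t, v' t - v t) \<le> C2 * N" if t: "t \<in> {0..1}" for t
    proof -
      have "norm (u' t - u t, v' t - v t) \<le> 4 * ((C1 + 6) * N) * Y * exp (4 * K + 1)"
      proof (rule zs_solution_perturb[OF uv(1) uv'(1) _ _ _ _ _ _ _ _ uvY t])
        show "norm (coef_a (z + w) (\<psi> + h) t) \<le> K" "norm (coef_b (z + w) (\<psi> + h) t) \<le> K"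
            "norm (coef_c (z + w) (\<psi> + h) t) \<le> K" for t
          using norm_coef_le[OF small(2,1), of t] by (simp_all add: K_def)
        show "norm (coef_a (z + w) (\<psi> + h) t - coef_a z \<psi> t) \<le> (C1 + 6) * N"
            "norm (coef_b (z + w) (\<psi> + h) t - coef_b z \<psi> t) \<le> (C1 + 6) * N"
            "norm (coef_c (z + w) (\<psi> + h) t - coef_c z \<psi> t) \<le> (C1 + 6) * N" for t
          using lq[OF l(1) q(1)] lq[OF l(2) q(2)] lq[OF l(3) q(3)]
          unfolding \<delta>a_def[symmetric] \<delta>b_def[symmetric] \<delta>c_def[symmetric] dl by blast+
      qed (use uv uv' in auto)
      then show ?thesis by (simp add: C2_def mult_ac)
    qed
    define F where "F t = \<zeta>1 t * (\<delta>a t * u' t + \<delta>b t * v' t) + \<zeta>2 t * (\<delta>c t * u' t - \<delta>a t * v' t)" for t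
    define G where "G t = \<zeta>1 t * (la t * u t + lb t * v t) + \<zeta>2 t * (lc t * u t - la t * v t)" for t
    have cc: "continuous_on {0..1} \<delta>a" "continuous_on {0..1} \<delta>b" "continuous_on {0..1} \<delta>c"
      "continuous_on {0..1} la" "continuous_on {0..1} lb" "continuous_on {0..1} lc"
      unfolding \<delta>a_def \<delta>b_def \<delta>c_def la_def lb_def lc_def by (intro continuous_intros)+
    have cF: "continuous_on {0..1} F" and cG: "continuous_on {0..1} G"
      unfolding F_def G_def by (intro continuous_intros cc c\<zeta> cuv csol[OF uv'(1)])+
    \<comment> \<open>Used twice: with the perturbed coefficients it yields the integral for the new
      boundary value; with the original ones the integrand vanishes, and this evaluates
      \<open>u 1 + v 1\<close> by the adjoint solution at time 0.\<close>
    have wronskian: "(F' has_integral (u'' 1 + v'' 1) - (- \<zeta>1 0 + \<zeta>2 0)) {0..1}"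
      if s: "zs_solution z' \<psi>' u'' v''" "u'' 0 = -1" "v'' 0 = 1"
        and F': "\<And>t. F' t = \<zeta>1 t * ((coef_a z' \<psi>' t - coef_a z \<psi> t) * u'' t + (coef_b z' \<psi>' t - coef_b z \<psi> t) * v'' t)
            + \<zeta>2 t * ((coef_c z' \<psi>' t - coef_c z \<psi> t) * u'' t - (coef_a z' \<psi>' t - coef_a z \<psi> t) * v'' t)"
      for z' \<psi>' u'' v'' F'
    proof -
      have "((\<lambda>t. \<zeta>1 t * u'' t + \<zeta>2 t * v'' t) has_vector_derivative F' t) (at t)" for t
      proof -
        have du: "(u'' has_vector_derivative coef_a z' \<psi>' t * u'' t + coef_b z' \<psi>' t * v'' t) (at t)"
          and dv: "(v'' has_vector_derivative coef_c z' \<psi>' t * u'' t - coef_a z' \<psi>' t * v'' t) (at t)"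
          using s(1) unfolding zs_solution_def by blast+
        show ?thesis
          by (rule has_vector_derivative_eq_rhs[OF has_vector_derivative_add[OF
                has_vector_derivative_mult[OF \<zeta>(3) du] has_vector_derivative_mult[OF \<zeta>(4) dv]]])
            (simp add: F' algebra_simps)
      qed
      then have "(F' has_integral (\<zeta>1 1 * u'' 1 + \<zeta>2 1 * v'' 1) - (\<zeta>1 0 * u'' 0 + \<zeta>2 0 * v'' 0)) {0..1}"
        by (rule fundamental_theorem_of_calculus[OF zero_le_one has_vector_derivative_at_within])
      then show ?thesis using s \<zeta>(1,2) by simp
    qed
    have "(F has_integral (u' 1 + v' 1) - (- \<zeta>1 0 + \<zeta>2 0)) {0..1}"
      by (rule wronskian[OF uv'(1-3)]) (simp add: F_def \<delta>a_def \<delta>b_def \<delta>c_def)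
    moreover have "((\<lambda>t::real. 0::complex) has_integral (u 1 + v 1) - (- \<zeta>1 0 + \<zeta>2 0)) {0..1}"
      by (rule wronskian[OF uv(1-3)]) simp
    then have "u 1 + v 1 = - \<zeta>1 0 + \<zeta>2 0" using has_integral_unique has_integral_0 by fastforce
    ultimately have FI: "integral {0..1} F = (u' 1 + v' 1) - (u 1 + v 1)"
      using integral_unique by force
    have "G t = \<alpha> t * w + \<beta>1 t * ?h 1 t + \<beta>2 t * ?h 2 t + \<beta>3 t * ?h 3 t + \<beta>4 t * ?h 4 t" for t
      by (simp add: G_def la_def lb_def lc_def \<alpha>_def \<beta>1_def \<beta>2_def \<beta>3_def \<beta>4_def algebra_simps)
    then have "G = (\<lambda>t. \<alpha> t * w + \<beta>1 t * ?h 1 t + \<beta>2 t * ?h 2 t + \<beta>3 t * ?h 3 t + \<beta>4 t * ?h 4 t)" by blast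
    moreover have "((\<lambda>t. \<alpha> t * w + \<beta>1 t * ?h 1 t + \<beta>2 t * ?h 2 t + \<beta>3 t * ?h 3 t + \<beta>4 t * ?h 4 t)
        has_integral integral {0..1} \<alpha> * w + J \<beta>1 (h $ 1) + J \<beta>2 (h $ 2) + J \<beta>3 (h $ 3) + J \<beta>4 (h $ 4)) {0..1}"
      unfolding J_def
      by (intro has_integral_add has_integral_mult_left integrable_integral integrable_continuous_real
          continuous_intros cont)
    ultimately have GI: "integral {0..1} G = integral {0..1} \<alpha> * w + J \<beta>1 (h $ 1) + J \<beta>2 (h $ 2) + J \<beta>3 (h $ 3) + J \<beta>4 (h $ 4)"
      using integral_unique by blast
    have "chi_N (z + w) (\<psi> + h) - chi_N z \<psi> - (c * w + D h) = (integral {0..1} F - integral {0..1} G) / (2 * \<i>)"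
      unfolding FI GI uv(4) uv'(4) c_def D_def by (simp add: field_simps)
    also have "integral {0..1} F - integral {0..1} G = integral {0..1} (\<lambda>t. F t - G t)"
      by (intro Henstock_Kurzweil_Integration.integral_diff[symmetric] integrable_continuous_real cF cG)
    finally have eq: "chi_N (z + w) (\<psi> + h) - chi_N z \<psi> - (c * w + D h) = integral {0..1} (\<lambda>t. F t - G t) / (2 * \<i>)" .
    have "norm (integral {0..1} (\<lambda>t. F t - G t)) \<le> (C * N\<^sup>2) * (1 - 0)"
    proof (rule integral_bound)
      show "continuous_on {0..1} (\<lambda>t. F t - G t)" by (intro continuous_intros cF cG)
      fix t :: real assume t: "t \<in> {0..1}"
      have e: "norm (q * s + l * d) \<le> (6 * Y + C1 * C2) * N\<^sup>2"
        if "norm q \<le> 6 * N\<^sup>2" "norm s \<le> Y" "norm l \<le> C1 * N" "norm d \<le> C2 * N" for q s l d :: complex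
      proof -
        have "norm (q * s) \<le> (6 * N\<^sup>2) * Y" unfolding norm_mult using that by (intro mult_mono) auto
        moreover have "norm (l * d) \<le> (C1 * N) * (C2 * N)"
          unfolding norm_mult using that C1 N by (intro mult_mono) auto
        ultimately show ?thesis
          using norm_triangle_ineq[of "q * s" "l * d"] by (simp add: algebra_simps power2_eq_square)
      qed
      have n: "norm (u' t) \<le> Y" "norm (v' t) \<le> Y" "norm (u' t - u t) \<le> C2 * N" "norm (v' t - v t) \<le> C2 * N"
        using u'Y[OF t] diff[OF t] norm_fst_le[of "u' t" "v' t"] norm_snd_le[of "v' t" "u' t"]
          norm_fst_le[of "u' t - u t" "v' t - v t"] norm_snd_le[of "v' t - v t" "u' t - u t"]
        by linarith+
      note l = l[of t] and q = q[of t]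
      \<comment> \<open>Each of the four terms is a quadratic remainder times the new solution plus
        a linear part times the change of the solution, so it is of order N^2.\<close>
      let ?e1 = "qa t * u' t + la t * (u' t - u t)" and ?e2 = "qb t * v' t + lb t * (v' t - v t)"
      let ?e3 = "qc t * u' t + lc t * (u' t - u t)" and ?e4 = "qa t * v' t + la t * (v' t - v t)"
      have "F t - G t = \<zeta>1 t * (?e1 + ?e2) + \<zeta>2 t * (?e3 - ?e4)"
        unfolding F_def G_def dl by (simp add: algebra_simps)
      also have "norm \<dots> \<le> S1 * (2 * ((6 * Y + C1 * C2) * N\<^sup>2)) + S2 * (2 * ((6 * Y + C1 * C2) * N\<^sup>2))"
      proof (rule order_trans[OF norm_triangle_ineq], rule add_mono)
        have "norm (?e1 + ?e2) \<le> 2 * ((6 * Y + C1 * C2) * N\<^sup>2)"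
          using norm_triangle_ineq[of ?e1 ?e2] e[OF q(1) n(1) l(1) n(3)] e[OF q(2) n(2) l(2) n(4)] by linarith
        then show "norm (\<zeta>1 t * (?e1 + ?e2)) \<le> S1 * (2 * ((6 * Y + C1 * C2) * N\<^sup>2))"
          unfolding norm_mult using S1 t by (intro mult_mono) auto
        have "norm (?e3 - ?e4) \<le> 2 * ((6 * Y + C1 * C2) * N\<^sup>2)"
          using norm_triangle_ineq4[of ?e3 ?e4] e[OF q(3) n(1) l(3) n(3)] e[OF q(1) n(2) l(1) n(4)] by linarith
        then show "norm (\<zeta>2 t * (?e3 - ?e4)) \<le> S2 * (2 * ((6 * Y + C1 * C2) * N\<^sup>2))"
          unfolding norm_mult using S2 t by (intro mult_mono) auto
      qed
      also have "\<dots> = C * N\<^sup>2" by (simp add: C_def algebra_simps)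
      finally show "norm (F t - G t) \<le> C * N\<^sup>2" .
    qed simp
    then have "norm (integral {0..1} (\<lambda>t. F t - G t) / (2 * \<i>)) \<le> C * N\<^sup>2"
      by (simp add: norm_divide norm_mult) (smt (verit) norm_ge_zero)
    then show "norm (chi_N (fst ((z, \<psi>) + x)) (snd ((z, \<psi>) + x)) - chi_N (fst (z, \<psi>)) (snd (z, \<psi>)) -
        (c * fst x + D (snd x))) \<le> C * (norm x)\<^sup>2"
      using eq by (simp add: x N_def)
  qed
  with Dc show ?thesis by blast
qed

lemma holomorphic_on_chi_N: "(\<lambda>z. chi_N z \<psi>) holomorphic_on S"
proof -
  have "\<exists>c. ((\<lambda>z. chi_N z \<psi>) has_field_derivative c) (at z)" for z
  proof -
    obtain c D where D: "\<forall>k h. D (potential_scaleC k h) = k * D h"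
      and d: "((\<lambda>x. chi_N (fst x) (snd x)) has_derivative (\<lambda>x. c * fst x + D (snd x))) (at (z, \<psi>))"
      using chi_N_joint_derivative by blast
    have "D 0 = 0"
      using linear_0[OF has_derivative_linear[OF d]] by simp
    moreover have "((\<lambda>w. (w, \<psi>)) has_derivative (\<lambda>w. (w, 0))) (at z)"
      by (intro has_derivative_Pair has_derivative_ident has_derivative_const)
    from has_derivative_compose[OF this d]
    have "((\<lambda>z. chi_N z \<psi>) has_derivative (\<lambda>w. c * w + D 0)) (at z)" by simp
    ultimately show ?thesis unfolding has_field_derivative_def by auto
  qed
  then show ?thesis
    unfolding holomorphic_on_def field_differentiable_def
    using has_field_derivative_at_within by blast
qed

lemma continuous_on_chi_N: "continuous_on S (\<lambda>x. chi_N (fst x) (snd x))"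
proof (intro continuous_at_imp_continuous_on ballI)
  fix x
  obtain c D where "((\<lambda>x. chi_N (fst x) (snd x)) has_derivative (\<lambda>x. c * fst x + D (snd x))) (at (fst x, snd x))"
    using chi_N_joint_derivative by blast
  then show "isCont (\<lambda>x. chi_N (fst x) (snd x)) x" by (simp add: has_derivative_continuous)
qed

lemma analytic_on_potentials_chi_N: "analytic_on_potentials (chi_N z) W"
  unfolding analytic_on_potentials_def
proof
  fix \<psi>
  obtain c D where D: "\<forall>k h. D (potential_scaleC k h) = k * D h"
    and d: "((\<lambda>x. chi_N (fst x) (snd x)) has_derivative (\<lambda>x. c * fst x + D (snd x))) (at (z, \<psi>))"
    using chi_N_joint_derivative by blast
  have "((\<lambda>\<phi>. (z, \<phi>)) has_derivative (\<lambda>h. (0, h))) (at \<psi>)"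
    by (intro has_derivative_Pair has_derivative_ident has_derivative_const)
  from has_derivative_compose[OF this d]
  have "(chi_N z has_derivative D) (at \<psi>)" by simp
  then show "\<exists>D. (chi_N z has_derivative D) (at \<psi>) \<and> (\<forall>c h. D (potential_scaleC c h) = c * D h)"
    using D by blast
qed

subsection \<open>Cauchy estimates on the phase space\<close>

lemma h1_eqI: "(\<And>t. h1_fun f t = h1_fun g t) \<Longrightarrow> f = g"
  by (metis ext h1_fun_inject)

lemma norm_potential_scaleC: "norm (potential_scaleC c h) = norm c * norm h"
  by (simp add: norm_vec_def potential_scaleC_def L2_set_right_distrib)

lemma bounded_linear_potential_scaleC: "bounded_linear (\<lambda>c. potential_scaleC c h)"
proof (rule bounded_linear_intro)
  show "potential_scaleC (a + b) h = potential_scaleC a h + potential_scaleC b h" for a b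
    by (auto simp: potential_scaleC_def vec_eq_iff distrib_right intro: h1_eqI)
  show "potential_scaleC (r *\<^sub>R a) h = r *\<^sub>R potential_scaleC a h" for r a
    by (auto simp: potential_scaleC_def vec_eq_iff scaleR_conv_of_real intro!: h1_eqI)
  show "norm (potential_scaleC a h) \<le> norm a * norm h" for a
    by (simp add: norm_potential_scaleC)
qed

lemma analytic_on_potentials_lipschitz:
  assumes f: "analytic_on_potentials f (ball 0 (2 * R))" and R: "R > 0"
    and bound: "\<And>\<psi>. norm \<psi> < 2 * R \<Longrightarrow> norm (f \<psi>) \<le> K"
    and \<psi>: "norm \<psi> < R" "norm \<phi> < R"
  shows "norm (f \<psi> - f \<phi>) \<le> 2 * K / R * norm (\<psi> - \<phi>)"
proof -
  obtain D where D: "\<And>\<psi>. \<psi> \<in> ball 0 (2 * R) \<Longrightarrow> (f has_derivative D \<psi>) (at \<psi>)"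
    "\<And>\<psi> c h. \<psi> \<in> ball 0 (2 * R) \<Longrightarrow> D \<psi> (potential_scaleC c h) = c * D \<psi> h"
    using f unfolding analytic_on_potentials_def by metis
  have K0: "0 \<le> K" using order_trans[OF norm_ge_zero bound[of 0]] R by simp
  have dirbound: "norm (D \<psi> h) \<le> 2 * K / R * norm h" if \<psi>: "\<psi> \<in> ball 0 R" for \<psi> h
  proof (cases "h = 0")
    case True
    have "\<psi> \<in> ball 0 (2 * R)" using \<psi> R by auto
    then show ?thesis using linear_0[OF has_derivative_linear[OF D(1)]] True by simp
  next
    case False
    \<comment> \<open>For |c| < 2r the shift has norm below R and the argument stays in the ball of
      radius 2R. The Cauchy circle of radius r therefore lies well inside the domain of holomorphy,
      and K/r gives the constant 2K/R.\<close>
    define r where "r = R / (2 * norm h)"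
    have r: "r > 0" using R False by (simp add: r_def)
    define g where "g c = f (\<psi> + potential_scaleC c h)" for c
    have inball: "norm (\<psi> + potential_scaleC c h) < 2 * R" if "norm c < 2 * r" for c
    proof -
      have "norm c * norm h < R" using that False by (simp add: r_def pos_less_divide_eq)
      then show ?thesis using norm_triangle_ineq[of \<psi> "potential_scaleC c h"] \<psi>
        by (simp add: norm_potential_scaleC)
    qed
    have dg: "(g has_field_derivative D (\<psi> + potential_scaleC c h) h) (at c)" if "norm c < 2 * r" for c
    proof -
      have "((\<lambda>c. \<psi> + potential_scaleC c h) has_derivative (\<lambda>c. 0 + potential_scaleC c h)) (at c)"
        by (intro has_derivative_add has_derivative_const
            bounded_linear.has_derivative[OF bounded_linear_potential_scaleC has_derivative_ident])
      moreover have "(f has_derivative D (\<psi> + potential_scaleC c h)) (at (\<psi> + potential_scaleC c h))"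
        using inball[OF that] by (intro D) auto
      ultimately have "(g has_derivative (\<lambda>k. D (\<psi> + potential_scaleC c h) (0 + potential_scaleC k h))) (at c)"
        unfolding g_def by (rule has_derivative_compose)
      then show ?thesis
        using D(2)[of "\<psi> + potential_scaleC c h"] inball[OF that]
        by (simp add: has_field_derivative_def mult_commute_abs)
    qed
    have gholo: "g holomorphic_on ball 0 (2 * r)"
      by (rule holomorphic_onI)
        (use dg in \<open>auto simp: field_differentiable_def intro: has_field_derivative_at_within\<close>)
    have "norm ((deriv ^^ 1) g 0) \<le> fact 1 * K / r ^ 1"
    proof (rule Cauchy_inequality[OF _ _ r])
      show "g holomorphic_on ball 0 r" using r by (intro holomorphic_on_subset[OF gholo]) auto
      show "continuous_on (cball 0 r) g"
        using r by (intro holomorphic_on_imp_continuous_on holomorphic_on_subset[OF gholo]) auto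
      show "norm (g x) \<le> K" if "norm (0 - x) = r" for x
        unfolding g_def using that r by (intro bound inball) auto
    qed
    moreover have "potential_scaleC 0 h = 0"
      using bounded_linear.linear[OF bounded_linear_potential_scaleC] linear_0 by blast
    then have "deriv g 0 = D \<psi> h" using DERIV_imp_deriv[OF dg[of 0]] r by simp
    ultimately show ?thesis by (simp add: r_def field_simps)
  qed
  show ?thesis
  proof (rule differentiable_bound[where S = "ball 0 R" and f' = D])
    show "(f has_derivative D \<psi>) (at \<psi> within ball 0 R)" if "\<psi> \<in> ball 0 R" for \<psi>
      by (rule has_derivative_at_withinI[OF D(1)]) (use that R in auto)
    show "onorm (D \<psi>) \<le> 2 * K / R" if "\<psi> \<in> ball 0 R" for \<psi>
      using dirbound[OF that] K0 R by (intro onorm_bound) auto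
  qed (use \<psi> in auto)
qed

subsection \<open>Asymptotics for large spectral parameter\<close>

text \<open>
  Adding \<open>\<alpha> v\<close> to \<open>u\<close> removes the off-diagonal terms of order \<open>z\<close> and \<open>1\<close> from the equation for
  \<open>u\<close>; the sign \<open>\<sigma> = -1\<close> is used for the equation for \<open>v\<close>.  The functions \<open>A\<close> and \<open>B\<close> are smooth
  approximations of the coefficients \<open>A0\<close> and \<open>B0\<close>.
\<close>

lemma gauge_coefficient_bounds:
  fixes z A0 B0 C E A B \<sigma> :: complex
  assumes \<sigma>: "\<sigma> = 1 \<or> \<sigma> = -1" and r: "r = norm z" "1 \<le> r" and Q: "1 \<le> Q"
    and le: "norm A0 \<le> Q" "norm C \<le> Q" "norm E \<le> Q" "norm A \<le> Q" "norm B \<le> Q"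
    and close: "norm (A0 - A) \<le> 1 / r\<^sup>2" "norm (B0 - B) \<le> 1 / r\<^sup>2"
    and \<alpha>: "\<alpha> = \<sigma> * \<i> * A / (2 * z) - B / (4 * z\<^sup>2)"
  shows "norm \<alpha> \<le> Q / r"
    and "norm (- \<sigma> * \<i> * (A0 * C) + \<alpha> * (2 * z * C - \<sigma> * \<i> * E)) \<le> 6 * Q ^ 3 / r"
    and "norm (2 * z * A0 + \<sigma> * \<i> * B0 + \<sigma> * \<i> * \<alpha> * (4 * z\<^sup>2 + A0 * C)) \<le> 6 * Q ^ 3 / r"
proof -
  have z: "z \<noteq> 0" using r by auto
  have n\<sigma>: "norm \<sigma> = 1" and \<sigma>\<sigma>: "\<sigma> * \<sigma> = 1" using \<sigma> by auto
  have r1: "1 / r\<^sup>2 \<le> 1 / r" using r by (simp add: power2_eq_square divide_simps)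
  have Q2: "Q \<le> Q\<^sup>2" "Q\<^sup>2 \<le> Q ^ 3" "1 \<le> Q ^ 3" using Q by (auto simp: self_le_power power_increasing)
  have a1: "norm (\<sigma> * \<i> * A / (2 * z)) \<le> (Q / r) / 2"
    using le r by (simp add: norm_mult norm_divide n\<sigma> divide_simps)
  have b1: "norm (B / (4 * z\<^sup>2)) \<le> (Q / r) / 4"
  proof -
    have "norm (B / (4 * z\<^sup>2)) = norm B * (1 / r\<^sup>2) / 4" by (simp add: norm_mult norm_divide norm_power r)
    also have "\<dots> \<le> Q * (1 / r) / 4" using le r1 Q by (intro divide_right_mono mult_mono) auto
    finally show ?thesis by simp
  qed
  have Qr: "0 \<le> Q / r" using Q r by simp
  show \<alpha>Q: "norm \<alpha> \<le> Q / r"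
    unfolding \<alpha> using norm_triangle_ineq4[of "\<sigma> * \<i> * A / (2 * z)" "B / (4 * z\<^sup>2)"] a1 b1 Qr by linarith
  \<comment> \<open>The coefficient of u after the gauge. The part \<sigma> i A / (2z) of \<alpha>,
    multiplied by 2zC, cancels the diagonal product A0 C up to A0 - A, so no phase of order one
    survives.\<close>
  have "- \<sigma> * \<i> * (A0 * C) + \<alpha> * (2 * z * C - \<sigma> * \<i> * E)
      = (\<sigma> * \<sigma>) * (A * E / (2 * z)) - \<sigma> * \<i> * ((A0 - A) * C) - B * C / (2 * z) + \<sigma> * \<i> * (B * E / (4 * z\<^sup>2))"
    unfolding \<alpha> using z by (simp add: field_simps power2_eq_square)
  then have "norm (- \<sigma> * \<i> * (A0 * C) + \<alpha> * (2 * z * C - \<sigma> * \<i> * E))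
      = norm (A * E / (2 * z) - \<sigma> * \<i> * ((A0 - A) * C) - B * C / (2 * z) + \<sigma> * \<i> * (B * E / (4 * z\<^sup>2)))"
    by (simp only: \<sigma>\<sigma> mult_1)
  also have "\<dots> \<le> norm (A * E / (2 * z)) + norm (\<sigma> * \<i> * ((A0 - A) * C)) + norm (B * C / (2 * z))
      + norm (\<sigma> * \<i> * (B * E / (4 * z\<^sup>2)))"
    by (intro order_trans[OF norm_triangle_ineq] order_trans[OF norm_triangle_ineq4] add_mono order_refl)
  also have "\<dots> = norm (A * E / (2 * z)) + norm ((A0 - A) * C) + norm (B * C / (2 * z)) + norm (B * E / (4 * z\<^sup>2))"
    by (simp only: norm_mult n\<sigma> norm_ii mult_1)
  also have "\<dots> \<le> Q ^ 3 / r + Q ^ 3 / r + Q ^ 3 / r + Q ^ 3 / r"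
  proof (intro add_mono)
    have p: "norm (x * y) \<le> Q\<^sup>2" if "norm x \<le> Q" "norm y \<le> Q" for x y :: complex
      unfolding norm_mult power2_eq_square using that Q by (intro mult_mono) auto
    have d: "norm (x / (2 * z)) \<le> Q ^ 3 / r" if "norm x \<le> Q\<^sup>2" for x
    proof -
      have "norm (x / (2 * z)) = norm x / (2 * r)" by (simp add: norm_divide norm_mult r)
      also have "\<dots> \<le> Q ^ 3 / r" using that Q2 r by (simp add: divide_simps)
      finally show ?thesis .
    qed
    show "norm (A * E / (2 * z)) \<le> Q ^ 3 / r" "norm (B * C / (2 * z)) \<le> Q ^ 3 / r"
      by (intro d p le)+
    have "norm ((A0 - A) * C) \<le> (1 / r) * Q"
      unfolding norm_mult using close(1) le r1 r by (intro mult_mono) auto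
    also have "\<dots> \<le> Q ^ 3 / r" using Q2 r by (simp add: divide_right_mono)
    finally show "norm ((A0 - A) * C) \<le> Q ^ 3 / r" .
    have "norm (B * E / (4 * z\<^sup>2)) = norm (B * E) * (1 / r\<^sup>2) / 4"
      by (simp add: norm_mult norm_divide norm_power r)
    also have "\<dots> \<le> Q\<^sup>2 * (1 / r) / 4" using p[OF le(5,3)] r1 Q by (intro divide_right_mono mult_mono) auto
    also have "\<dots> \<le> Q ^ 3 / r" using Q2 r Q by (simp add: divide_simps)
    finally show "norm (B * E / (4 * z\<^sup>2)) \<le> Q ^ 3 / r" .
  qed
  also have "\<dots> \<le> 6 * Q ^ 3 / r" using Q r by (simp add: divide_simps)
  finally show "norm (- \<sigma> * \<i> * (A0 * C) + \<alpha> * (2 * z * C - \<sigma> * \<i> * E)) \<le> 6 * Q ^ 3 / r" .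
  \<comment> \<open>The coefficient of v after the gauge. \<alpha> is chosen so that 4 z^2 \<sigma>
    i \<alpha> = -(2zA + \<sigma> i B), the negative of the coupling with A0 and B0 replaced by
    their approximations.\<close>
  have "2 * z * A0 + \<sigma> * \<i> * B0 + \<sigma> * \<i> * \<alpha> * (4 * z\<^sup>2 + A0 * C)
      = 2 * z * A0 - (\<sigma> * \<sigma>) * (2 * z * A) + \<sigma> * \<i> * (B0 - B) + \<sigma> * \<i> * (\<alpha> * (A0 * C))"
    unfolding \<alpha> using z by (simp add: field_simps power2_eq_square)
  also have "\<dots> = 2 * z * (A0 - A) + \<sigma> * \<i> * (B0 - B) + \<sigma> * \<i> * (\<alpha> * (A0 * C))"
    unfolding \<sigma>\<sigma> by (simp add: algebra_simps)
  also have "norm \<dots> \<le> norm (2 * z * (A0 - A)) + norm (\<sigma> * \<i> * (B0 - B)) + norm (\<sigma> * \<i> * (\<alpha> * (A0 * C)))"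
    by (rule order_trans[OF norm_triangle_ineq], rule add_right_mono, rule norm_triangle_ineq)
  also have "\<dots> \<le> 2 / r + 1 / r + Q ^ 3 / r"
  proof (intro add_mono)
    \<comment> \<open>This term dictates the accuracy 1/r^2 of the approximation: after
      multiplication by 2z it is still 2/r.\<close>
    have "norm (2 * z * (A0 - A)) \<le> 2 * r * (1 / r\<^sup>2)"
      unfolding norm_mult using close(1) r by (intro mult_mono) auto
    then show "norm (2 * z * (A0 - A)) \<le> 2 / r" using z r by (simp add: power2_eq_square)
    show "norm (\<sigma> * \<i> * (B0 - B)) \<le> 1 / r" using close(2) r1 by (simp add: norm_mult n\<sigma>)
    have "norm (\<alpha> * (A0 * C)) \<le> (Q / r) * (Q * Q)"
      unfolding norm_mult using \<alpha>Q le Qr Q by (intro mult_mono) auto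
    then show "norm (\<sigma> * \<i> * (\<alpha> * (A0 * C))) \<le> Q ^ 3 / r"
      by (simp add: norm_mult n\<sigma> power3_eq_cube mult_ac)
  qed
  also have "\<dots> \<le> 6 * Q ^ 3 / r" using Q2 r by (simp add: divide_simps)
  finally show "norm (2 * z * A0 + \<sigma> * \<i> * B0 + \<sigma> * \<i> * \<alpha> * (4 * z\<^sup>2 + A0 * C)) \<le> 6 * Q ^ 3 / r" .
qed

text \<open>Derivatives of the approximations enter only through the derivative of \<alpha>, hence
  divided by r. The parameter \<sigma>, together with an exchange of the two unknowns, covers both
  equations of the system.\<close>

lemma gauge_transformed_equation:
  fixes u v A0 B0 C E A B A' B' :: "real \<Rightarrow> complex"
  assumes \<sigma>: "\<sigma> = 1 \<or> \<sigma> = -1" and r: "r = norm z" "1 \<le> r" and Q: "1 \<le> Q"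
    and t: "t \<in> {0..1}"
    and le: "norm (A0 t) \<le> Q" "norm (C t) \<le> Q" "norm (E t) \<le> Q" "norm (A t) \<le> Q" "norm (B t) \<le> Q"
    and close: "norm (A0 t - A t) \<le> 1 / r\<^sup>2" "norm (B0 t - B t) \<le> 1 / r\<^sup>2"
    and A': "(A has_vector_derivative A' t) (at t within {0..1})"
    and B': "(B has_vector_derivative B' t) (at t within {0..1})"
    and g: "norm (A' t) + norm (B' t) \<le> g t"
    and u: "(u has_vector_derivative - \<sigma> * \<i> * (2 * z\<^sup>2 + A0 t * C t) * u t
        + (2 * z * A0 t + \<sigma> * \<i> * B0 t) * v t) (at t within {0..1})"
    and v: "(v has_vector_derivative (2 * z * C t - \<sigma> * \<i> * E t) * u t
        + \<sigma> * \<i> * (2 * z\<^sup>2 + A0 t * C t) * v t) (at t within {0..1})"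
  defines "\<alpha> \<equiv> \<lambda>t. \<sigma> * \<i> * A t / (2 * z) - B t / (4 * z\<^sup>2)"
  shows "\<exists>e. ((\<lambda>t. u t + \<alpha> t * v t) has_vector_derivative - \<sigma> * \<i> * (2 * z\<^sup>2) * (u t + \<alpha> t * v t) + e)
      (at t within {0..1}) \<and> norm e \<le> (6 * Q ^ 3 + g t) / r * (norm (u t) + norm (v t))"
proof -
  define \<alpha>' where "\<alpha>' = \<sigma> * \<i> / (2 * z) * A' t - 1 / (4 * z\<^sup>2) * B' t"
  have \<alpha>_eq: "\<alpha> = (\<lambda>t. \<sigma> * \<i> / (2 * z) * A t - 1 / (4 * z\<^sup>2) * B t)" by (simp add: \<alpha>_def)
  have \<alpha>': "(\<alpha> has_vector_derivative \<alpha>') (at t within {0..1})"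
    unfolding \<alpha>'_def \<alpha>_eq
    by (intro has_vector_derivative_diff has_vector_derivative_mult_right A' B')
  define e1 where "e1 = - \<sigma> * \<i> * (A0 t * C t) + \<alpha> t * (2 * z * C t - \<sigma> * \<i> * E t)"
  define e2 where "e2 = 2 * z * A0 t + \<sigma> * \<i> * B0 t + \<sigma> * \<i> * \<alpha> t * (4 * z\<^sup>2 + A0 t * C t)"
  have e: "norm e1 \<le> 6 * Q ^ 3 / r" "norm e2 \<le> 6 * Q ^ 3 / r"
    unfolding e1_def e2_def using gauge_coefficient_bounds(2,3)[OF \<sigma> r Q le close] by (simp_all add: \<alpha>_def)
  have g0: "0 \<le> g t" using g norm_ge_zero[of "A' t"] norm_ge_zero[of "B' t"] by linarith
  have "norm \<alpha>' \<le> norm (\<sigma> * \<i> / (2 * z) * A' t) + norm (1 / (4 * z\<^sup>2) * B' t)"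
    unfolding \<alpha>'_def by (rule norm_triangle_ineq4)
  also have "\<dots> \<le> norm (A' t) / r + norm (B' t) / r"
  proof (rule add_mono)
    show "norm (\<sigma> * \<i> / (2 * z) * A' t) \<le> norm (A' t) / r"
      using \<sigma> r by (auto simp: norm_mult norm_divide divide_simps)
    have "r \<le> 4 * r\<^sup>2" using self_le_power[of r 2] r(2) by simp
    then have "norm (B' t) / (4 * r\<^sup>2) \<le> norm (B' t) / r" using r order.strict_trans2[OF zero_less_one r(2)] by (intro divide_left_mono) auto
    then show "norm (1 / (4 * z\<^sup>2) * B' t) \<le> norm (B' t) / r"
      by (simp add: norm_mult norm_divide norm_power r)
  qed
  also have "\<dots> \<le> g t / r" using g r by (simp add: add_divide_distrib[symmetric] divide_right_mono)
  finally have a: "norm \<alpha>' \<le> g t / r" .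
  show ?thesis
  proof (intro exI conjI)
    have "((\<lambda>t. u t + \<alpha> t * v t) has_vector_derivative
        (- \<sigma> * \<i> * (2 * z\<^sup>2 + A0 t * C t) * u t + (2 * z * A0 t + \<sigma> * \<i> * B0 t) * v t)
        + (\<alpha> t * ((2 * z * C t - \<sigma> * \<i> * E t) * u t + \<sigma> * \<i> * (2 * z\<^sup>2 + A0 t * C t) * v t) + \<alpha>' * v t))
        (at t within {0..1})"
      by (intro has_vector_derivative_add u has_vector_derivative_mult \<alpha>' v)
    then show "((\<lambda>t. u t + \<alpha> t * v t) has_vector_derivative
        - \<sigma> * \<i> * (2 * z\<^sup>2) * (u t + \<alpha> t * v t) + (e1 * u t + (e2 + \<alpha>') * v t)) (at t within {0..1})"
      by (rule has_vector_derivative_eq_rhs) (simp add: e1_def e2_def algebra_simps)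
    have "norm (e1 * u t) \<le> (6 * Q ^ 3 + g t) / r * norm (u t)"
      unfolding norm_mult using e(1) g0 r by (intro mult_right_mono) (auto simp: add_divide_distrib add_increasing2)
    moreover have "norm ((e2 + \<alpha>') * v t) \<le> (6 * Q ^ 3 + g t) / r * norm (v t)"
      unfolding norm_mult using norm_triangle_ineq[of e2 \<alpha>'] e(2) a
      by (intro mult_right_mono) (auto simp: add_divide_distrib)
    ultimately show "norm (e1 * u t + (e2 + \<alpha>') * v t) \<le> (6 * Q ^ 3 + g t) / r * (norm (u t) + norm (v t))"
      using norm_triangle_ineq[of "e1 * u t" "(e2 + \<alpha>') * v t"] by (simp add: distrib_left)
  qed
qed

text \<open>With the couplings removed, U and V evolve with the rates -i\<theta> and i\<theta>,
  where \<theta> is 2 z^2, up to errors whose integral is O(1/r) relative to the size of the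
  solution. The free evolution of (-1, 1) gives 2i sin \<theta>. The threshold for |z| makes Q/r at
  most 1/10, so the gauge is invertible, and keeps the exponent in Gronwall's inequality below
  8.\<close>

lemma chi_N_large:
  assumes \<psi>: "norm \<psi> \<le> R" and z: "norm z \<ge> 10 * (2 * R + 1) ^ 3"
  shows "norm (chi_N z \<psi> - sin (2 * z\<^sup>2)) \<le> 150 * exp 8 * (2 * R + 1) ^ 3 * exp \<bar>Im (2 * z\<^sup>2)\<bar> / norm z"
proof -
  \<comment> \<open>2R bounds the components of the potential uniformly. Adding 1 makes Q at least
    1, so that its lower powers are dominated by \<open>Q ^ 3\<close>.\<close>
  define Q where "Q = 2 * R + 1"
  define r where "r = norm z"
  define \<theta> where "\<theta> = 2 * z\<^sup>2"
  define \<tau> where "\<tau> = \<bar>Im \<theta>\<bar>"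
  have R: "0 \<le> R" using \<psi> norm_ge_zero order_trans by blast
  have Q: "1 \<le> Q" using R by (simp add: Q_def)
  have Q3: "1 \<le> Q ^ 3" "Q \<le> Q ^ 3" using Q by (auto simp: self_le_power)
  have r: "10 * Q ^ 3 \<le> r" using z by (simp add: Q_def r_def)
  have r1: "1 \<le> r" using r Q3 by linarith
  have \<epsilon>: "1 / r\<^sup>2 > 0" using r1 by simp
  let ?p = "\<lambda>j t. h1_fun (\<psi> $ j) t"
  have "\<forall>j. \<exists>P P' G G'. (\<forall>t\<in>{0..1}. norm (?p j t - P t) \<le> 1 / r\<^sup>2 \<and> norm (P t) \<le> 2 * norm (\<psi> $ j)
      \<and> (P has_vector_derivative P' t) (at t within {0..1})
      \<and> (G has_real_derivative G' t) (at t within {0..1}) \<and> norm (P' t) \<le> G' t) \<and> G 1 - G 0 \<le> norm (\<psi> $ j)"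
    by (rule allI, rule h1_smoothing[OF \<epsilon>], blast)
  then obtain P P' G G' where PG: "\<And>j t. t \<in> {0..1} \<Longrightarrow> norm (?p j t - P j t) \<le> 1 / r\<^sup>2"
    "\<And>j t. t \<in> {0..1} \<Longrightarrow> norm (P j t) \<le> 2 * norm (\<psi> $ j)"
    "\<And>j t. t \<in> {0..1} \<Longrightarrow> (P j has_vector_derivative P' j t) (at t within {0..1})"
    "\<And>j t. t \<in> {0..1} \<Longrightarrow> (G j has_real_derivative G' j t) (at t within {0..1})"
    "\<And>j t. t \<in> {0..1} \<Longrightarrow> norm (P' j t) \<le> G' j t"
    "\<And>j. G j 1 - G j 0 \<le> norm (\<psi> $ j)"
    by metis
  have nj: "norm (\<psi> $ j) \<le> R" for j
    using Finite_Cartesian_Product.norm_nth_le[of \<psi> j] \<psi> by linarith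
  have pQ: "norm (?p j t) \<le> Q" for j t
    using norm_h1_fun_component[of \<psi> j t] \<psi> by (simp add: Q_def)
  have PQ: "norm (P j t) \<le> Q" if "t \<in> {0..1}" for j t
    using PG(2)[OF that, of j] nj[of j] by (simp add: Q_def)
  obtain u v where uv: "zs_solution z \<psi> u v" "u 0 = -1" "v 0 = 1" "chi_N z \<psi> = (u 1 + v 1) / (2 * \<i>)"
    using chi_N_solution by blast
  define g where "g t = G' 1 t + G' 2 t + G' 3 t + G' 4 t" for t
  define k where "k t = (6 * Q ^ 3 + g t) / r" for t
  \<comment> \<open>A primitive of k. Each of the four functions G grows by at most R, so the
    increment of KK over [0, 1] is at most (6 Q^3 + 4R)/r, hence at most 10 Q^3 / r.\<close>
  define KK where "KK t = (6 * Q ^ 3 * t + (G 1 t + G 2 t + G 3 t + G 4 t)) / r" for t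
  have G'0: "0 \<le> G' j t" if "t \<in> {0..1}" for j t
    using PG(5)[OF that, of j] norm_ge_zero order_trans by blast
  have kd: "(KK has_real_derivative k t) (at t within {0..1})" if "t \<in> {0..1}" for t
    unfolding KK_def k_def g_def by (use r1 in \<open>auto intro!: derivative_eq_intros PG(4) that\<close>)
  have cKK: "continuous_on {0..1} KK"
    unfolding continuous_on_eq_continuous_within using DERIV_continuous[OF kd] by blast
  have k0: "0 \<le> k t" if "t \<in> {0..1}" for t
    unfolding k_def g_def using G'0[OF that] Q r1 by (intro divide_nonneg_nonneg add_nonneg_nonneg) auto
  have KK1: "KK 1 - KK 0 \<le> 10 * Q ^ 3 / r"
  proof -
    have "KK 1 - KK 0 = (6 * Q ^ 3 + ((G 1 1 - G 1 0) + (G 2 1 - G 2 0) + (G 3 1 - G 3 0) + (G 4 1 - G 4 0))) / r"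
      by (simp add: KK_def diff_divide_distrib[symmetric] algebra_simps)
    also have "\<dots> \<le> (6 * Q ^ 3 + 4 * R) / r"
      using PG(6)[of 1] PG(6)[of 2] PG(6)[of 3] PG(6)[of 4] nj[of 1] nj[of 2] nj[of 3] nj[of 4] r1
      by (intro divide_right_mono) auto
    also have "\<dots> \<le> 10 * Q ^ 3 / r"
      using Q3 R r1 by (intro divide_right_mono) (auto simp: Q_def)
    finally show ?thesis .
  qed
  have KK_le: "KK t - KK 0 \<le> KK 1 - KK 0" if t: "t \<in> {0..1}" for t
  proof -
    have "KK t \<le> KK 1"
    proof (rule DERIV_nonneg_imp_increasing_open[of t 1])
      show "continuous_on {t..1} KK"
        by (rule continuous_on_subset[OF cKK]) (use t in auto)
      show "\<exists>y. (KK has_real_derivative y) (at x) \<and> 0 \<le> y" if "t < x" "x < 1" for x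
        using kd[of x] k0[of x] that t by (intro exI[of _ "k x"]) (auto simp: at_within_Icc_at)
    qed (use t in auto)
    then show ?thesis by simp
  qed
  define \<alpha> where "\<alpha> t = \<i> * P 1 t / (2 * z) - P 3 t / (4 * z\<^sup>2)" for t
  define \<beta> where "\<beta> t = - \<i> * P 2 t / (2 * z) - P 4 t / (4 * z\<^sup>2)" for t
  define U where "U t = u t + \<alpha> t * v t" for t
  define V where "V t = v t + \<beta> t * u t" for t
  have \<alpha>Q: "norm (\<alpha> t) \<le> Q / r" and \<beta>Q: "norm (\<beta> t) \<le> Q / r" if t: "t \<in> {0..1}" for t
  proof -
    show "norm (\<alpha> t) \<le> Q / r"
      by (rule gauge_coefficient_bounds(1)[where \<sigma> = 1 and z = z and ?A0.0 = "?p 1 t" and C = "?p 2 t"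
            and E = "?p 4 t" and ?B0.0 = "?p 3 t"])
        (use pQ PQ[OF t] PG(1)[OF t] r1 Q in \<open>auto simp: r_def \<alpha>_def\<close>)
    show "norm (\<beta> t) \<le> Q / r"
      by (rule gauge_coefficient_bounds(1)[where \<sigma> = "-1" and z = z and ?A0.0 = "?p 2 t" and C = "?p 1 t"
            and E = "?p 3 t" and ?B0.0 = "?p 4 t"])
        (use pQ PQ[OF t] PG(1)[OF t] r1 Q in \<open>auto simp: r_def \<beta>_def\<close>)
  qed
  have Qr: "Q / r \<le> 1 / 10" using r Q3 r1 by (simp add: divide_simps)
  have uw: "(u has_vector_derivative coef_a z \<psi> t * u t + coef_b z \<psi> t * v t) (at t within {0..1})"
    and vw: "(v has_vector_derivative coef_c z \<psi> t * u t - coef_a z \<psi> t * v t) (at t within {0..1})" for t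
    using uv(1) unfolding zs_solution_def by (blast intro: has_vector_derivative_at_within)+
  have "\<exists>e. (U has_vector_derivative - \<i> * \<theta> * U t + e) (at t within {0..1}) \<and>
      norm e \<le> k t * (norm (u t) + norm (v t))" if t: "t \<in> {0..1}" for t
  proof -
    have gg: "norm (P' 1 t) + norm (P' 3 t) \<le> g t"
      using PG(5)[OF t, of 1] PG(5)[OF t, of 3] G'0[OF t, of 2] G'0[OF t, of 4] by (simp add: g_def)
    have "\<exists>e. ((\<lambda>t. u t + (1 * \<i> * P 1 t / (2 * z) - P 3 t / (4 * z\<^sup>2)) * v t) has_vector_derivative
        - 1 * \<i> * (2 * z\<^sup>2) * (u t + (1 * \<i> * P 1 t / (2 * z) - P 3 t / (4 * z\<^sup>2)) * v t) + e)
        (at t within {0..1}) \<and> norm e \<le> (6 * Q ^ 3 + g t) / r * (norm (u t) + norm (v t))"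
    proof (rule gauge_transformed_equation[where ?A0.0 = "?p 1" and C = "?p 2"
            and E = "?p 4" and ?B0.0 = "?p 3" and A' = "P' 1" and B' = "P' 3" and g = g, OF _ r_def r1 Q t])
      show "(u has_vector_derivative - 1 * \<i> * (2 * z\<^sup>2 + ?p 1 t * ?p 2 t) * u t + (2 * z * ?p 1 t + 1 * \<i> * ?p 3 t) * v t)
          (at t within {0..1})"
        using uw[of t] by (simp add: coef_a_def coef_b_def)
      show "(v has_vector_derivative (2 * z * ?p 2 t - 1 * \<i> * ?p 4 t) * u t + 1 * \<i> * (2 * z\<^sup>2 + ?p 1 t * ?p 2 t) * v t)
          (at t within {0..1})"
        using vw[of t] by (simp add: coef_a_def coef_c_def)
    qed (use pQ PQ[OF t] PG(1,3)[OF t] gg in auto)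
    then show ?thesis by (simp add: U_def[abs_def] \<alpha>_def k_def \<theta>_def)
  qed
  then obtain eU where eU: "\<And>t. t \<in> {0..1} \<Longrightarrow> (U has_vector_derivative - \<i> * \<theta> * U t + eU t) (at t within {0..1})"
    "\<And>t. t \<in> {0..1} \<Longrightarrow> norm (eU t) \<le> k t * (norm (u t) + norm (v t))" by metis
  have "\<exists>e. (V has_vector_derivative \<i> * \<theta> * V t + e) (at t within {0..1}) \<and>
      norm e \<le> k t * (norm (u t) + norm (v t))" if t: "t \<in> {0..1}" for t
  proof -
    have gg: "norm (P' 2 t) + norm (P' 4 t) \<le> g t"
      using PG(5)[OF t, of 2] PG(5)[OF t, of 4] G'0[OF t, of 1] G'0[OF t, of 3] by (simp add: g_def)
    have "\<exists>e. ((\<lambda>t. v t + (-1 * \<i> * P 2 t / (2 * z) - P 4 t / (4 * z\<^sup>2)) * u t) has_vector_derivative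
        - (-1) * \<i> * (2 * z\<^sup>2) * (v t + (-1 * \<i> * P 2 t / (2 * z) - P 4 t / (4 * z\<^sup>2)) * u t) + e)
        (at t within {0..1}) \<and> norm e \<le> (6 * Q ^ 3 + g t) / r * (norm (v t) + norm (u t))"
    proof (rule gauge_transformed_equation[where ?A0.0 = "?p 2" and C = "?p 1"
            and E = "?p 3" and ?B0.0 = "?p 4" and A' = "P' 2" and B' = "P' 4" and g = g, OF _ r_def r1 Q t])
      show "(v has_vector_derivative - (-1) * \<i> * (2 * z\<^sup>2 + ?p 2 t * ?p 1 t) * v t + (2 * z * ?p 2 t + (-1) * \<i> * ?p 4 t) * u t)
          (at t within {0..1})"
        using vw[of t] by (simp add: coef_a_def coef_c_def algebra_simps)
      show "(u has_vector_derivative (2 * z * ?p 1 t - (-1) * \<i> * ?p 3 t) * v t + (-1) * \<i> * (2 * z\<^sup>2 + ?p 2 t * ?p 1 t) * u t)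
          (at t within {0..1})"
        using uw[of t] by (simp add: coef_a_def coef_b_def algebra_simps)
    qed (use pQ PQ[OF t] PG(1,3)[OF t] gg in auto)
    then show ?thesis by (simp add: V_def[abs_def] \<beta>_def k_def \<theta>_def add.commute)
  qed
  then obtain eV where eV: "\<And>t. t \<in> {0..1} \<Longrightarrow> (V has_vector_derivative \<i> * \<theta> * V t + eV t) (at t within {0..1})"
    "\<And>t. t \<in> {0..1} \<Longrightarrow> norm (eV t) \<le> k t * (norm (u t) + norm (v t))" by metis
  \<comment> \<open>The gauge changes u and v by at most a tenth of their sizes, so it can be undone
    with a factor 2. The second factor 2 compares |U| + |V| with the norm of the pair.\<close>
  have uvUV: "norm (u t) + norm (v t) \<le> 4 * norm (U t, V t)" if t: "t \<in> {0..1}" for t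
  proof -
    have a: "norm (\<alpha> t * v t) \<le> (1 / 10) * norm (v t)" "norm (\<beta> t * u t) \<le> (1 / 10) * norm (u t)"
      unfolding norm_mult
      by (rule mult_right_mono[OF order_trans[OF \<alpha>Q[OF t] Qr]]
          mult_right_mono[OF order_trans[OF \<beta>Q[OF t] Qr]]; simp)+
    have b: "norm (u t) \<le> norm (U t) + norm (\<alpha> t * v t)" "norm (v t) \<le> norm (V t) + norm (\<beta> t * u t)"
      using norm_triangle_ineq4[of "U t" "\<alpha> t * v t"] norm_triangle_ineq4[of "V t" "\<beta> t * u t"]
      by (simp_all add: U_def V_def)
    have "norm (u t) + norm (v t) \<le> 2 * (norm (U t) + norm (V t))"
    proof -
      have "x + y \<le> 2 * (X + Y)" if "x \<le> X + p" "y \<le> Y + q" "p \<le> 1 / 10 * y" "q \<le> 1 / 10 * x" "0 \<le> x" "0 \<le> y"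
        for x y X Y p q :: real
        using that by argo
      from this[OF b a norm_ge_zero norm_ge_zero] show ?thesis .
    qed
    then show ?thesis
      using norm_fst_le[of "U t" "V t"] norm_snd_le[of "V t" "U t"] by argo
  qed
  have err: "norm (eU t) \<le> 4 * k t * norm (U t, V t)" "norm (eV t) \<le> 4 * k t * norm (U t, V t)"
    if t: "t \<in> {0..1}" for t
  proof -
    have *: "k t * (norm (u t) + norm (v t)) \<le> 4 * k t * norm (U t, V t)"
      using mult_left_mono[OF uvUV[OF t] k0[OF t]] by simp
    show "norm (eU t) \<le> 4 * k t * norm (U t, V t)" "norm (eV t) \<le> 4 * k t * norm (U t, V t)"
      using eU(2)[OF t] eV(2)[OF t] * by linarith+
  qed
  define L where "L = 3 * exp (8::real)"
  have UVL: "norm (U t, V t) \<le> L * exp (\<tau> * t)" if t: "t \<in> {0..1}" for t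
  proof -
    \<comment> \<open>Damping by exp(-\<tau> s) gives both diagonal rates a nonpositive real part.
      Gronwall's inequality then sees only the errors, and the growth exp(\<tau> t) is restored at
      the end.\<close>
    define y where "y s = exp (- \<tau> * s) *\<^sub>R (U s, V s)" for s
    define y' where "y' s = exp (- \<tau> * s) *\<^sub>R ((- \<tau>) *\<^sub>R (U s, V s) + (- \<i> * \<theta> * U s + eU s, \<i> * \<theta> * V s + eV s))" for s
    have dy: "(y has_vector_derivative y' s) (at s within {0..t})" if s: "s \<in> {0..t}" for s
    proof -
      have s1: "s \<in> {0..1}" using s t by auto
      have "((\<lambda>s. exp (- \<tau> * s)) has_real_derivative exp (- \<tau> * s) * (- \<tau>)) (at s within {0..1})"
        by (auto intro!: derivative_eq_intros)
      from has_vector_derivative_scaleR[OF this has_vector_derivative_Pair[OF eU(1)[OF s1] eV(1)[OF s1]]]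
      have "(y has_vector_derivative y' s) (at s within {0..1})"
        unfolding y_def by (rule has_vector_derivative_eq_rhs) (simp add: y'_def algebra_simps)
      then show ?thesis using t by (rule_tac has_vector_derivative_within_subset) auto
    qed
    have kd': "((\<lambda>s. 8 * KK s) has_real_derivative 8 * k s) (at s within {0..t})" if "s \<in> {0..t}" for s
      using t that by (intro DERIV_cmult DERIV_subset[OF kd]) auto
    have "inner (y s) (y' s) \<le> 8 * k s * (norm (y s))\<^sup>2" if s: "s \<in> {0..t}" for s
    proof -
      have s1: "s \<in> {0..1}" using s t by auto
      have q: "inner w (c * w) = Re c * (norm w)\<^sup>2" for w c :: complex
        unfolding cmod_power2 by (simp add: inner_complex_def power2_eq_square algebra_simps)
      have "inner (U s, V s) ((- \<tau>) *\<^sub>R (U s, V s) + (- \<i> * \<theta> * U s + eU s, \<i> * \<theta> * V s + eV s))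
        = inner (U s) (((- of_real \<tau>) + (- \<i> * \<theta>)) * U s) + inner (V s) (((- of_real \<tau>) + \<i> * \<theta>) * V s)
          + inner (U s, V s) (eU s, eV s)"
        by (simp add: scaleR_conv_of_real inner_add_right distrib_right algebra_simps)
      also have "\<dots> \<le> 0 + 0 + norm (U s, V s) * norm (eU s, eV s)"
        unfolding q
        by (intro add_mono norm_cauchy_schwarz mult_nonpos_nonneg) (auto simp: \<tau>_def)
      also have "\<dots> \<le> norm (U s, V s) * (8 * k s * norm (U s, V s))"
        using norm_Pair_le[of "eU s" "eV s"] err[OF s1] by (simp add: mult_left_mono)
      finally have "inner (U s, V s) ((- \<tau>) *\<^sub>R (U s, V s) + (- \<i> * \<theta> * U s + eU s, \<i> * \<theta> * V s + eV s))
        \<le> 8 * k s * (norm (U s, V s))\<^sup>2" by (simp add: power2_eq_square mult_ac)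
      from mult_left_mono[OF this, of "exp (- \<tau> * s) * exp (- \<tau> * s)"]
      show ?thesis
        unfolding y_def y'_def inner_scaleR_left inner_scaleR_right norm_scaleR abs_exp_cancel
        by (simp only: power_mult_distrib power2_eq_square mult_ac exp_ge_zero mult_nonneg_nonneg simp_thms)
    qed
    from gronwall_inner[OF _ dy kd' this]
    have "norm (y t) \<le> norm (y 0) * exp (8 * KK t - 8 * KK 0)" using t by simp
    also have "\<dots> \<le> 3 * exp 8"
    proof (rule mult_mono)
      have "norm (\<alpha> 0) \<le> 1 / 10" "norm (\<beta> 0) \<le> 1 / 10" by (rule order_trans[OF \<alpha>Q Qr] order_trans[OF \<beta>Q Qr]; simp)+
      then have "norm (U 0) \<le> 1 + 1 / 10" "norm (V 0) \<le> 1 + 1 / 10"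
        using norm_triangle_ineq[of "-1" "\<alpha> 0"] norm_triangle_ineq4[of 1 "\<beta> 0"] by (auto simp: U_def V_def uv)
      then show "norm (y 0) \<le> 3" using norm_Pair_le[of "U 0" "V 0"] by (simp add: y_def)
      have "10 * Q ^ 3 / r \<le> 1" using r r1 by (simp add: divide_simps)
      then show "exp (8 * KK t - 8 * KK 0) \<le> exp 8" using KK_le[OF t] KK1 by simp
    qed auto
    finally have "norm (U t, V t) * exp (- (\<tau> * t)) \<le> L"
      unfolding y_def norm_scaleR by (simp add: L_def mult.commute)
    then show ?thesis by (simp add: exp_minus field_simps)
  qed
  have L: "0 \<le> L" by (simp add: L_def)
  \<comment> \<open>Variation of constants: after multiplication by exp(\<mu>(1 - s)) only the error
    is left in the derivative. \<open>UVL\<close> bounds the size of (U, V), and the smallness 1/r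
    comes from the increment of KK.\<close>
  have transport: "norm (W 1 - exp (\<mu>) * W 0) \<le> 40 * L * Q ^ 3 * exp \<tau> / r"
    if W: "\<And>t. t \<in> {0..1} \<Longrightarrow> (W has_vector_derivative \<mu> * W t + e t) (at t within {0..1})"
      and e: "\<And>t. t \<in> {0..1} \<Longrightarrow> norm (e t) \<le> 4 * k t * norm (U t, V t)" and \<mu>: "Re \<mu> \<le> \<tau>"
    for W e \<mu>
  proof -
    define f where "f s = exp (\<mu> * (1 - of_real s)) * W s" for s :: real
    have df: "(f has_vector_derivative exp (\<mu> * (1 - of_real s)) * e s) (at s within {0..1})" if s: "s \<in> {0..1}" for s
    proof -
      have "((\<lambda>x. exp (\<mu> * (1 - x))) has_field_derivative exp (\<mu> * (1 - of_real s)) * (- \<mu>)) (at (of_real s))"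
        by (auto intro!: derivative_eq_intros)
      then have "((\<lambda>s. exp (\<mu> * (1 - of_real s))) has_vector_derivative exp (\<mu> * (1 - of_real s)) * (- \<mu>)) (at s within {0..1})"
        by (rule has_vector_derivative_real_field)
      from has_vector_derivative_mult[OF this W[OF s]] show ?thesis
        unfolding f_def by (rule has_vector_derivative_eq_rhs) (simp add: algebra_simps)
    qed
    define c where "c = 4 * L * exp \<tau>"
    have c: "0 \<le> c" using L by (simp add: c_def)
    have "norm (f 1 - f 0) \<le> c * KK 1 - c * KK 0"
    proof (rule differentiable_bound_general[OF zero_less_one])
      show "continuous_on {0..1} f" unfolding continuous_on_eq_continuous_within
        using has_vector_derivative_continuous[OF df] by blast
      show "continuous_on {0..1} (\<lambda>t. c * KK t)"
        by (intro continuous_intros cKK)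
      fix s :: real assume s: "0 < s" "s < 1"
      then have at: "at s within {0..1} = at s" and s1: "s \<in> {0..1}" by (auto simp: at_within_Icc_at)
      show "(f has_vector_derivative exp (\<mu> * (1 - of_real s)) * e s) (at s)" using df[OF s1] at by simp
      show "((\<lambda>t. c * KK t) has_vector_derivative c * k s) (at s)"
        using DERIV_cmult[OF kd[OF s1], of c] at by (simp add: has_real_derivative_iff_has_vector_derivative)
      have "norm (exp (\<mu> * (1 - of_real s)) * e s) = exp (Re \<mu> * (1 - s)) * norm (e s)"
        by (simp add: norm_mult)
      also have "\<dots> \<le> exp (\<tau> * (1 - s)) * (4 * k s * (L * exp (\<tau> * s)))"
      proof (rule mult_mono)
        show "exp (Re \<mu> * (1 - s)) \<le> exp (\<tau> * (1 - s))" using \<mu> s by (simp add: mult_right_mono)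
        show "norm (e s) \<le> 4 * k s * (L * exp (\<tau> * s))"
          using e[OF s1] mult_left_mono[OF UVL[OF s1], of "4 * k s"] k0[OF s1] by simp
      qed auto
      also have "\<dots> = c * k s" by (simp add: c_def algebra_simps exp_add exp_diff)
      finally show "norm (exp (\<mu> * (1 - of_real s)) * e s) \<le> c * k s" .
    qed
    also have "\<dots> = c * (KK 1 - KK 0)" by (simp add: algebra_simps)
    also have "\<dots> \<le> c * (10 * Q ^ 3 / r)" using KK1 c by (rule mult_left_mono)
    finally show ?thesis by (simp add: f_def c_def mult_ac)
  qed
  have tU: "norm (U 1 - exp (- \<i> * \<theta>) * U 0) \<le> 40 * L * Q ^ 3 * exp \<tau> / r"
    by (rule transport[where e = eU]) (use eU(1) err(1) in \<open>auto simp: \<tau>_def\<close>)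
  have tV: "norm (V 1 - exp (\<i> * \<theta>) * V 0) \<le> 40 * L * Q ^ 3 * exp \<tau> / r"
    by (rule transport[where e = eV]) (use eV(1) err(2) in \<open>auto simp: \<tau>_def\<close>)
  have ex: "norm (exp (- \<i> * \<theta>)) \<le> exp \<tau>" "norm (exp (\<i> * \<theta>)) \<le> exp \<tau>" by (auto simp: \<tau>_def)
  have Qr0: "0 \<le> Q / r" using Q r1 by simp
  have Qr3: "Q / r \<le> Q ^ 3 / r" using Q3 r1 by (intro divide_right_mono) auto
  have s1: "norm (\<alpha> 1 * v 1) \<le> (Q / r) * (norm (u 1) + norm (v 1))" "norm (\<beta> 1 * u 1) \<le> (Q / r) * (norm (u 1) + norm (v 1))"
    unfolding norm_mult by (rule mult_mono[OF \<alpha>Q _ Qr0] mult_mono[OF \<beta>Q _ Qr0]; simp)+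
  have "(Q / r) * (norm (u 1) + norm (v 1)) \<le> (Q ^ 3 / r) * (4 * (L * exp \<tau>))"
    using uvUV[of 1] UVL[of 1] Qr3 Q r1 by (intro mult_mono) auto
  then have s1': "norm (\<alpha> 1 * v 1) \<le> 4 * L * Q ^ 3 * exp \<tau> / r" "norm (\<beta> 1 * u 1) \<le> 4 * L * Q ^ 3 * exp \<tau> / r"
    using s1 by (simp_all add: mult_ac)
  have "norm (exp (- \<i> * \<theta>) * \<alpha> 0) \<le> exp \<tau> * (Q ^ 3 / r)" "norm (exp (\<i> * \<theta>) * \<beta> 0) \<le> exp \<tau> * (Q ^ 3 / r)"
    unfolding norm_mult[of "exp (- \<i> * \<theta>)"] norm_mult[of "exp (\<i> * \<theta>)"]
    by (rule mult_mono[OF ex(1) order_trans[OF \<alpha>Q Qr3]] mult_mono[OF ex(2) order_trans[OF \<beta>Q Qr3]]; simp)+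
  then have s0: "norm (exp (- \<i> * \<theta>) * \<alpha> 0) \<le> L * Q ^ 3 * exp \<tau> / r" "norm (exp (\<i> * \<theta>) * \<beta> 0) \<le> L * Q ^ 3 * exp \<tau> / r"
  proof -
    have "exp \<tau> * (Q ^ 3 / r) \<le> L * (exp \<tau> * (Q ^ 3 / r))"
    proof -
      have "0 \<le> exp \<tau> * (Q ^ 3 / r)" using Q r1 by simp
      moreover have "(1::real) \<le> exp 8" by simp
      then have "1 \<le> L" unfolding L_def by linarith
      ultimately show ?thesis using mult_right_mono by fastforce
    qed
    then show "norm (exp (- \<i> * \<theta>) * \<alpha> 0) \<le> L * Q ^ 3 * exp \<tau> / r" "norm (exp (\<i> * \<theta>) * \<beta> 0) \<le> L * Q ^ 3 * exp \<tau> / r"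
      using \<open>norm (exp (- \<i> * \<theta>) * \<alpha> 0) \<le> exp \<tau> * (Q ^ 3 / r)\<close> \<open>norm (exp (\<i> * \<theta>) * \<beta> 0) \<le> exp \<tau> * (Q ^ 3 / r)\<close>
      by (simp_all add: mult_ac)
  qed
  have "2 * \<i> * (chi_N z \<psi> - sin \<theta>) = (U 1 - exp (- \<i> * \<theta>) * U 0) + (V 1 - exp (\<i> * \<theta>) * V 0)
      - \<alpha> 1 * v 1 - \<beta> 1 * u 1 + exp (- \<i> * \<theta>) * \<alpha> 0 - exp (\<i> * \<theta>) * \<beta> 0"
  proof -
    have "2 * \<i> * chi_N z \<psi> = u 1 + v 1" by (simp add: uv(4))
    moreover have "2 * \<i> * sin \<theta> = exp (\<i> * \<theta>) - exp (- \<i> * \<theta>)" by (simp add: sin_exp_eq)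
    ultimately show ?thesis unfolding right_diff_distrib by (simp add: U_def V_def uv algebra_simps)
  qed
  also have "norm \<dots> \<le> norm (U 1 - exp (- \<i> * \<theta>) * U 0) + norm (V 1 - exp (\<i> * \<theta>) * V 0)
      + norm (\<alpha> 1 * v 1) + norm (\<beta> 1 * u 1) + norm (exp (- \<i> * \<theta>) * \<alpha> 0) + norm (exp (\<i> * \<theta>) * \<beta> 0)"
    by (intro order_trans[OF norm_triangle_ineq] order_trans[OF norm_triangle_ineq4] add_mono order_refl)
  \<comment> \<open>The six terms contribute 40 + 40 + 4 + 4 + 1 + 1.\<close>
  also have "\<dots> \<le> 90 * (L * Q ^ 3 * exp \<tau> / r)"
    using tU tV s1' s0 by simp
  finally have "norm (chi_N z \<psi> - sin \<theta>) \<le> 45 * (L * Q ^ 3 * exp \<tau> / r)" by (simp add: norm_mult)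
  also have "\<dots> \<le> 150 * exp 8 * Q ^ 3 * exp \<tau> / r"
  proof -
    define X where "X = exp 8 * Q ^ 3 * exp \<tau> / r"
    have "45 * (L * Q ^ 3 * exp \<tau> / r) = 135 * X" "150 * exp 8 * Q ^ 3 * exp \<tau> / r = 150 * X"
      by (simp_all add: L_def X_def)
    moreover have "0 \<le> X" using Q r1 by (simp add: X_def)
    ultimately show ?thesis by simp
  qed
  finally show ?thesis by (simp add: Q_def r_def \<tau>_def \<theta>_def)
qed

section \<open>The free case and bounds uniform in the spectral parameter\<close>

lemma chi_N_0: "chi_N z 0 = sin (2 * z\<^sup>2)"
proof -
  define a where "a = 2 * \<i> * z\<^sup>2"
  have d: "((\<lambda>t. exp (c * of_real t)) has_vector_derivative c * exp (c * of_real t)) (at t)" for c :: complex and t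
    by (rule has_vector_derivative_real_field) (auto intro!: derivative_eq_intros)
  have "((\<lambda>t. - exp (- a * of_real t)) has_vector_derivative - (- a * exp (- a * of_real t))) (at t)" for t
    by (rule has_vector_derivative_minus[OF d])
  then have "zs_solution z 0 (\<lambda>t. - exp (- a * of_real t)) (\<lambda>t. exp (a * of_real t))"
    using d[of a] by (simp add: zs_solution_def coef_a_def coef_b_def coef_c_def a_def mult_ac)
  from chi_N_eq[OF this] show ?thesis
    by (simp add: a_def sin_exp_eq algebra_simps)
qed

lemma norm_sin_le_exp: "norm (sin w) \<le> exp \<bar>Im w\<bar>" for w :: complex
proof -
  have "norm (sin w) = norm (exp (\<i> * w) - exp (- (\<i> * w))) / 2"
    by (simp add: sin_exp_eq norm_divide norm_mult)
  also have "norm (exp (\<i> * w) - exp (- (\<i> * w))) \<le> norm (exp (\<i> * w)) + norm (exp (- (\<i> * w)))"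
    by (rule norm_triangle_ineq4)
  also have "\<dots> \<le> 2 * exp \<bar>Im w\<bar>" by simp (metis abs_ge_self abs_ge_minus_self exp_le_cancel_iff add_mono mult_2)
  finally show ?thesis by simp
qed

text \<open>For large |z| this is \<open>chi_N_large\<close>. On the remaining compact set of z the
  crude growth bound of the solutions is enough, since 1 + |z| is bounded there.\<close>

lemma chi_N_asymptotic:
  obtains C where "0 \<le> C"
    "\<And>z \<psi>. norm \<psi> \<le> R \<Longrightarrow> norm (chi_N z \<psi> - sin (2 * z\<^sup>2)) \<le> C * exp \<bar>Im (2 * z\<^sup>2)\<bar> / (1 + norm z)"
proof (cases "0 \<le> R")
  case False
  then have "\<not> norm \<psi> \<le> R" for \<psi> :: potential using norm_ge_zero[of \<psi>] by linarith
  then show ?thesis using that[of 0] by simp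
next
  case R: True
  define \<Lambda> where "\<Lambda> = 10 * (2 * R + 1) ^ 3"
  have \<Lambda>: "1 \<le> \<Lambda>" using R one_le_power[of "2 * R + 1" 3] unfolding \<Lambda>_def by linarith
  define K where "K = 2 * \<Lambda>\<^sup>2 + 4 * R\<^sup>2 + 4 * \<Lambda> * R + 2 * R"
  define C1 where "C1 = 2 * (150 * exp 8 * (2 * R + 1) ^ 3)"
  define C2 where "C2 = (1 + \<Lambda>) * (2 * exp (4 * K) + 1)"
  have C: "0 \<le> C1" "0 \<le> C2" using R \<Lambda> by (simp_all add: C1_def C2_def)
  show ?thesis
  proof (rule that[of "C1 + C2"])
    show "0 \<le> C1 + C2" using C by simp
    fix z :: complex and \<psi> :: potential
    assume \<psi>: "norm \<psi> \<le> R"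
    let ?e = "exp \<bar>Im (2 * z\<^sup>2)\<bar>"
    have e1: "1 \<le> ?e" by simp
    have "norm (chi_N z \<psi> - sin (2 * z\<^sup>2)) * (1 + norm z) \<le> (C1 + C2) * ?e"
    proof (cases "\<Lambda> \<le> norm z")
      case True
      then have z1: "1 \<le> norm z" using \<Lambda> by linarith
      have "norm (chi_N z \<psi> - sin (2 * z\<^sup>2)) * (1 + norm z) \<le>
          (150 * exp 8 * (2 * R + 1) ^ 3 * ?e / norm z) * (2 * norm z)"
        using chi_N_large[OF \<psi>] True z1 R by (intro mult_mono) (auto simp: \<Lambda>_def)
      also have "\<dots> = C1 * ?e" using order.strict_trans2[OF zero_less_one z1] by (simp add: C1_def)
      also have "\<dots> \<le> (C1 + C2) * ?e" using C by (intro mult_right_mono) auto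
      finally show ?thesis .
    next
      case False
      then have z: "norm z \<le> \<Lambda>" by simp
      obtain u v where uv: "zs_solution z \<psi> u v" "u 0 = -1" "v 0 = 1" "chi_N z \<psi> = (u 1 + v 1) / (2 * \<i>)"
        using chi_N_solution by blast
      have "norm (u 1, v 1) \<le> norm (-1::complex, 1::complex) * exp (4 * K * \<bar>1\<bar>)"
        using zs_solution_bound[OF uv(1) norm_coef_le[OF \<psi> z], of 1] uv(2,3) by (simp add: K_def)
      also have "\<dots> \<le> 2 * exp (4 * K)" using norm_Pair_le[of "-1::complex" "1::complex"] by simp
      finally have "norm (u 1) + norm (v 1) \<le> 2 * (2 * exp (4 * K))"
        using norm_fst_le[of "u 1" "v 1"] norm_snd_le[of "v 1" "u 1"] by linarith
      then have "norm (chi_N z \<psi>) \<le> 2 * exp (4 * K)"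
        using norm_triangle_ineq[of "u 1" "v 1"] by (simp add: uv(4) norm_divide norm_mult)
      also have "\<dots> \<le> 2 * exp (4 * K) * ?e" using e1 mult_left_mono[OF e1, of "2 * exp (4 * K)"] by simp
      finally have "norm (chi_N z \<psi> - sin (2 * z\<^sup>2)) \<le> (2 * exp (4 * K) + 1) * ?e"
        using norm_triangle_ineq4[of "chi_N z \<psi>" "sin (2 * z\<^sup>2)"] norm_sin_le_exp[of "2 * z\<^sup>2"]
        by (simp add: algebra_simps)
      then have "norm (chi_N z \<psi> - sin (2 * z\<^sup>2)) * (1 + norm z) \<le> ((2 * exp (4 * K) + 1) * ?e) * (1 + \<Lambda>)"
        using z by (intro mult_mono) auto
      also have "\<dots> = C2 * ?e" by (simp add: C2_def)
      also have "\<dots> \<le> (C1 + C2) * ?e" using C by (intro mult_right_mono) auto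
      finally show ?thesis .
    qed
    moreover have "0 < 1 + norm z" using norm_ge_zero[of z] by linarith
    ultimately show "norm (chi_N z \<psi> - sin (2 * z\<^sup>2)) \<le> (C1 + C2) * ?e / (1 + norm z)"
      by (simp add: pos_le_divide_eq)
  qed
qed

lemma analytic_on_potentials_diff_const:
  assumes "analytic_on_potentials f W"
  shows "analytic_on_potentials (\<lambda>\<psi>. f \<psi> - c) W"
  unfolding analytic_on_potentials_def
proof
  fix \<psi> assume "\<psi> \<in> W"
  then obtain D where D: "(f has_derivative D) (at \<psi>)" "\<forall>c h. D (potential_scaleC c h) = c * D h"
    using assms unfolding analytic_on_potentials_def by blast
  from has_derivative_diff[OF D(1) has_derivative_const, of c] D(2)
  show "\<exists>D. ((\<lambda>\<psi>. f \<psi> - c) has_derivative D) (at \<psi>) \<and> (\<forall>c h. D (potential_scaleC c h) = c * D h)"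
    by auto
qed

text \<open>The constant of \<open>chi_N_asymptotic\<close> does not become small with \<psi>. For
  fixed z, however, the difference is analytic in \<psi>, bounded on the ball of radius 2 and zero
  at \<psi> = 0, so the Lipschitz estimate on the unit ball supplies the factor
  \<open>norm \<psi>\<close>.\<close>

lemma chi_N_near_zero:
  obtains C where "0 \<le> C"
    "\<And>z \<psi>. norm \<psi> < 1 \<Longrightarrow> norm (chi_N z \<psi> - sin (2 * z\<^sup>2)) \<le> C * norm \<psi> * exp \<bar>Im (2 * z\<^sup>2)\<bar>"
proof -
  obtain C where C: "0 \<le> C"
    "\<And>z \<psi>. norm \<psi> \<le> 2 \<Longrightarrow> norm (chi_N z \<psi> - sin (2 * z\<^sup>2)) \<le> C * exp \<bar>Im (2 * z\<^sup>2)\<bar> / (1 + norm z)"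
    using chi_N_asymptotic[of 2] by blast
  show ?thesis
  proof (rule that[of "2 * C"])
    show "0 \<le> 2 * C" using C by simp
    fix z and \<psi> :: potential assume \<psi>: "norm \<psi> < 1"
    let ?K = "C * exp \<bar>Im (2 * z\<^sup>2)\<bar>"
    have "norm ((chi_N z \<psi> - sin (2 * z\<^sup>2)) - (chi_N z 0 - sin (2 * z\<^sup>2))) \<le> 2 * ?K / 1 * norm (\<psi> - 0)"
    proof (rule analytic_on_potentials_lipschitz[OF analytic_on_potentials_diff_const[OF analytic_on_potentials_chi_N]])
      fix \<phi> :: potential assume "norm \<phi> < 2 * 1"
      then have "norm (chi_N z \<phi> - sin (2 * z\<^sup>2)) \<le> ?K / (1 + norm z)" using C(2)[of \<phi> z] by simp
      also have "\<dots> \<le> ?K / 1" using C(1) by (intro divide_left_mono) (auto simp: add_pos_nonneg)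
      finally show "norm (chi_N z \<phi> - sin (2 * z\<^sup>2)) \<le> ?K" by simp
    qed (use \<psi> in auto)
    then show "norm (chi_N z \<psi> - sin (2 * z\<^sup>2)) \<le> 2 * C * norm \<psi> * exp \<bar>Im (2 * z\<^sup>2)\<bar>"
      by (simp add: chi_N_0 mult_ac)
  qed
qed

section \<open>Counting zeros\<close>

text \<open>Since |sin w|^2 = (E + 1/E - 2 cos 2x)/4, the constant 1/8 amounts to 2 cos 2x \<le>
  (15/16) E + 1/E. For |y| \<ge> pi/8 it suffices that E \<ge> 2. For smaller |y| the distance
  hypothesis keeps x at least pi/6 away from the multiples of pi, whence 2 cos 2x \<le> 1.\<close>

lemma norm_sin_ge_exp:
  fixes w :: complex
  assumes away: "\<And>m::int. pi / 4 \<le> norm (w - of_int m * of_real pi)"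
  shows "exp \<bar>Im w\<bar> / 8 \<le> norm (sin w)"
proof -
  define x where "x = Re w"
  define y where "y = Im w"
  define E where "E = exp (2 * \<bar>y\<bar>)"
  have E1: "1 \<le> E" by (simp add: E_def)
  have sq: "(norm (sin w))\<^sup>2 = (E + inverse E - 2 * cos (2 * x)) / 4"
    unfolding norm_sin_squared E_def x_def y_def
    by (cases "Im w \<ge> 0") (auto simp: exp_minus)
  have "2 * cos (2 * x) \<le> (15/16) * E + inverse E"
  proof (cases "pi / 8 \<le> \<bar>y\<bar>")
    case True
    define h where "h = 2 * \<bar>y\<bar>"
    have h: "3/4 \<le> h" using True pi_gt3 by (simp add: h_def)
    have "1 + h + h\<^sup>2 / 2 \<le> E"
      unfolding E_def h_def by (rule exp_lower_Taylor_quadratic) simp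
    moreover have "(3/4)\<^sup>2 \<le> h\<^sup>2" using h by (intro power_mono) auto
    ultimately have E2: "2 \<le> E" using h by (simp add: power2_eq_square)
    have "(15/16) * E + inverse E - 2 = inverse E * ((15/16) * E\<^sup>2 - 2 * E + 1)"
      using E1 by (simp add: field_simps power2_eq_square)
    moreover have "0 \<le> (15/16) * E\<^sup>2 - 2 * E + 1"
    proof -
      have "(15/16) * E\<^sup>2 - 2 * E + 1 = (E - 2) * ((15/16) * E - 1/8) + 3/4"
        by (simp add: power2_eq_square field_simps)
      moreover have "0 \<le> (E - 2) * ((15/16) * E - 1/8)" using E2 by (intro mult_nonneg_nonneg) auto
      ultimately show ?thesis by linarith
    qed
    ultimately have "0 \<le> (15/16) * E + inverse E - 2" using E1 by (simp add: mult_nonneg_nonneg)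
    then show ?thesis using cos_le_one[of "2 * x"] by linarith
  next
    case False
    define n where "n = round (x / pi)"
    define s where "s = x - of_int n * pi"
    have "\<bar>x / pi - of_int n\<bar> \<le> 1 / 2"
      using of_int_round_abs_le[of "x / pi"] by (simp add: n_def abs_minus_commute)
    then have "\<bar>(x / pi - of_int n) * pi\<bar> \<le> 1 / 2 * pi" unfolding abs_mult by (intro mult_mono) auto
    then have s: "\<bar>s\<bar> \<le> pi / 2" by (simp add: s_def algebra_simps)
    have "norm (w - of_int n * of_real pi) = sqrt (s\<^sup>2 + y\<^sup>2)"
      by (simp add: cmod_def s_def x_def y_def)
    then have "pi / 4 \<le> sqrt (s\<^sup>2 + y\<^sup>2)" using away[of n] by simp
    then have "(pi / 4)\<^sup>2 \<le> (sqrt (s\<^sup>2 + y\<^sup>2))\<^sup>2" by (intro power_mono) auto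
    then have "(pi / 4)\<^sup>2 \<le> s\<^sup>2 + y\<^sup>2" by simp
    moreover have "y\<^sup>2 \<le> (pi / 8)\<^sup>2" using False by (intro power2_le_iff_abs_le[THEN iffD2]) auto
    moreover have "(pi / 6)\<^sup>2 + (pi / 8)\<^sup>2 \<le> (pi / 4)\<^sup>2" by (simp add: power2_eq_square)
    ultimately have "(pi / 6)\<^sup>2 \<le> s\<^sup>2" by linarith
    then have s6: "pi / 6 \<le> \<bar>s\<bar>" by (simp add: abs_le_square_iff[symmetric])
    have "cos (2 * x) = cos (2 * s + 2 * (of_int n * pi))" by (simp add: s_def)
    also have "2 * s + 2 * (of_int n * pi) = 2 * s + (2 * pi) * of_int n" by simp
    also have "cos \<dots> = cos (2 * s)" by (simp only: cos_add cos_int_2pin sin_int_2pin mult_1_right mult_zero_right diff_0_right)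
    also have "\<dots> = cos \<bar>2 * s\<bar>" by simp
    also have "\<dots> \<le> cos (pi / 3)" using s s6 by (intro cos_monotone_0_pi_le) auto
    finally have "2 * cos (2 * x) \<le> 1" by (simp add: cos_60)
    moreover have "1 \<le> (15/16) * E + inverse E"
    proof -
      have "(15/16) * E + inverse E - 1 = inverse E * ((15/16) * E\<^sup>2 - E + 1)"
        using E1 by (simp add: field_simps power2_eq_square)
      moreover have "(15/16) * E\<^sup>2 - E + 1 = (3/4) * E\<^sup>2 - E + 1 / 3 + (3/16) * E\<^sup>2 + 2/3" by simp
      moreover have "(3/4) * E\<^sup>2 - E + 1 / 3 = 3/4 * (E - 2/3)\<^sup>2" by (simp add: power2_eq_square algebra_simps)
      moreover have "0 \<le> (E - 2/3)\<^sup>2" "0 \<le> E\<^sup>2" by simp_all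
      ultimately have "0 \<le> (15/16) * E\<^sup>2 - E + 1" by linarith
      then have "0 \<le> inverse E * ((15/16) * E\<^sup>2 - E + 1)" using E1 by (intro mult_nonneg_nonneg) auto
      then show ?thesis using \<open>(15/16) * E + inverse E - 1 = inverse E * ((15/16) * E\<^sup>2 - E + 1)\<close> by linarith
    qed
    ultimately show ?thesis by linarith
  qed
  then have "E / 64 \<le> (norm (sin w))\<^sup>2" unfolding sq by (simp add: field_simps)
  moreover have "(exp \<bar>y\<bar> / 8)\<^sup>2 = E / 64" by (simp add: E_def power_divide exp_double)
  ultimately show ?thesis unfolding y_def by (metis norm_ge_zero power2_le_imp_le)
qed

text \<open>Rouche's theorem asks for finitely many zeros on an open set around the circle. Zeros
  might accumulate at the boundary of the ball of radius R, so an intermediate radius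
  \<open>R'\<close> is used, whose closed ball is compact inside. The winding numbers 1 and 0 reduce
  the sums to the inner ball.\<close>

lemma rouche_ball:
  assumes f: "f holomorphic_on ball a R" and g: "g holomorphic_on ball a R" and r: "0 < r" "r < R"
    and less: "\<And>z. norm (z - a) = r \<Longrightarrow> norm (g z - f z) < norm (f z)"
  shows "finite {z \<in> ball a r. f z = 0}" and "finite {z \<in> ball a r. g z = 0}"
    and "(\<Sum>z | z \<in> ball a r \<and> g z = 0. zorder g z) = (\<Sum>z | z \<in> ball a r \<and> f z = 0. zorder f z)"
proof -
  define R' where "R' = (r + R) / 2"
  have R': "r < R'" "R' < R" using r by (auto simp: R'_def)
  have f0: "f z \<noteq> 0" and g0: "g z \<noteq> 0" if "norm (z - a) = r" for z
    using less[OF that] by auto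
  have fin: "finite {z \<in> ball a R'. h z = 0}"
    if h: "h holomorphic_on ball a R" and h0: "\<And>z. norm (z - a) = r \<Longrightarrow> h z \<noteq> 0" for h
  proof -
    have h1: "h (a + of_real r) \<noteq> 0" using r by (intro h0) auto
    have "finite {z \<in> cball a R'. h z = 0}"
    proof (cases "h constant_on ball a R")
      case True
      then obtain c where c: "\<And>z. z \<in> ball a R \<Longrightarrow> h z = c" unfolding constant_on_def by blast
      have "a + of_real r \<in> ball a R" using r by (simp add: dist_norm)
      then have "c \<noteq> 0" using h1 c by metis
      then have "{z \<in> cball a R'. h z = 0} = {}" using c R' by fastforce
      then show ?thesis by (simp only: finite.emptyI)
    next
      case False
      show ?thesis by (rule holomorphic_compact_finite_zeros[OF h _ _ _ _ False]) (use R' in auto)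
    qed
    then show ?thesis by (rule rev_finite_subset) auto
  qed
  have ff: "finite {z \<in> ball a R'. f z = 0}" by (rule fin[OF f f0])
  have fg: "finite {z \<in> ball a R'. g z = 0}" by (rule fin[OF g g0])
  show "finite {z \<in> ball a r. f z = 0}" using R' by (intro finite_subset[OF _ ff]) auto
  show "finite {z \<in> ball a r. g z = 0}" using R' by (intro finite_subset[OF _ fg]) auto
  have loc: "(\<Sum>p\<in>{z \<in> ball a R'. h z = 0}. winding_number (circlepath a r) p * zorder h p)
      = of_int (\<Sum>z | z \<in> ball a r \<and> h z = 0. zorder h z)"
    if fh: "finite {z \<in> ball a R'. h z = 0}" and h0: "\<And>z. norm (z - a) = r \<Longrightarrow> h z \<noteq> 0" for h
  proof -
    have w: "winding_number (circlepath a r) p = (if p \<in> ball a r then 1 else 0)" if "h p = 0" for p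
    proof (cases "p \<in> ball a r")
      case True
      then show ?thesis by (simp add: dist_norm norm_minus_commute winding_number_circlepath)
    next
      case False
      then have "p \<notin> cball a r" using h0[of p] that by (auto simp: dist_norm norm_minus_commute)
      then have "winding_number (circlepath a r) p = 0"
        using r by (intro winding_number_zero_outside[where s = "cball a r"]) (auto simp: dist_norm)
      then show ?thesis using False by simp
    qed
    have "(\<Sum>p\<in>{z \<in> ball a R'. h z = 0}. winding_number (circlepath a r) p * zorder h p)
        = (\<Sum>p\<in>{z \<in> ball a R'. h z = 0}. if p \<in> ball a r then of_int (zorder h p) else 0)"
      by (intro sum.cong) (auto simp: w)
    also have "\<dots> = (\<Sum>p\<in>{p \<in> {z \<in> ball a R'. h z = 0}. p \<in> ball a r}. of_int (zorder h p))"
      by (rule sum.inter_filter[OF fh, symmetric])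
    also have "{p \<in> {z \<in> ball a R'. h z = 0}. p \<in> ball a r} = {z. z \<in> ball a r \<and> h z = 0}" using R' by auto
    finally show ?thesis by simp
  qed
  define k where "k z = g z - f z" for z
  have kg: "f p + k p = g p" for p by (simp add: k_def)
  have "(\<Sum>p\<in>{z \<in> ball a R'. f z + k z = 0}. winding_number (circlepath a r) p * zorder (\<lambda>p. f p + k p) p)
      = (\<Sum>p\<in>{z \<in> ball a R'. f z = 0}. winding_number (circlepath a r) p * zorder f p)"
  proof (rule Rouche_theorem)
    show "f holomorphic_on ball a R'" using R' by (intro holomorphic_on_subset[OF f]) auto
    show "k holomorphic_on ball a R'" unfolding k_def
      using R' by (intro holomorphic_on_diff holomorphic_on_subset[OF f] holomorphic_on_subset[OF g]) auto
    show "\<forall>z\<in>path_image (circlepath a r). norm (k z) < norm (f z)"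
      using less r by (auto simp: k_def dist_norm norm_minus_commute)
    show "\<forall>z. z \<notin> ball a R' \<longrightarrow> winding_number (circlepath a r) z = 0"
      using r R' by (intro allI impI winding_number_zero_outside[where s = "cball a r"]) (auto simp: dist_norm)
  qed (use ff fg r R' in \<open>auto simp: dist_norm kg\<close>)
  then have "(\<Sum>p\<in>{z \<in> ball a R'. g z = 0}. winding_number (circlepath a r) p * zorder g p)
      = (\<Sum>p\<in>{z \<in> ball a R'. f z = 0}. winding_number (circlepath a r) p * zorder f p)"
    by (simp only: kg)
  note eq = trans[OF trans[OF loc[OF fg g0, symmetric] this] loc[OF ff f0]]
  show "(\<Sum>z | z \<in> ball a r \<and> g z = 0. zorder g z) = (\<Sum>z | z \<in> ball a r \<and> f z = 0. zorder f z)"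
    using eq by (simp only: of_int_eq_iff)
qed

lemma zorder_pos_of_zero:
  assumes "f holomorphic_on S" "open S" "connected S" "z \<in> S" "w \<in> S" "f w \<noteq> 0" "f z = 0"
  shows "0 < zorder f z"
  using zorder_exist_zero[OF assms(1-4)] assms(5-7) by auto

text \<open>Multiplicities are defined by \<open>zorder\<close>, while the change of coordinates and
  the implicit function argument work with derivatives. Both directions are used.\<close>

lemma zorder_eq_1_iff_deriv:
  assumes "f holomorphic_on S" "open S" "connected S" "z \<in> S" "w \<in> S" "f w \<noteq> 0" "f z = 0"
  shows "zorder f z = 1 \<longleftrightarrow> deriv f z \<noteq> 0"
proof
  assume 1: "zorder f z = 1"
  obtain r where r: "r > 0" "cball z r \<subseteq> S" "zor_poly f z holomorphic_on cball z r"
    "\<And>w. w \<in> cball z r \<Longrightarrow> f w = zor_poly f z w * (w - z) ^ nat (zorder f z) \<and> zor_poly f z w \<noteq> 0"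
    using zorder_exist_zero[OF assms(1-4)] assms(5,6) by blast
  let ?g = "zor_poly f z"
  have g: "?g field_differentiable (at z)"
    by (rule holomorphic_on_imp_differentiable_at[OF holomorphic_on_subset[OF r(3) ball_subset_cball]])
      (use r(1) in auto)
  have "((\<lambda>w. ?g w * (w - z)) has_field_derivative deriv ?g z * (z - z) + 1 * ?g z) (at z)"
    using g by (auto intro!: derivative_eq_intros DERIV_deriv_iff_field_differentiable[THEN iffD2])
  then have "(f has_field_derivative ?g z) (at z)"
    by (rule_tac has_field_derivative_transform_within_open[where S = "ball z r"]) (use r(1,4) 1 in auto)
  then show "deriv f z \<noteq> 0" using r(1) r(4)[of z] DERIV_imp_deriv by fastforce
next
  assume "deriv f z \<noteq> 0"
  then show "zorder f z = 1" by (intro zorder_zero_eqI[OF assms(1,2,4)]) (use assms(7) in auto)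
qed

subsection \<open>The discs as images of discs under the square root\<close>

text \<open>The rotations by 1, -1, i and -i that carry the right half plane to the half plane of a
  disc. The factor \<open>sgn n\<close> gives 0 for n = 0; then \<open>root_param\<close> is 0 as
  well, which is the free eigenvalue of label 0.\<close>

definition sector_unit :: "nat \<Rightarrow> int \<Rightarrow> complex" where
  "sector_unit i n = (if i = 1 then 1 else \<i>) * of_int (sgn n)"

text \<open>For nonzero n, the number m such that the disc is one half of
  \<open>U_set m\<close>.\<close>

definition disc_index :: "nat \<Rightarrow> int \<Rightarrow> int" where
  "disc_index i n = (if i = 1 then \<bar>n\<bar> else - \<bar>n\<bar>)"

text \<open>The coordinate in which a half disc becomes round: on it, this is the inverse of the map
  sending z to 2 z^2 or -2 z^2, and it carries the disc of radius pi/4 about |n| pi onto the half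
  disc.\<close>

definition root_param :: "nat \<Rightarrow> int \<Rightarrow> complex \<Rightarrow> complex" where
  "root_param i n w = sector_unit i n * csqrt (w / 2)"

lemma sector_unit_simps:
  assumes "n \<noteq> 0"
  shows "sector_unit i n \<noteq> 0" "norm (sector_unit i n) = 1"
    "(sector_unit i n)\<^sup>2 = (if i = 1 then 1 else -1)" "of_int (disc_index i n) = (sector_unit i n)\<^sup>2 * of_int \<bar>n\<bar>"
  using assms by (auto simp: sector_unit_def disc_index_def norm_mult power_mult_distrib sgn_if)

lemma two_root_param_sq:
  assumes "n \<noteq> 0"
  shows "2 * (root_param i n w)\<^sup>2 = (sector_unit i n)\<^sup>2 * w"
  by (simp add: root_param_def power_mult_distrib)

lemma D_disc_iff:
  assumes "n \<noteq> 0"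
  shows "z \<in> D_disc i n \<longleftrightarrow>
    norm ((sector_unit i n)\<^sup>2 * (2 * z\<^sup>2) - of_int \<bar>n\<bar> * of_real pi) < pi / 4 \<and> 0 < Re (z / sector_unit i n)"
proof -
  define c where "c = (of_int n * of_real pi :: complex)"
  have m: "norm (- (2 * z\<^sup>2) - c) = norm (2 * z\<^sup>2 + c)" "norm (c - 2 * z\<^sup>2) = norm (2 * z\<^sup>2 - c)"
    using norm_minus_cancel[of "2 * z\<^sup>2 + c"] norm_minus_commute[of c "2 * z\<^sup>2"] by (simp_all del: norm_minus_cancel)
  consider "i = 1" "n > 0" | "i = 1" "n < 0" | "i \<noteq> 1" "n > 0" | "i \<noteq> 1" "n < 0" using assms by linarith
  then show ?thesis
    by cases (auto simp: D_disc_def U_set_def sector_unit_def m Re_divide simp flip: c_def)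
qed

lemma D_disc_index:
  assumes "n \<noteq> 0" "z \<in> D_disc i n"
  shows "norm (2 * z\<^sup>2 - of_int (disc_index i n) * of_real pi) < pi / 4"
  using assms by (auto simp: D_disc_def U_set_def disc_index_def split: if_splits)

lemma D_disc_0_index: "z \<in> D_disc i 0 \<longleftrightarrow> norm (2 * z\<^sup>2) < pi / 4"
proof -
  have "norm (2 * z\<^sup>2) < pi / 4 \<longleftrightarrow> (norm z)\<^sup>2 < (sqrt (pi / 8))\<^sup>2"
    by (simp add: norm_mult norm_power mult.commute)
  also have "\<dots> \<longleftrightarrow> norm z < sqrt (pi / 8)"
  proof
    assume "norm z < sqrt (pi / 8)"
    then show "(norm z)\<^sup>2 < (sqrt (pi / 8))\<^sup>2" by (rule power_strict_mono) auto
  qed (rule power2_less_imp_less, auto)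
  finally show ?thesis by (simp add: D_disc_def)
qed

text \<open>Distinct multiples of pi are at least pi apart. One of the two inequalities is not
  strict because points on boundary circles have to be treated as well.\<close>

lemma near_multiple_of_pi_unique:
  fixes w :: complex and k m :: int
  assumes "norm (w - of_int k * of_real pi) < r" "norm (w - of_int m * of_real pi) \<le> r'" "r + r' \<le> pi"
  shows "k = m"
proof (rule ccontr)
  assume "k \<noteq> m"
  then have "1 \<le> \<bar>real_of_int (k - m)\<bar>" by linarith
  then have "pi * 1 \<le> pi * \<bar>real_of_int (k - m)\<bar>" by (intro mult_left_mono) auto
  also have "\<dots> = norm (of_int (k - m) * of_real pi :: complex)"
    by (simp only: norm_mult norm_of_int norm_of_real) (simp add: mult.commute)
  also have "of_int (k - m) * of_real pi = (w - of_int m * of_real pi) - (w - of_int k * of_real pi :: complex)"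
    by (simp add: algebra_simps)
  also have "norm \<dots> \<le> norm (w - of_int m * of_real pi) + norm (w - of_int k * of_real pi)"
    by (rule norm_triangle_ineq4)
  finally show False using assms by simp
qed

text \<open>The multiple of pi near 2 z^2 determines |n| and, unless it is 0, the upper index; the
  sign of n is read off from the half plane. For n = 0 both upper indices name the same
  disc.\<close>

lemma D_disc_disjoint:
  assumes "i \<in> {1, 2}" "j \<in> {1, 2}" "z \<in> D_disc i n" "z \<in> D_disc j m"
  shows "n = m \<and> (n \<noteq> 0 \<longrightarrow> i = j)"
proof -
  have idx: "norm (2 * z\<^sup>2 - of_int (disc_index i n) * of_real pi) < pi / 4" if "z \<in> D_disc i n" for i n
    using D_disc_index[OF _ that] D_disc_0_index[of z i] that by (cases "n = 0") (auto simp: disc_index_def)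
  have eq: "disc_index i n = disc_index j m"
    by (rule near_multiple_of_pi_unique[OF idx[OF assms(3)] less_imp_le[OF idx[OF assms(4)]]]) simp
  show ?thesis
  proof (cases "n = 0")
    case True
    then show ?thesis using eq by (auto simp: disc_index_def split: if_splits)
  next
    case False
    then have m: "m \<noteq> 0" using eq by (auto simp: disc_index_def split: if_splits)
    have ij: "i = j" and nm: "\<bar>n\<bar> = \<bar>m\<bar>" using eq False m assms(1,2) by (auto simp: disc_index_def split: if_splits)
    have "n = m"
    proof (rule ccontr)
      assume "n \<noteq> m"
      then have "m = - n" using nm by linarith
      then have "sector_unit j m = - sector_unit i n" using ij by (simp add: sector_unit_def)
      then have "Re (z / sector_unit j m) = - Re (z / sector_unit i n)" by simp
      then show False using assms(3,4) D_disc_iff[OF False, of z i] D_disc_iff[OF m, of z j] by simp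
    qed
    then show ?thesis using ij by simp
  qed
qed

lemma Re_near_multiple_of_pi:
  assumes "n \<noteq> 0" "norm (w - of_int \<bar>n\<bar> * of_real pi) < r" "r \<le> pi"
  shows "0 < Re w"
proof -
  have "real_of_int 1 \<le> of_int \<bar>n\<bar>" using assms(1) by (intro of_int_le_iff[THEN iffD2]) simp
  then have "pi * 1 \<le> pi * of_int \<bar>n\<bar>" by (intro mult_left_mono) auto
  moreover have "\<bar>Re (w - of_int \<bar>n\<bar> * of_real pi)\<bar> < r" using assms(2) abs_Re_le_cmod order.strict_trans1 by blast
  moreover have "Re (w - of_int \<bar>n\<bar> * of_real pi) = Re w - pi * of_int \<bar>n\<bar>" by simp
  ultimately show ?thesis using assms(3) by linarith
qed

lemma Re_csqrt_pos: "0 < Re w \<Longrightarrow> 0 < Re (csqrt w)"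
  by (simp add: add_nonneg_pos)

lemma root_param_in_D_disc:
  assumes "n \<noteq> 0" "norm (w - of_int \<bar>n\<bar> * of_real pi) < pi / 4"
  shows "root_param i n w \<in> D_disc i n"
proof -
  have "(sector_unit i n)\<^sup>2 * (2 * (root_param i n w)\<^sup>2) = w"
    using sector_unit_simps(3)[OF assms(1)] by (simp add: two_root_param_sq[OF assms(1)])
  moreover have "root_param i n w / sector_unit i n = csqrt (w / 2)"
    using sector_unit_simps(1)[OF assms(1)] by (simp add: root_param_def)
  moreover have "0 < Re (csqrt (w / 2))"
    using Re_near_multiple_of_pi[OF assms] by (intro Re_csqrt_pos) simp
  ultimately show ?thesis using assms by (simp add: D_disc_iff del: csqrt.sel)
qed

lemma D_disc_root_param:
  assumes "n \<noteq> 0" "z \<in> D_disc i n"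
  shows "z = root_param i n ((sector_unit i n)\<^sup>2 * (2 * z\<^sup>2))"
proof -
  let ?s = "sector_unit i n"
  have "0 < Re (z / ?s)" using assms by (simp add: D_disc_iff)
  then have "csqrt ((z / ?s)\<^sup>2) = z / ?s" by (intro csqrt_square) simp
  moreover have "(z / ?s)\<^sup>2 = ?s\<^sup>2 * (2 * z\<^sup>2) / 2"
    using sector_unit_simps(3)[OF assms(1), of i] by (simp add: power_divide)
  ultimately show ?thesis using sector_unit_simps(1)[OF assms(1), of i] by (simp add: root_param_def)
qed

lemma holomorphic_on_root_param:
  assumes "\<And>w. w \<in> S \<Longrightarrow> 0 < Re w"
  shows "root_param i n holomorphic_on S"
  unfolding root_param_def[abs_def] using assms
  by (intro holomorphic_intros) (auto simp: complex_nonpos_Reals_iff not_le)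

lemma sum_eq_1_singleton:
  fixes f :: "'a \<Rightarrow> int"
  assumes "finite S" "\<And>x. x \<in> S \<Longrightarrow> 1 \<le> f x" "sum f S = 1"
  obtains x where "S = {x}" "f x = 1"
proof -
  have "of_nat (card S) * 1 \<le> sum f S" by (rule sum_bounded_below[OF assms(2)])
  moreover have "S \<noteq> {}" using assms(3) by auto
  ultimately have "card S = 1" using assms(1,3) card_gt_0_iff[of S] by simp
  then obtain x where "S = {x}" by (rule card_1_singletonE)
  then show ?thesis using that assms(3) by simp
qed

text \<open>Half discs are not round, so Rouche's theorem is applied in the variable w, on the
  circle of radius pi/4 about |n| pi. There \<open>root_param\<close> is holomorphic up to radius
  pi/2, and the comparison function has a single zero, simple and at the center.\<close>

lemma D_disc_unique_zero:
  assumes n: "n \<noteq> 0"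
    and close: "\<And>z. norm ((sector_unit i n)\<^sup>2 * (2 * z\<^sup>2) - of_int \<bar>n\<bar> * of_real pi) = pi / 4 \<Longrightarrow>
      norm (chi_N z \<psi> - sin (2 * z\<^sup>2)) < exp \<bar>Im (2 * z\<^sup>2)\<bar> / 8"
  shows "(\<exists>!z. z \<in> D_disc i n \<inter> neumann_spectrum \<psi>) \<and>
    (\<forall>z \<in> D_disc i n \<inter> neumann_spectrum \<psi>. neumann_mult \<psi> z = 1)"
proof -
  let ?s = "sector_unit i n"
  let ?\<rho> = "root_param i n"
  define a where "a = (of_int \<bar>n\<bar> * of_real pi :: complex)"
  have ss: "?s\<^sup>2 * ?s\<^sup>2 = 1" using sector_unit_simps(3)[OF n, of i] by simp
  have ns: "norm (?s\<^sup>2) = 1" using sector_unit_simps(2)[OF n, of i] by (simp add: norm_power)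
  have s0: "?s\<^sup>2 \<noteq> 0" using ss by auto
  \<comment> \<open>Multiplication by the square of the unit, which is 1 or -1, permutes the
    multiples of pi, so distances to them can be computed for w itself.\<close>
  have idx: "norm (?s\<^sup>2 * w - of_int m * of_real pi) = norm (w - of_int (if i = 1 then m else - m) * of_real pi)" for w m
  proof -
    have "?s\<^sup>2 * w - of_int m * of_real pi = ?s\<^sup>2 * (w - of_int (if i = 1 then m else - m) * of_real pi)"
      using sector_unit_simps(3)[OF n, of i] by (simp add: algebra_simps)
    then show ?thesis by (simp only: norm_mult ns mult_1)
  qed
  define F where "F w = chi_N (?\<rho> w) \<psi>" for w
  define f where "f w = sin (?s\<^sup>2 * w)" for w
  have pos: "0 < Re w" if "w \<in> ball a (pi / 2)" for w
    using that by (intro Re_near_multiple_of_pi[OF n, of _ "pi/2"]) (auto simp: a_def dist_norm norm_minus_commute)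
  have hr: "?\<rho> holomorphic_on ball a (pi / 2)" by (rule holomorphic_on_root_param[OF pos])
  have hF: "F holomorphic_on ball a (pi / 2)"
    using holomorphic_on_compose[OF hr holomorphic_on_chi_N[of \<psi>]] by (simp add: F_def[abs_def] o_def)
  have hf: "f holomorphic_on ball a (pi / 2)" unfolding f_def by (intro holomorphic_intros)
  have big: "norm (F w - f w) < norm (f w)" if w: "norm (w - a) = pi / 4" for w
  proof -
    have sq: "2 * (?\<rho> w)\<^sup>2 = ?s\<^sup>2 * w" by (rule two_root_param_sq[OF n])
    have "norm (F w - f w) < exp \<bar>Im (?s\<^sup>2 * w)\<bar> / 8"
      using close[of "?\<rho> w"] w unfolding sq F_def f_def a_def by (simp only: mult.assoc[symmetric] ss mult_1)
    also have "\<dots> \<le> norm (f w)"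
      unfolding f_def
    proof (rule norm_sin_ge_exp, rule ccontr)
      fix m :: int
      let ?m = "if i = 1 then m else - m"
      assume "\<not> pi / 4 \<le> norm (?s\<^sup>2 * w - of_int m * of_real pi)"
      then have m: "norm (w - of_int ?m * of_real pi) < pi / 4" unfolding idx by simp
      have "?m = \<bar>n\<bar>"
        by (rule near_multiple_of_pi_unique[OF m, of _ "pi/4"]) (use w in \<open>auto simp: a_def\<close>)
      then show False using m w by (simp add: a_def)
    qed
    finally show ?thesis .
  qed
  have p4: "0 < pi / 4" "pi / 4 < pi / 2" by simp_all
  note rouche = rouche_ball[OF hf hF p4 big]
  have fa: "f a = 0"
  proof -
    have "?s\<^sup>2 * a = of_int (disc_index i n) * of_real pi"
      using sector_unit_simps(4)[OF n, of i] by (simp add: a_def)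
    then show ?thesis unfolding f_def by (simp add: sin_eq_0)
  qed
  have fz: "{z \<in> ball a (pi / 4). f z = 0} = {a}"
  proof
    show "{z \<in> ball a (pi / 4). f z = 0} \<subseteq> {a}"
    proof
      fix w assume w: "w \<in> {z \<in> ball a (pi / 4). f z = 0}"
      then obtain m :: int where "?s\<^sup>2 * w = of_real (m * pi)" unfolding f_def by (auto simp: sin_eq_0)
      then have "norm (?s\<^sup>2 * w - of_int m * of_real pi) = 0" by simp
      then have m: "norm (w - of_int (if i = 1 then m else - m) * of_real pi) = 0" unfolding idx .
      have "\<bar>n\<bar> = (if i = 1 then m else - m)"
        by (rule near_multiple_of_pi_unique[of w _ "pi/4" _ 0])
          (use w m in \<open>auto simp: a_def dist_norm norm_minus_commute\<close>)
      then show "w \<in> {a}" using m by (simp add: a_def)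
    qed
  qed (use fa in auto)
  have "zorder f a = 1"
  proof (rule zorder_zero_eqI[OF hf])
    have "(f has_field_derivative ?s\<^sup>2 * cos (?s\<^sup>2 * a)) (at a)"
      unfolding f_def by (auto intro!: derivative_eq_intros)
    then have "deriv f a = ?s\<^sup>2 * cos (?s\<^sup>2 * a)" by (rule DERIV_imp_deriv)
    moreover have "cos (?s\<^sup>2 * a) \<noteq> 0" using fa sin_cos_squared_add[of "?s\<^sup>2 * a"] by (auto simp: f_def)
    ultimately show "(deriv ^^ nat 1) f a \<noteq> 0" using s0 by simp
  qed (use fa in auto)
  then have sumF: "(\<Sum>z | z \<in> ball a (pi / 4) \<and> F z = 0. zorder F z) = 1"
    using rouche(3) fz by simp
  define w1 where "w1 = a + of_real (pi / 4)"
  have w1: "w1 \<in> ball a (pi / 2)" and Fw1: "F w1 \<noteq> 0"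
    using big[of w1] by (auto simp: w1_def dist_norm)
  have po: "1 \<le> zorder F w" if "w \<in> ball a (pi / 4)" "F w = 0" for w
  proof -
    have "w \<in> ball a (pi / 2)" using that(1) subset_ball[of "pi / 4" "pi / 2" a] by auto
    then show ?thesis using zorder_pos_of_zero[OF hF _ _ _ w1 Fw1, of w] that(2) by simp
  qed
  obtain w0 where w0: "{z. z \<in> ball a (pi / 4) \<and> F z = 0} = {w0}" "zorder F w0 = 1"
    by (rule sum_eq_1_singleton[OF _ _ sumF]) (use rouche(2) po in auto)
  have "w0 \<in> {z. z \<in> ball a (pi / 4) \<and> F z = 0}" unfolding w0(1) by simp
  then have w0b: "w0 \<in> ball a (pi / 2)" "w0 \<in> ball a (pi / 4)" "F w0 = 0"
    using subset_ball[of "pi / 4" "pi / 2" a] by auto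
  define z0 where "z0 = ?\<rho> w0"
  have z0D: "z0 \<in> D_disc i n"
    unfolding z0_def using w0b by (intro root_param_in_D_disc[OF n]) (auto simp: a_def dist_norm norm_minus_commute)
  have z0s: "z0 \<in> neumann_spectrum \<psi>" using w0b by (simp add: neumann_spectrum_def F_def z0_def)
  have uniq: "z = z0" if "z \<in> D_disc i n \<inter> neumann_spectrum \<psi>" for z
  proof -
    define w where "w = ?s\<^sup>2 * (2 * z\<^sup>2)"
    have z: "z = ?\<rho> w" unfolding w_def using that by (intro D_disc_root_param[OF n]) auto
    have "norm (w - a) < pi / 4" using that D_disc_iff[OF n, of z i] by (simp add: w_def a_def)
    moreover have "F w = 0" using that z by (simp add: F_def neumann_spectrum_def)
    ultimately have "w \<in> {z. z \<in> ball a (pi / 4) \<and> F z = 0}" by (simp add: dist_norm norm_minus_commute)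
    then have "w = w0" unfolding w0(1) by simp
    then show ?thesis using z by (simp add: z0_def)
  qed
  have dF: "deriv F w0 \<noteq> 0"
    using zorder_eq_1_iff_deriv[OF hF _ _ w0b(1) w1 Fw1 w0b(3)] w0(2) by simp
  \<comment> \<open>Simplicity is carried back from w to z by the chain rule: if the derivative of
    \<open>chi_N\<close> vanished at z0, that of F would vanish at w0.\<close>
  have "deriv (\<lambda>w. chi_N w \<psi>) z0 \<noteq> 0"
  proof
    assume 0: "deriv (\<lambda>w. chi_N w \<psi>) z0 = 0"
    have "((\<lambda>w. chi_N w \<psi>) has_field_derivative 0) (at (?\<rho> w0))"
      using holomorphic_derivI[OF holomorphic_on_chi_N[of \<psi> UNIV], of z0] 0 by (simp add: z0_def)
    from DERIV_chain2[OF this holomorphic_derivI[OF hr _ w0b(1)]]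
    have "(F has_field_derivative 0) (at w0)" by (simp add: F_def[abs_def])
    then show False using dF DERIV_imp_deriv by blast
  qed
  then have "zorder (\<lambda>w. chi_N w \<psi>) z0 = 1"
    using zorder_eq_1_iff_deriv[OF holomorphic_on_chi_N[of \<psi> UNIV], of z0 "?\<rho> w1"] Fw1 z0s connected_UNIV
    by (simp add: F_def neumann_spectrum_def)
  then have "neumann_mult \<psi> z0 = 1" using z0s by (simp add: neumann_mult_def)
  then show ?thesis using z0D z0s uniq by blast
qed

section \<open>The large discs and the zeros in the free case\<close>

lemma B_disc_iff: "z \<in> B_disc N \<longleftrightarrow> norm (2 * z\<^sup>2) < (real N + 1 / 4) * pi"
proof -
  have "norm (2 * z\<^sup>2) < (real N + 1 / 4) * pi \<longleftrightarrow> (norm z)\<^sup>2 < (real N + 1 / 4) * pi / 2"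
    by (simp add: norm_mult norm_power mult.commute)
  also have "\<dots> \<longleftrightarrow> norm z < sqrt ((real N + 1 / 4) * pi / 2)"
    using real_less_rsqrt[of "norm z"] real_sqrt_less_iff[of "(norm z)\<^sup>2" "(real N + 1 / 4) * pi / 2"] by auto
  finally show ?thesis by (simp add: B_disc_def)
qed

lemma B_disc_ball: "B_disc N = ball 0 (sqrt ((real N + 1 / 4) * pi / 2))"
  by (auto simp: B_disc_def)

lemma B_disc_mono: "N \<le> M \<Longrightarrow> B_disc N \<subseteq> B_disc M"
  unfolding B_disc_ball by (intro subset_ball) (auto intro!: divide_right_mono mult_right_mono)

lemma D_disc_1_0: "D_disc 1 0 = B_disc 0" "D_disc 2 0 = B_disc 0"
  by (auto simp: D_disc_0_index B_disc_iff)

lemma D_disc_bounds: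
  fixes z :: complex
  assumes "n \<noteq> 0" "norm (2 * z\<^sup>2 - of_int (disc_index i n) * of_real pi) \<le> pi / 4"
  shows "(of_int \<bar>n\<bar> - 1 / 4) * pi \<le> norm (2 * z\<^sup>2)" "norm (2 * z\<^sup>2) \<le> (of_int \<bar>n\<bar> + 1 / 4) * pi"
    "of_int \<bar>n\<bar> \<le> (norm z)\<^sup>2"
proof -
  have e: "norm (of_int (disc_index i n) * of_real pi :: complex) = of_int \<bar>n\<bar> * pi"
    by (simp add: norm_mult disc_index_def)
  show 1: "(of_int \<bar>n\<bar> - 1 / 4) * pi \<le> norm (2 * z\<^sup>2)"
    using assms(2) norm_triangle_ineq2[of "of_int (disc_index i n) * of_real pi" "2 * z\<^sup>2"] e
    by (simp add: norm_minus_commute left_diff_distrib)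
  show "norm (2 * z\<^sup>2) \<le> (of_int \<bar>n\<bar> + 1 / 4) * pi"
    using assms(2) norm_triangle_ineq2[of "2 * z\<^sup>2" "of_int (disc_index i n) * of_real pi"] e
    by (simp add: distrib_right)
  have "(1::real) \<le> of_int \<bar>n\<bar>" using assms(1) by linarith
  then have "of_int \<bar>n\<bar> * (3 / 4) * pi \<le> (of_int \<bar>n\<bar> - 1 / 4) * pi" by (intro mult_right_mono) auto
  moreover have "of_int \<bar>n\<bar> * (3 / 4) * 3 \<le> of_int \<bar>n\<bar> * (3 / 4) * pi"
    using pi_gt3 by (intro mult_left_mono) auto
  moreover have "norm (2 * z\<^sup>2) = 2 * (norm z)\<^sup>2" by (simp add: norm_mult norm_power)
  ultimately have "of_int \<bar>n\<bar> * 2 \<le> 2 * (norm z)\<^sup>2" using 1 by linarith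
  then show "of_int \<bar>n\<bar> \<le> (norm z)\<^sup>2" by simp
qed

lemma D_disc_subset_B_disc:
  assumes "\<bar>n\<bar> \<le> int N" "z \<in> D_disc i n"
  shows "z \<in> B_disc N"
proof (cases "n = 0")
  case True
  then have "norm (2 * z\<^sup>2) < pi / 4" using assms(2) D_disc_0_index by blast
  also have "\<dots> \<le> (real N + 1 / 4) * pi" by (simp add: distrib_right)
  finally show ?thesis by (simp add: B_disc_iff)
next
  case False
  have e: "norm (of_int (disc_index i n) * of_real pi :: complex) = of_int \<bar>n\<bar> * pi"
    by (simp add: norm_mult disc_index_def)
  have "norm (2 * z\<^sup>2) < of_int \<bar>n\<bar> * pi + pi / 4"
    using norm_triangle_ineq2[of "2 * z\<^sup>2" "of_int (disc_index i n) * of_real pi"] D_disc_index[OF False assms(2)] e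
    by linarith
  also have "\<dots> \<le> real N * pi + pi / 4"
  proof -
    have "real_of_int \<bar>n\<bar> \<le> real N" using assms(1) by linarith
    then show ?thesis by (intro add_right_mono mult_right_mono) auto
  qed
  finally show ?thesis by (simp add: B_disc_iff distrib_right)
qed

text \<open>The real part of 2 z^2 has the sign of m. Hence Re z for positive m, and Im z for
  negative m, cannot vanish, and its sign selects one of the two halves.\<close>

lemma near_multiple_imp_D_disc:
  assumes "m \<noteq> 0" "norm (2 * z\<^sup>2 - of_int m * of_real pi) < pi / 4"
  shows "\<exists>i\<in>{1, 2}. \<exists>n. \<bar>n\<bar> = \<bar>m\<bar> \<and> z \<in> D_disc i n"
proof -
  have re: "Re (z\<^sup>2) = (Re z)\<^sup>2 - (Im z)\<^sup>2" by (simp add: power2_eq_square)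
  have r: "\<bar>Re (2 * z\<^sup>2) - of_int m * pi\<bar> < pi / 4"
    using order.strict_trans1[OF abs_Re_le_cmod assms(2)] by simp
  consider "m > 0" | "m < 0" using assms(1) by linarith
  then show ?thesis
  proof cases
    case 1
    then have "(1::real) \<le> of_int m" by linarith
    then have "1 * pi \<le> of_int m * pi" by (intro mult_right_mono) auto
    then have "0 < Re (2 * z\<^sup>2)" using r pi_gt_zero by linarith
    then have "Re z \<noteq> 0" using re by auto
    then have "z \<in> D_disc 1 m \<or> z \<in> D_disc 1 (- m)"
      using 1 assms(2) by (auto simp: D_disc_def U_set_def)
    then show ?thesis by (metis abs_minus_cancel insertI1)
  next
    case 2
    then have "(1::real) \<le> - of_int m" by linarith
    then have "1 * pi \<le> - of_int m * pi" by (intro mult_right_mono) auto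
    then have "Re (2 * z\<^sup>2) < 0" using r pi_gt_zero by linarith
    then have "Im z \<noteq> 0" using re by auto
    then have "z \<in> D_disc 2 m \<or> z \<in> D_disc 2 (- m)"
      using 2 assms(2) by (auto simp: D_disc_def U_set_def)
    then show ?thesis by (metis abs_minus_cancel insertI1 insertI2)
  qed
qed

lemma free_zero:
  assumes "n \<noteq> 0"
  shows "sin (2 * (root_param i n (of_int \<bar>n\<bar> * of_real pi))\<^sup>2) = 0"
    and "norm (2 * (root_param i n (of_int \<bar>n\<bar> * of_real pi))\<^sup>2) = of_int \<bar>n\<bar> * pi"
    and "root_param i n (of_int \<bar>n\<bar> * of_real pi) \<in> D_disc i n"
    and "root_param i n (of_int \<bar>n\<bar> * of_real pi) \<noteq> 0"
proof -
  have e: "2 * (root_param i n (of_int \<bar>n\<bar> * of_real pi))\<^sup>2 = of_real (of_int (disc_index i n) * pi)"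
    unfolding two_root_param_sq[OF assms] mult.assoc[symmetric] sector_unit_simps(4)[OF assms, symmetric]
    by simp
  show "sin (2 * (root_param i n (of_int \<bar>n\<bar> * of_real pi))\<^sup>2) = 0"
    unfolding e sin_eq_0 by blast
  show n: "norm (2 * (root_param i n (of_int \<bar>n\<bar> * of_real pi))\<^sup>2) = of_int \<bar>n\<bar> * pi"
    unfolding e norm_of_real by (simp add: abs_mult disc_index_def)
  show "root_param i n (of_int \<bar>n\<bar> * of_real pi) \<in> D_disc i n"
    using assms by (intro root_param_in_D_disc) auto
  show "root_param i n (of_int \<bar>n\<bar> * of_real pi) \<noteq> 0" using n assms by auto
qed

lemma deriv_sin_two_sq: "deriv (\<lambda>z::complex. sin (2 * z\<^sup>2)) = (\<lambda>z. 4 * z * cos (2 * z\<^sup>2))"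
proof
  fix z :: complex
  show "deriv (\<lambda>z. sin (2 * z\<^sup>2)) z = 4 * z * cos (2 * z\<^sup>2)"
    by (rule DERIV_imp_deriv) (auto intro!: derivative_eq_intros simp: power2_eq_square)
qed

text \<open>There are 4N simple zeros, one for each upper index and each n with 0 < |n| \<le> N, and
  the zero at the origin, which is double because sin(2 z^2) behaves like 2 z^2. Disjointness of the
  discs shows that the indexing does not repeat a zero.\<close>

lemma free_zero_count:
  "(\<Sum>z | z \<in> B_disc N \<and> sin (2 * z\<^sup>2) = 0. zorder (\<lambda>z. sin (2 * z\<^sup>2)) z) = 2 * (2 * int N + 1)"
proof -
  define I where "I = {n::int. n \<noteq> 0 \<and> \<bar>n\<bar> \<le> int N}"
  define \<nu> where "\<nu> = (\<lambda>(i, n). root_param i n (of_int \<bar>n\<bar> * of_real pi))"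
  define Z where "Z = \<nu> ` ({1, 2} \<times> I)"
  have I: "I = {- int N..int N} - {0}" by (auto simp: I_def)
  have fI: "finite I" "card I = 2 * N" unfolding I by simp_all
  have inj: "inj_on \<nu> ({1, 2} \<times> I)"
  proof (rule inj_onI, clarify)
    fix i n j m assume "i \<in> {1::nat, 2}" "n \<in> I" "j \<in> {1::nat, 2}" "m \<in> I" "\<nu> (i, n) = \<nu> (j, m)"
    then show "i = j \<and> n = m"
      using D_disc_disjoint[of i j "\<nu> (i, n)" n m] free_zero(3)[of n i] free_zero(3)[of m j]
      by (auto simp: \<nu>_def I_def)
  qed
  have cardZ: "finite Z" "card Z = 4 * N"
    unfolding Z_def card_image[OF inj] using fI by (auto simp: card_cartesian_product)
  have Z0: "0 \<notin> Z" using free_zero(4) by (fastforce simp: Z_def \<nu>_def I_def)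
  have set: "{z. z \<in> B_disc N \<and> sin (2 * z\<^sup>2) = 0} = insert 0 Z"
  proof (rule set_eqI, rule iffI)
    fix z assume "z \<in> {z. z \<in> B_disc N \<and> sin (2 * z\<^sup>2) = 0}"
    then have z: "norm (2 * z\<^sup>2) < (real N + 1 / 4) * pi" "sin (2 * z\<^sup>2) = 0" by (auto simp: B_disc_iff)
    then obtain m :: int where m: "2 * z\<^sup>2 = of_real (m * pi)" by (auto simp: sin_eq_0)
    show "z \<in> insert 0 Z"
    proof (cases "m = 0")
      case True
      then show ?thesis using m by simp
    next
      case False
      have mz: "norm (2 * z\<^sup>2 - of_int m * of_real pi) < pi / 4" using m by simp
      obtain i n where i: "i \<in> {1, 2}" and n: "\<bar>n\<bar> = \<bar>m\<bar>" "z \<in> D_disc i n"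
        using near_multiple_imp_D_disc[OF False mz] by blast
      have n0: "n \<noteq> 0" using n(1) False by auto
      have "\<bar>real_of_int m\<bar> * pi < (real N + 1 / 4) * pi"
        using z(1) unfolding m norm_of_real by (simp add: abs_mult)
      then have "\<bar>real_of_int m\<bar> < real N + 1 / 4" by simp
      then have "\<bar>m\<bar> \<le> int N" by linarith
      then have nI: "n \<in> I" using n0 n(1) by (simp add: I_def)
      have "disc_index i n = m"
        by (rule near_multiple_of_pi_unique[OF D_disc_index[OF n0 n(2)] less_imp_le[OF mz]]) simp
      then have "(sector_unit i n)\<^sup>2 * (2 * z\<^sup>2) = (sector_unit i n)\<^sup>2 * (sector_unit i n)\<^sup>2 * of_int \<bar>n\<bar> * of_real pi"
        using sector_unit_simps(4)[OF n0, of i] m by (simp add: mult.assoc)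
      also have "\<dots> = of_int \<bar>n\<bar> * of_real pi" using sector_unit_simps(3)[OF n0, of i] by simp
      finally have "z = \<nu> (i, n)" using D_disc_root_param[OF n0 n(2)] by (simp add: \<nu>_def)
      then show ?thesis using i nI by (auto simp: Z_def)
    qed
  next
    fix z assume "z \<in> insert 0 Z"
    then consider "z = 0" | i n where "n \<in> I" "z = root_param i n (of_int \<bar>n\<bar> * of_real pi)"
      by (auto simp: Z_def \<nu>_def)
    then show "z \<in> {z. z \<in> B_disc N \<and> sin (2 * z\<^sup>2) = 0}"
    proof cases
      case 1
      then show ?thesis by (simp add: B_disc_iff)
    next
      case 2
      then have n: "n \<noteq> 0" "\<bar>n\<bar> \<le> int N" by (auto simp: I_def)
      show ?thesis using free_zero(1,3)[OF n(1), of i] D_disc_subset_B_disc[OF n(2)] 2(2) by auto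
    qed
  qed
  have holo: "(\<lambda>z::complex. sin (2 * z\<^sup>2)) holomorphic_on UNIV" by (intro holomorphic_intros)
  have "zorder (\<lambda>z. sin (2 * z\<^sup>2)) z = 1" if "z \<in> Z" for z
  proof (rule zorder_zero_eqI[OF holo])
    have z: "sin (2 * z\<^sup>2) = 0" "z \<noteq> 0" using set that Z0 by auto
    then show "(deriv ^^ nat 1) (\<lambda>z. sin (2 * z\<^sup>2)) z \<noteq> 0"
      using sin_cos_squared_add[of "2 * z\<^sup>2"] by (auto simp: deriv_sin_two_sq)
    show "(deriv ^^ j) (\<lambda>z. sin (2 * z\<^sup>2)) z = 0" if "j < nat 1" for j using that z by simp
  qed auto
  moreover have "zorder (\<lambda>z::complex. sin (2 * z\<^sup>2)) 0 = 2"
  proof (rule zorder_zero_eqI[OF holo])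
    have "((\<lambda>z::complex. 4 * z * cos (2 * z\<^sup>2)) has_field_derivative 4) (at 0)"
      by (auto intro!: derivative_eq_intros)
    then have "deriv (\<lambda>z::complex. 4 * z * cos (2 * z\<^sup>2)) 0 = 4" by (rule DERIV_imp_deriv)
    moreover have "nat 2 = Suc (Suc 0)" by simp
    ultimately show "(deriv ^^ nat 2) (\<lambda>z::complex. sin (2 * z\<^sup>2)) 0 \<noteq> 0"
      by (simp only: funpow.simps o_def id_def deriv_sin_two_sq) simp
    show "(deriv ^^ j) (\<lambda>z::complex. sin (2 * z\<^sup>2)) 0 = 0" if "j < nat 2" for j
    proof -
      have "j = 0 \<or> j = 1" using that by auto
      then show ?thesis by (auto simp: deriv_sin_two_sq)
    qed
  qed auto
  ultimately show ?thesis unfolding set using cardZ Z0 by simp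
qed

text \<open>One pointwise bound outside \<open>B_disc N\<close> serves three purposes. On the
  contours of the discs with |n| > N it isolates one simple eigenvalue each; away from the multiples
  of pi it excludes further eigenvalues; on the boundary of \<open>B_disc N\<close> it transfers the
  free count.\<close>

lemma counting_propertyI:
  assumes close: "\<And>z. z \<notin> B_disc N \<Longrightarrow> norm (chi_N z \<psi> - sin (2 * z\<^sup>2)) < exp \<bar>Im (2 * z\<^sup>2)\<bar> / 8"
  shows "counting_property \<psi> N"
proof -
  have D: "(\<exists>!z. z \<in> D_disc i n \<inter> neumann_spectrum \<psi>) \<and>
      (\<forall>z \<in> D_disc i n \<inter> neumann_spectrum \<psi>. neumann_mult \<psi> z = 1)" if n: "\<bar>n\<bar> > int N" for i n
  proof (rule D_disc_unique_zero)
    show n0: "n \<noteq> 0" using n by auto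
    fix z assume z: "norm ((sector_unit i n)\<^sup>2 * (2 * z\<^sup>2) - of_int \<bar>n\<bar> * of_real pi) = pi / 4"
    have "real N + 1 \<le> of_int \<bar>n\<bar>" using n by linarith
    then have "(real N + 1) * pi \<le> of_int \<bar>n\<bar> * pi" by (intro mult_right_mono) auto
    moreover have "of_int \<bar>n\<bar> * pi - norm ((sector_unit i n)\<^sup>2 * (2 * z\<^sup>2)) \<le> pi / 4"
      using norm_triangle_ineq2[of "of_int \<bar>n\<bar> * of_real pi" "(sector_unit i n)\<^sup>2 * (2 * z\<^sup>2)"] z
      by (simp add: norm_minus_commute norm_mult)
    moreover have "norm ((sector_unit i n)\<^sup>2 * (2 * z\<^sup>2)) = norm (2 * z\<^sup>2)"
      using sector_unit_simps(2)[OF n0, of i] by (simp add: norm_mult norm_power)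
    ultimately have "(real N + 1) * pi - pi / 4 \<le> norm (2 * z\<^sup>2)" by linarith
    moreover have "(real N + 1 / 4) * pi \<le> (real N + 1) * pi - pi / 4" by (simp add: distrib_right)
    ultimately have "(real N + 1 / 4) * pi \<le> norm (2 * z\<^sup>2)" by linarith
    then show "norm (chi_N z \<psi> - sin (2 * z\<^sup>2)) < exp \<bar>Im (2 * z\<^sup>2)\<bar> / 8"
      by (intro close) (simp add: B_disc_iff)
  qed
  have rest: "z \<in> B_disc N"
    if z: "z \<in> neumann_spectrum \<psi>" "\<And>i n. i \<in> {1, 2} \<Longrightarrow> \<bar>n\<bar> > int N \<Longrightarrow> z \<notin> D_disc i n" for z
  proof (rule ccontr)
    assume zB: "z \<notin> B_disc N"
    have "norm (sin (2 * z\<^sup>2)) < exp \<bar>Im (2 * z\<^sup>2)\<bar> / 8"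
      using close[OF zB] z(1) by (simp add: neumann_spectrum_def)
    then obtain m :: int where m: "norm (2 * z\<^sup>2 - of_int m * of_real pi) < pi / 4"
      using norm_sin_ge_exp[of "2 * z\<^sup>2"] not_le by blast
    have "\<bar>m\<bar> > int N"
    proof (rule ccontr)
      assume "\<not> \<bar>m\<bar> > int N"
      then have "real_of_int \<bar>m\<bar> \<le> real N" by linarith
      then have "real_of_int \<bar>m\<bar> * pi \<le> real N * pi" by (intro mult_right_mono) auto
      moreover have "norm (of_int m * of_real pi :: complex) = real_of_int \<bar>m\<bar> * pi"
        by (simp add: norm_mult)
      ultimately have "norm (2 * z\<^sup>2) < real N * pi + pi / 4"
        using norm_triangle_ineq2[of "2 * z\<^sup>2" "of_int m * of_real pi"] m by linarith
      then have "norm (2 * z\<^sup>2) < (real N + 1 / 4) * pi" by (simp add: distrib_right)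
      then show False using zB by (simp add: B_disc_iff)
    qed
    then obtain i n where "i \<in> {1, 2}" "\<bar>n\<bar> = \<bar>m\<bar>" "z \<in> D_disc i n"
      using near_multiple_imp_D_disc[of m z] m by force
    then show False using z(2)[of i n] \<open>\<bar>m\<bar> > int N\<close> by auto
  qed
  have total: "(\<Sum>z \<in> B_disc N \<inter> neumann_spectrum \<psi>. neumann_mult \<psi> z) = 2 * (2 * N + 1)"
  proof -
    define r where "r = sqrt ((real N + 1 / 4) * pi / 2)"
    have r: "0 < r" by (auto simp: r_def intro!: divide_pos_pos mult_pos_pos)
    have Br: "B_disc N = ball 0 r" by (simp add: B_disc_ball r_def)
    have hf: "(\<lambda>z::complex. sin (2 * z\<^sup>2)) holomorphic_on ball 0 (r + 1)" by (intro holomorphic_intros)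
    have less: "norm (chi_N z \<psi> - sin (2 * z\<^sup>2)) < norm (sin (2 * z\<^sup>2))" if z: "norm (z - 0) = r" for z
    proof -
      have "norm (chi_N z \<psi> - sin (2 * z\<^sup>2)) < exp \<bar>Im (2 * z\<^sup>2)\<bar> / 8"
        using z by (intro close) (simp add: Br)
      also have "\<dots> \<le> norm (sin (2 * z\<^sup>2))"
      proof (rule norm_sin_ge_exp)
        fix m :: int
        have "norm (2 * z\<^sup>2) = 2 * r\<^sup>2" using z by (simp add: norm_mult norm_power)
        also have "\<dots> = (real N + 1 / 4) * pi" by (simp add: r_def)
        finally have n: "norm (2 * z\<^sup>2) = (real N + 1 / 4) * pi" .
        \<comment> \<open>On the boundary |2 z^2| = (N + 1/4) pi, and N + 1/4 has distance at least
          1/4 from every integer. So the whole circle keeps the distance pi/4 from the zeros of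
          sin.\<close>
        have "1 / 4 \<le> \<bar>real N + 1 / 4 - of_int \<bar>m\<bar>\<bar>"
          by (cases "\<bar>m\<bar> \<le> int N") linarith+
        then have "1 / 4 * pi \<le> \<bar>real N + 1 / 4 - of_int \<bar>m\<bar>\<bar> * pi" by (intro mult_right_mono) auto
        also have "\<dots> = \<bar>norm (2 * z\<^sup>2) - norm (of_int m * of_real pi :: complex)\<bar>"
        proof -
          have "norm (of_int m * of_real pi :: complex) = of_int \<bar>m\<bar> * pi" by (simp add: norm_mult)
          moreover have "\<bar>(real N + 1 / 4 - of_int \<bar>m\<bar>) * pi\<bar> = \<bar>real N + 1 / 4 - of_int \<bar>m\<bar>\<bar> * pi"
            by (simp only: abs_mult abs_of_pos[OF pi_gt_zero])
          ultimately show ?thesis by (simp only: n left_diff_distrib)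
        qed
        also have "\<dots> \<le> norm (2 * z\<^sup>2 - of_int m * of_real pi)" by (rule norm_triangle_ineq3)
        finally show "pi / 4 \<le> norm (2 * z\<^sup>2 - of_int m * of_real pi)" by simp
      qed
      finally show ?thesis .
    qed
    note rouche = rouche_ball[OF hf holomorphic_on_chi_N r less_add_one less]
    have eq: "{z. z \<in> ball 0 r \<and> chi_N z \<psi> = 0} = B_disc N \<inter> neumann_spectrum \<psi>"
      by (auto simp: Br neumann_spectrum_def)
    have nz: "chi_N (of_real r) \<psi> \<noteq> 0" using less[of "of_real r"] r by auto
    have m: "int (neumann_mult \<psi> z) = zorder (\<lambda>z. chi_N z \<psi>) z" if "z \<in> neumann_spectrum \<psi>" for z
      using zorder_pos_of_zero[OF holomorphic_on_chi_N[of \<psi> UNIV] open_UNIV connected_UNIV UNIV_I UNIV_I nz, of z] that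
      by (simp add: neumann_mult_def neumann_spectrum_def)
    have "int (\<Sum>z \<in> B_disc N \<inter> neumann_spectrum \<psi>. neumann_mult \<psi> z)
        = (\<Sum>z \<in> B_disc N \<inter> neumann_spectrum \<psi>. zorder (\<lambda>z. chi_N z \<psi>) z)"
      unfolding of_nat_sum by (intro sum.cong) (auto simp: m)
    also have "\<dots> = int (2 * (2 * N + 1))"
      using rouche(3) free_zero_count[of N] unfolding eq Br by simp
    finally show ?thesis by (simp only: of_nat_eq_iff)
  qed
  show ?thesis
    unfolding counting_property_def
  proof (intro conjI)
    show "\<forall>i\<in>{1, 2}. \<forall>n. int N < \<bar>n\<bar> \<longrightarrow> (\<exists>!z. z \<in> D_disc i n \<inter> neumann_spectrum \<psi>) \<and>
        (\<forall>z\<in>D_disc i n \<inter> neumann_spectrum \<psi>. neumann_mult \<psi> z = 1)"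
      by (intro ballI allI impI D)
    show "neumann_spectrum \<psi> - (\<Union>i\<in>{1, 2}. \<Union>n\<in>{n. int N < \<bar>n\<bar>}. D_disc i n) \<subseteq> B_disc N"
    proof
      fix z assume z: "z \<in> neumann_spectrum \<psi> - (\<Union>i\<in>{1, 2}. \<Union>n\<in>{n. int N < \<bar>n\<bar>}. D_disc i n)"
      show "z \<in> B_disc N" by (rule rest) (use z in auto)
    qed
  qed (rule total)
qed

section \<open>Labels\<close>

lemma counting_propertyD:
  assumes "counting_property \<psi> N"
  shows "\<And>i n. i \<in> {1, 2} \<Longrightarrow> \<bar>n\<bar> > int N \<Longrightarrow> \<exists>!z. z \<in> D_disc i n \<inter> neumann_spectrum \<psi>"
    and "\<And>i n z. i \<in> {1, 2} \<Longrightarrow> \<bar>n\<bar> > int N \<Longrightarrow> z \<in> D_disc i n \<Longrightarrow> z \<in> neumann_spectrum \<psi> \<Longrightarrow> neumann_mult \<psi> z = 1"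
    and "\<And>z. z \<in> neumann_spectrum \<psi> \<Longrightarrow> z \<in> B_disc N \<or> (\<exists>i\<in>{1, 2}. \<exists>n. \<bar>n\<bar> > int N \<and> z \<in> D_disc i n)"
    and "(\<Sum>z \<in> B_disc N \<inter> neumann_spectrum \<psi>. neumann_mult \<psi> z) = 2 * (2 * N + 1)"
proof -
  note c = assms[unfolded counting_property_def]
  show "\<exists>!z. z \<in> D_disc i n \<inter> neumann_spectrum \<psi>" if "i \<in> {1, 2}" "\<bar>n\<bar> > int N" for i n
    using c that by blast
  show "neumann_mult \<psi> z = 1" if "i \<in> {1, 2}" "\<bar>n\<bar> > int N" "z \<in> D_disc i n" "z \<in> neumann_spectrum \<psi>" for i n z
    using c that by blast
  show "z \<in> B_disc N \<or> (\<exists>i\<in>{1, 2}. \<exists>n. \<bar>n\<bar> > int N \<and> z \<in> D_disc i n)" if "z \<in> neumann_spectrum \<psi>" for z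
  proof (rule disjCI)
    assume "\<not> (\<exists>i\<in>{1, 2}. \<exists>n. \<bar>n\<bar> > int N \<and> z \<in> D_disc i n)"
    then have "z \<in> neumann_spectrum \<psi> - (\<Union>i\<in>{1, 2}. \<Union>n\<in>{n. \<bar>n\<bar> > int N}. D_disc i n)"
      using that by blast
    then show "z \<in> B_disc N" using c by blast
  qed
  show "(\<Sum>z \<in> B_disc N \<inter> neumann_spectrum \<psi>. neumann_mult \<psi> z) = 2 * (2 * N + 1)"
    using c by blast
qed

lemma counting_property_neumann_N: "counting_property \<psi> N \<Longrightarrow> counting_property \<psi> (neumann_N \<psi>)"
  unfolding neumann_N_def by (rule LeastI)

text \<open>A sum over an infinite set is 0 by convention, whereas the prescribed total is
  positive.\<close>

lemma counting_property_finite: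
  assumes "counting_property \<psi> N"
  shows "finite (B_disc N \<inter> neumann_spectrum \<psi>)"
  by (rule ccontr) (use counting_propertyD(4)[OF assms] in simp)

text \<open>A disc is infinite but contains only finitely many eigenvalues, so \<open>chi_N\<close>
  is not identically zero in z. The lemmas on \<open>zorder\<close> ask for such a point.\<close>

lemma counting_property_nonzero:
  assumes "counting_property \<psi> N"
  obtains w where "chi_N w \<psi> \<noteq> 0"
proof -
  have "infinite (B_disc N)"
    unfolding B_disc_ball
    by (intro uncountable_infinite uncountable_ball) (auto intro!: divide_pos_pos mult_pos_pos)
  then have "B_disc N \<inter> neumann_spectrum \<psi> \<noteq> B_disc N"
    using counting_property_finite[OF assms] by metis
  then show ?thesis using that by (auto simp: neumann_spectrum_def)
qed

lemma neumann_mult_pos: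
  assumes "counting_property \<psi> N" "z \<in> neumann_spectrum \<psi>"
  shows "0 < neumann_mult \<psi> z"
proof -
  obtain w where "chi_N w \<psi> \<noteq> 0" by (rule counting_property_nonzero[OF assms(1)])
  then show ?thesis
    using zorder_pos_of_zero[OF holomorphic_on_chi_N[of \<psi> UNIV] open_UNIV connected_UNIV UNIV_I UNIV_I, of w z] assms(2)
    by (simp add: neumann_mult_def neumann_spectrum_def)
qed

text \<open>\<open>neumann_list\<close> is a definite description. The lexicographic order is linear
  on the whole plane, so a finite multiset of complex numbers can be sorted in exactly one
  way.\<close>

lemma lex_sorted_list_unique_exists:
  fixes f :: "complex \<Rightarrow> nat"
  assumes "finite {z. 0 < f z}"
  shows "\<exists>!zs. sorted_wrt lex_le zs \<and> (\<forall>z. count_list zs z = f z)"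
proof -
  interpret lex: linorder lex_le "\<lambda>z w. lex_le z w \<and> z \<noteq> w"
    by unfold_locales (auto simp: lex_le_def complex_eq_iff)
  obtain xs where xs: "mset xs = Abs_multiset f" using ex_mset by blast
  then have c: "count_list xs z = f z" for z
    using count_Abs_multiset[OF assms] by (simp flip: count_mset)
  show ?thesis
  proof (rule ex1I[of _ "lex.sort xs"])
    show "sorted_wrt lex_le (lex.sort xs) \<and> (\<forall>z. count_list (lex.sort xs) z = f z)"
      using lex.sorted_sort[of xs] c by (simp flip: count_mset)
    fix ys assume ys: "sorted_wrt lex_le ys \<and> (\<forall>z. count_list ys z = f z)"
    then have "mset ys = mset xs" using c by (intro multiset_eqI) (simp add: count_mset)
    then show "ys = lex.sort xs" using ys lex.properties_for_sort by metis
  qed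
qed

lemma neumann_list_count:
  assumes "counting_property \<psi> (neumann_N \<psi>)"
  shows "count_list (neumann_list \<psi>) z = (if z \<in> B_disc (neumann_N \<psi>) then neumann_mult \<psi> z else 0)"
    and "length (neumann_list \<psi>) = 4 * neumann_N \<psi> + 2"
    and "set (neumann_list \<psi>) = B_disc (neumann_N \<psi>) \<inter> neumann_spectrum \<psi>"
proof -
  let ?N = "neumann_N \<psi>"
  let ?f = "\<lambda>z. if z \<in> B_disc ?N then neumann_mult \<psi> z else 0"
  have sup: "{z. 0 < ?f z} = B_disc ?N \<inter> neumann_spectrum \<psi>"
    using neumann_mult_pos[OF assms] by (auto simp: neumann_mult_def split: if_splits)
  then have "finite {z. 0 < ?f z}" using counting_property_finite[OF assms] by simp
  from theI'[OF lex_sorted_list_unique_exists[OF this]]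
  have c: "count_list (neumann_list \<psi>) z = ?f z" for z unfolding neumann_list_def by blast
  then show "count_list (neumann_list \<psi>) z = ?f z" .
  show set: "set (neumann_list \<psi>) = B_disc ?N \<inter> neumann_spectrum \<psi>"
  proof (rule set_eqI)
    fix z
    have "z \<in> set (neumann_list \<psi>) \<longleftrightarrow> 0 < ?f z"
      unfolding c[symmetric] using count_list_0_iff[of "neumann_list \<psi>" z] by (simp add: neq0_conv[symmetric] del: neq0_conv)
    also have "\<dots> \<longleftrightarrow> z \<in> {z. 0 < ?f z}" by simp
    finally show "z \<in> set (neumann_list \<psi>) \<longleftrightarrow> z \<in> B_disc ?N \<inter> neumann_spectrum \<psi>" unfolding sup .
  qed
  have "length (neumann_list \<psi>) = sum (count_list (neumann_list \<psi>)) (set (neumann_list \<psi>))"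
    by (rule sum_count_set[symmetric]) auto
  also have "\<dots> = (\<Sum>z \<in> B_disc ?N \<inter> neumann_spectrum \<psi>. neumann_mult \<psi> z)"
    unfolding set by (intro sum.cong) (auto simp: c)
  finally show "length (neumann_list \<psi>) = 4 * ?N + 2" using counting_propertyD(4)[OF assms] by simp
qed

section \<open>Positions of the labels and location of the labeled eigenvalues\<close>

lemma label_position_less:
  assumes "\<bar>n\<bar> \<le> int N"
  shows "label_position N i n < 4 * N + 2"
  using assms unfolding label_position_def by (auto simp: nat_less_iff)

text \<open>The cases are the consecutive blocks of the chain. The fourth one contains the label 0
  with upper index 2 together with the positive labels of that index.\<close>

lemma label_position_surj:
  assumes "p < 4 * N + 2"
  obtains i n where "i \<in> {1, 2}" "\<bar>n\<bar> \<le> int N" "label_position N i n = p"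
proof -
  consider "p < N" | "N \<le> p" "p < 2 * N" | "p = 2 * N" | "2 * N < p" "p \<le> 3 * N + 1" | "3 * N + 1 < p"
    by linarith
  then show ?thesis
  proof cases
    case 1
    then show ?thesis by (intro that[of 1 "int p - int N"]) (auto simp: label_position_def)
  next
    case 2
    then show ?thesis by (intro that[of 2 "int p - 2 * int N"]) (auto simp: label_position_def)
  next
    case 3
    then show ?thesis by (intro that[of 1 0]) (auto simp: label_position_def)
  next
    case 4
    then show ?thesis by (intro that[of 2 "int p - 2 * int N - 1"]) (auto simp: label_position_def)
  next
    case 5
    then show ?thesis using assms by (intro that[of 1 "int p - 3 * int N - 1"]) (auto simp: label_position_def)
  qed
qed

lemma neumann_ev_outer:
  assumes "counting_property \<psi> N" "i \<in> {1, 2}" "\<bar>n\<bar> > int (neumann_N \<psi>)"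
  shows "neumann_ev i n \<psi> \<in> D_disc i n" "neumann_ev i n \<psi> \<in> neumann_spectrum \<psi>"
proof -
  have "counting_property \<psi> (neumann_N \<psi>)" by (rule counting_property_neumann_N[OF assms(1)])
  from theI'[OF counting_propertyD(1)[OF this assms(2,3)]] assms(3)
  show "neumann_ev i n \<psi> \<in> D_disc i n" "neumann_ev i n \<psi> \<in> neumann_spectrum \<psi>"
    by (simp_all add: neumann_ev_def)
qed

lemma neumann_ev_inner:
  assumes "counting_property \<psi> N" "\<bar>n\<bar> \<le> int (neumann_N \<psi>)"
  shows "neumann_ev i n \<psi> = neumann_list \<psi> ! label_position (neumann_N \<psi>) i n"
    and "neumann_ev i n \<psi> \<in> B_disc (neumann_N \<psi>) \<inter> neumann_spectrum \<psi>"
proof -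
  have c: "counting_property \<psi> (neumann_N \<psi>)" by (rule counting_property_neumann_N[OF assms(1)])
  show e: "neumann_ev i n \<psi> = neumann_list \<psi> ! label_position (neumann_N \<psi>) i n"
    using assms(2) by (simp add: neumann_ev_def)
  show "neumann_ev i n \<psi> \<in> B_disc (neumann_N \<psi>) \<inter> neumann_spectrum \<psi>"
    unfolding e neumann_list_count(3)[OF c, symmetric]
    using label_position_less[OF assms(2), of i] neumann_list_count(2)[OF c] by (intro nth_mem) simp
qed

lemma neumann_N_le: "counting_property \<psi> N \<Longrightarrow> neumann_N \<psi> \<le> N"
  unfolding neumann_N_def by (rule Least_le)

lemma neumann_ev_spectrum:
  assumes "counting_property \<psi> N" "i \<in> {1, 2}"
  shows "neumann_ev i n \<psi> \<in> neumann_spectrum \<psi>"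
  using neumann_ev_outer[OF assms] neumann_ev_inner[OF assms(1)]
  by (cases "\<bar>n\<bar> > int (neumann_N \<psi>)") auto

lemma neumann_ev_B_disc:
  assumes "counting_property \<psi> N" "i \<in> {1, 2}" "\<bar>n\<bar> \<le> int N"
  shows "neumann_ev i n \<psi> \<in> B_disc N"
proof (cases "\<bar>n\<bar> > int (neumann_N \<psi>)")
  case True
  then show ?thesis using neumann_ev_outer[OF assms(1,2)] D_disc_subset_B_disc[OF assms(3)] by blast
next
  case False
  then show ?thesis using neumann_ev_inner(2)[OF assms(1), of n i] B_disc_mono[OF neumann_N_le[OF assms(1)]] by auto
qed

text \<open>If every eigenvalue lies in the disc with its own label then, because the discs are disjoint,
  each disc contains exactly as many entries of the list as it has labels.\<close>

lemma counting_property_0I: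
  assumes c: "counting_property \<psi> N0"
    and ev: "\<And>i n. i \<in> {1, 2} \<Longrightarrow> neumann_ev i n \<psi> \<in> D_disc i n"
  shows "counting_property \<psi> 0"
proof -
  define N where "N = neumann_N \<psi>"
  define zs where "zs = neumann_list \<psi>"
  have cN: "counting_property \<psi> N" unfolding N_def by (rule counting_property_neumann_N[OF c])
  note nl = neumann_list_count[OF cN[unfolded N_def], folded N_def zs_def]
  have nthD: "zs ! label_position N i n \<in> D_disc i n" if "i \<in> {1, 2}" "\<bar>n\<bar> \<le> int N" for i n
    using ev[OF that(1), of n] neumann_ev_inner(1)[OF c, of n i] that(2) by (simp add: N_def zs_def)
  \<comment> \<open>Every position carries a label, so every entry of the list lies in the disc of
    some label. In this way the hypothesis on the labeled eigenvalues reaches all eigenvalues in the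
    large disc.\<close>
  have label: "\<exists>j\<in>{1, 2}. \<exists>m. \<bar>m\<bar> \<le> int N \<and> label_position N j m = p \<and> zs ! p \<in> D_disc j m" if "p < length zs" for p
  proof -
    have "p < 4 * N + 2" using that nl(2) by simp
    then obtain i n where "i \<in> {1, 2}" "\<bar>n\<bar> \<le> int N" "label_position N i n = p" by (rule label_position_surj)
    then show ?thesis using nthD[of i n] by blast
  qed
  have filt: "count_list (filter (\<lambda>z. z \<in> D) zs) z = (if z \<in> D then count_list zs z else 0)" for D z
    by (induction zs) auto
  \<comment> \<open>The list repeats an eigenvalue as often as its multiplicity, so multiplicities
    in a region are counted by list entries.\<close>
  have sumfilt: "(\<Sum>z \<in> D \<inter> neumann_spectrum \<psi>. neumann_mult \<psi> z) = length (filter (\<lambda>z. z \<in> D) zs)"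
    if "D \<subseteq> B_disc N" for D
  proof -
    have fin: "finite (D \<inter> neumann_spectrum \<psi>)"
      using that by (intro finite_subset[OF _ counting_property_finite[OF cN]]) auto
    have "(\<Sum>z \<in> D \<inter> neumann_spectrum \<psi>. neumann_mult \<psi> z)
        = sum (count_list (filter (\<lambda>z. z \<in> D) zs)) (D \<inter> neumann_spectrum \<psi>)"
      using that by (intro sum.cong) (auto simp: filt nl(1))
    also have "\<dots> = length (filter (\<lambda>z. z \<in> D) zs)"
      using nl(3) fin by (intro sum_count_set) auto
    finally show ?thesis .
  qed
  have D0: "D_disc i 0 = B_disc 0" if "i \<in> {1, 2}" for i using that D_disc_1_0 by auto
  have "length (filter (\<lambda>z. z \<in> B_disc 0) zs) = card {p. p < length zs \<and> zs ! p \<in> B_disc 0}"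
    by (rule length_filter_conv_card)
  \<comment> \<open>The two labels 0 have different positions, so the small disc receives two
    entries even if they are the same complex number.\<close>
  also have "{p. p < length zs \<and> zs ! p \<in> B_disc 0} = {label_position N 1 0, label_position N 2 0}"
  proof (intro set_eqI iffI)
    fix p assume p: "p \<in> {p. p < length zs \<and> zs ! p \<in> B_disc 0}"
    then obtain j m where j: "j \<in> {1, 2}" "label_position N j m = p" "zs ! p \<in> D_disc j m" using label by blast
    have "m = 0" using D_disc_disjoint[OF j(1) _ j(3), of 1 0] p D0[of 1] by simp
    then show "p \<in> {label_position N 1 0, label_position N 2 0}" using j by auto
  next
    fix p assume "p \<in> {label_position N 1 0, label_position N 2 0}"
    then show "p \<in> {p. p < length zs \<and> zs ! p \<in> B_disc 0}"
      using nthD[of 1 0] nthD[of 2 0] D0 label_position_less[of 0 N] nl(2) by auto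
  qed
  also have "card \<dots> = 2" by (auto simp: label_position_def)
  finally have total: "(\<Sum>z \<in> B_disc 0 \<inter> neumann_spectrum \<psi>. neumann_mult \<psi> z) = 2"
    using sumfilt[OF B_disc_mono] by simp
  have outer: "(\<exists>!z. z \<in> D_disc i n \<inter> neumann_spectrum \<psi>) \<and>
      (\<forall>z \<in> D_disc i n \<inter> neumann_spectrum \<psi>. neumann_mult \<psi> z = 1)" if i: "i \<in> {1, 2}" and n: "n \<noteq> 0" for i n
  proof (cases "\<bar>n\<bar> > int N")
    case True
    then show ?thesis using counting_propertyD(1,2)[OF cN i] by blast
  next
    case False
    then have nN: "\<bar>n\<bar> \<le> int N" by simp
    have DB: "D_disc i n \<subseteq> B_disc N" using D_disc_subset_B_disc[OF nN] by blast
    have "length (filter (\<lambda>z. z \<in> D_disc i n) zs) = card {p. p < length zs \<and> zs ! p \<in> D_disc i n}"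
      by (rule length_filter_conv_card)
    also have "{p. p < length zs \<and> zs ! p \<in> D_disc i n} = {label_position N i n}"
    proof (intro set_eqI iffI)
      fix p assume p: "p \<in> {p. p < length zs \<and> zs ! p \<in> D_disc i n}"
      then obtain j m where j: "j \<in> {1, 2}" "label_position N j m = p" "zs ! p \<in> D_disc j m" using label by blast
      have "m = n \<and> j = i" using D_disc_disjoint[OF j(1) i j(3), of n] p n by auto
      then show "p \<in> {label_position N i n}" using j by auto
    next
      fix p assume "p \<in> {label_position N i n}"
      then show "p \<in> {p. p < length zs \<and> zs ! p \<in> D_disc i n}"
        using nthD[OF i nN] label_position_less[OF nN, of i] nl(2) by auto
    qed
    finally have "(\<Sum>z \<in> D_disc i n \<inter> neumann_spectrum \<psi>. neumann_mult \<psi> z) = 1"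
      using sumfilt[OF DB] by simp
    then have s: "(\<Sum>z \<in> D_disc i n \<inter> neumann_spectrum \<psi>. int (neumann_mult \<psi> z)) = 1"
      unfolding of_nat_sum[symmetric] by simp
    have fin: "finite (D_disc i n \<inter> neumann_spectrum \<psi>)"
      using DB by (intro finite_subset[OF _ counting_property_finite[OF cN]]) auto
    obtain x where "D_disc i n \<inter> neumann_spectrum \<psi> = {x}" "int (neumann_mult \<psi> x) = 1"
    proof (rule sum_eq_1_singleton[OF fin _ s])
      show "1 \<le> int (neumann_mult \<psi> z)" if "z \<in> D_disc i n \<inter> neumann_spectrum \<psi>" for z
        using neumann_mult_pos[OF cN, of z] that by simp
    qed
    then show ?thesis by simp
  qed
  have rest: "z \<in> B_disc 0" if z: "z \<in> neumann_spectrum \<psi>" "\<And>i n. i \<in> {1, 2} \<Longrightarrow> n \<noteq> 0 \<Longrightarrow> z \<notin> D_disc i n" for z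
  proof -
    have "z \<in> B_disc N" using counting_propertyD(3)[OF cN z(1)] z(2) by fastforce
    then have "z \<in> set zs" using nl(3) z(1) by simp
    then obtain p where "p < length zs" "zs ! p = z" by (auto simp: in_set_conv_nth)
    then obtain j m where "j \<in> {1, 2}" "z \<in> D_disc j m" using label by blast
    then show ?thesis using z(2)[of j m] D0 by (cases "m = 0") auto
  qed
  show ?thesis
    unfolding counting_property_def
  proof (intro conjI)
    show "\<forall>i\<in>{1, 2}. \<forall>n. int 0 < \<bar>n\<bar> \<longrightarrow> (\<exists>!z. z \<in> D_disc i n \<inter> neumann_spectrum \<psi>) \<and>
        (\<forall>z\<in>D_disc i n \<inter> neumann_spectrum \<psi>. neumann_mult \<psi> z = 1)"
      by (intro ballI allI impI outer) auto
    show "neumann_spectrum \<psi> - (\<Union>i\<in>{1, 2}. \<Union>n\<in>{n. int 0 < \<bar>n\<bar>}. D_disc i n) \<subseteq> B_disc 0"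
    proof
      fix z assume z: "z \<in> neumann_spectrum \<psi> - (\<Union>i\<in>{1, 2}. \<Union>n\<in>{n. int 0 < \<bar>n\<bar>}. D_disc i n)"
      show "z \<in> B_disc 0" by (rule rest) (use z in auto)
    qed
  qed (use total in simp)
qed

lemma bounded_D_disc: "bounded (D_disc i n)"
proof (rule bounded_subset)
  show "bounded (B_disc (nat \<bar>n\<bar>))" by (simp add: B_disc_ball)
  show "D_disc i n \<subseteq> B_disc (nat \<bar>n\<bar>)" using D_disc_subset_B_disc[of n "nat \<bar>n\<bar>"] by auto
qed

text \<open>Limits of eigenvalues are only known to lie in the closure, so boundary points have to
  be excluded. By the counting property such an eigenvalue lies in \<open>B_disc N\<close>, which is
  too small, or in an outer disc, which the nearby multiple of pi and the half plane
  identify.\<close>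

lemma closure_D_disc_spectrum:
  assumes c: "counting_property \<psi> N" and i: "i \<in> {1, 2}" and n: "\<bar>n\<bar> > int N"
    and z: "z \<in> closure (D_disc i n)" "z \<in> neumann_spectrum \<psi>"
  shows "z \<in> D_disc i n"
proof -
  have n0: "n \<noteq> 0" using n by auto
  let ?A = "{z. norm (2 * z\<^sup>2 - of_int (disc_index i n) * of_real pi) \<le> pi / 4 \<and> 0 \<le> Re (z / sector_unit i n)}"
  have "closed ?A"
    using sector_unit_simps(1)[OF n0, of i]
    by (intro closed_Collect_conj closed_Collect_le continuous_intros) auto
  moreover have "D_disc i n \<subseteq> ?A"
    using D_disc_index[OF n0] D_disc_iff[OF n0] by (auto intro: less_imp_le)
  ultimately have "closure (D_disc i n) \<subseteq> ?A" by (rule closure_minimal[rotated])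
  then have zA: "norm (2 * z\<^sup>2 - of_int (disc_index i n) * of_real pi) \<le> pi / 4" "0 \<le> Re (z / sector_unit i n)"
    using z(1) by auto
  from counting_propertyD(3)[OF c z(2)] show ?thesis
  proof
    assume "z \<in> B_disc N"
    then have "norm (2 * z\<^sup>2) < (real N + 1 / 4) * pi" by (simp add: B_disc_iff)
    moreover have "(of_int \<bar>n\<bar> - 1 / 4) * pi \<le> norm (2 * z\<^sup>2)" by (rule D_disc_bounds(1)[OF n0 zA(1)])
    moreover have "(real N + 1 / 4) * pi \<le> (of_int \<bar>n\<bar> - 1 / 4) * pi"
    proof (rule mult_right_mono)
      have "real N + 1 \<le> of_int \<bar>n\<bar>" using n by linarith
      then show "real N + 1 / 4 \<le> of_int \<bar>n\<bar> - 1 / 4" by simp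
    qed simp
    ultimately show ?thesis by linarith
  next
    assume "\<exists>j\<in>{1, 2}. \<exists>m. int N < \<bar>m\<bar> \<and> z \<in> D_disc j m"
    then obtain j m where j: "j \<in> {1, 2}" and m: "int N < \<bar>m\<bar>" and zj: "z \<in> D_disc j m" by blast
    have m0: "m \<noteq> 0" using m by auto
    have "disc_index j m = disc_index i n"
      by (rule near_multiple_of_pi_unique[OF D_disc_index[OF m0 zj] zA(1)]) simp
    then have ij: "j = i" and mn: "\<bar>m\<bar> = \<bar>n\<bar>"
      using m0 n0 i j by (auto simp: disc_index_def split: if_splits)
    have "m = n"
    proof (rule ccontr)
      assume "m \<noteq> n"
      then have "m = - n" using mn by linarith
      then have "sector_unit j m = - sector_unit i n" using ij by (simp add: sector_unit_def)
      then have "Re (z / sector_unit j m) = - Re (z / sector_unit i n)" by simp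
      then show False using zj zA(2) D_disc_iff[OF m0, of z j] by simp
    qed
    then show ?thesis using zj ij by simp
  qed
qed

section \<open>Analyticity of simple eigenvalues\<close>

text \<open>If roots along a sequence stayed away from the value at \<psi>, they would have a limit
  point in the compact closure of D. By joint continuity it is a root for \<psi>, hence equal to
  that value.\<close>

lemma continuous_unique_root:
  assumes W: "open W" "\<psi> \<in> W" and D: "bounded D"
    and root: "\<And>\<phi>. \<phi> \<in> W \<Longrightarrow> \<nu> \<phi> \<in> D" "\<And>\<phi>. \<phi> \<in> W \<Longrightarrow> chi_N (\<nu> \<phi>) \<phi> = 0"
    and uniq: "\<And>z. z \<in> closure D \<Longrightarrow> chi_N z \<psi> = 0 \<Longrightarrow> z = \<nu> \<psi>"
  shows "isCont \<nu> \<psi>"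
  unfolding continuous_at_sequentially
proof (intro allI impI)
  fix x :: "nat \<Rightarrow> potential" assume x: "x \<longlonglongrightarrow> \<psi>"
  show "(\<nu> \<circ> x) \<longlonglongrightarrow> \<nu> \<psi>"
  proof (rule ccontr)
    assume "\<not> (\<nu> \<circ> x) \<longlonglongrightarrow> \<nu> \<psi>"
    then obtain e where e: "e > 0" "\<not> (\<forall>\<^sub>F k in sequentially. dist (\<nu> (x k)) (\<nu> \<psi>) < e)"
      unfolding tendsto_iff by auto
    have evW: "\<forall>\<^sub>F k in sequentially. x k \<in> W" using x W topological_tendstoD by blast
    have "\<not> (\<forall>\<^sub>F k in sequentially. \<not> (x k \<in> W \<and> e \<le> dist (\<nu> (x k)) (\<nu> \<psi>)))"
    proof (rule contrapos_nn[OF e(2)])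
      assume "\<forall>\<^sub>F k in sequentially. \<not> (x k \<in> W \<and> e \<le> dist (\<nu> (x k)) (\<nu> \<psi>))"
      with evW show "\<forall>\<^sub>F k in sequentially. dist (\<nu> (x k)) (\<nu> \<psi>) < e"
        by eventually_elim auto
    qed
    from not_eventually_sequentiallyD[OF this]
    obtain r :: "nat \<Rightarrow> nat" where r: "strict_mono r \<and> (\<forall>k. \<not> \<not> (x (r k) \<in> W \<and> e \<le> dist (\<nu> (x (r k))) (\<nu> \<psi>)))"
      by (rule exE)
    then have mono_r: "strict_mono r" and rW: "\<And>k. x (r k) \<in> W" and re: "\<And>k. e \<le> dist (\<nu> (x (r k))) (\<nu> \<psi>)"
      by (simp_all only: not_not)
    have "seq_compact (closure D)" using D by (simp add: compact_imp_seq_compact)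
    moreover have "\<forall>k. \<nu> (x (r k)) \<in> closure D" using root(1)[OF rW] closure_subset[of D] by auto
    ultimately obtain l s where l: "l \<in> closure D" "strict_mono s" "((\<lambda>k. \<nu> (x (r k))) \<circ> s) \<longlonglongrightarrow> l"
      by (rule seq_compactE)
    have xs: "(\<lambda>k. x (r (s k))) \<longlonglongrightarrow> \<psi>"
      using LIMSEQ_subseq_LIMSEQ[OF x strict_mono_o[OF mono_r l(2)]] by (simp add: o_def)
    have pair: "(\<lambda>k. (\<nu> (x (r (s k))), x (r (s k)))) \<longlonglongrightarrow> (l, \<psi>)"
      using l(3) xs by (intro tendsto_Pair) (simp_all add: o_def)
    have "isCont (\<lambda>p. chi_N (fst p) (snd p)) (l, \<psi>)"
      using continuous_on_chi_N[of UNIV] by (simp add: continuous_on_eq_continuous_at)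
    from isCont_tendsto_compose[OF this pair]
    have "(\<lambda>k. chi_N (\<nu> (x (r (s k)))) (x (r (s k)))) \<longlonglongrightarrow> chi_N l \<psi>" by simp
    moreover have "chi_N (\<nu> (x (r (s k)))) (x (r (s k))) = 0" for k by (rule root(2)[OF rW])
    ultimately have "chi_N l \<psi> = 0" by (simp add: LIMSEQ_const_iff)
    then have "l = \<nu> \<psi>" by (rule uniq[OF l(1)])
    then have "(\<lambda>k. dist (\<nu> (x (r (s k)))) (\<nu> \<psi>)) \<longlonglongrightarrow> 0"
      using tendsto_dist_iff[THEN iffD1, OF l(3)] by (simp add: o_def)
    then have "e \<le> 0" by (rule tendsto_lowerbound) (use re in auto)
    then show False using e(1) by simp
  qed
qed

text \<open>The root is already given as a function, so only the differentiability part of the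
  implicit function theorem is carried out. Continuity comes from compactness; linearizing the
  equation at the root gives the derivative -D'/c, which is complex linear because D' is.\<close>

lemma analytic_on_potentials_unique_root:
  assumes W: "open W" and D: "bounded D"
    and root: "\<And>\<phi>. \<phi> \<in> W \<Longrightarrow> \<nu> \<phi> \<in> D" "\<And>\<phi>. \<phi> \<in> W \<Longrightarrow> chi_N (\<nu> \<phi>) \<phi> = 0"
    and uniq: "\<And>\<phi> z. \<phi> \<in> W \<Longrightarrow> z \<in> closure D \<Longrightarrow> chi_N z \<phi> = 0 \<Longrightarrow> z = \<nu> \<phi>"
    and simple: "\<And>\<phi>. \<phi> \<in> W \<Longrightarrow> deriv (\<lambda>z. chi_N z \<phi>) (\<nu> \<phi>) \<noteq> 0"
  shows "analytic_on_potentials \<nu> W"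
  unfolding analytic_on_potentials_def
proof
  fix \<psi> assume \<psi>: "\<psi> \<in> W"
  have cont: "isCont \<nu> \<psi>" by (rule continuous_unique_root[OF W \<psi> D root uniq[OF \<psi>]])
  define z where "z = \<nu> \<psi>"
  define F where "F = (\<lambda>x. chi_N (fst x) (snd x))"
  obtain c D' where D': "\<And>k h. D' (potential_scaleC k h) = k * D' h"
    and d: "(F has_derivative (\<lambda>x. c * fst x + D' (snd x))) (at (z, \<psi>))"
    using chi_N_joint_derivative unfolding F_def by blast
  have bl: "bounded_linear (\<lambda>x. c * fst x + D' (snd x))" by (rule has_derivative_bounded_linear[OF d])
  have D'bl: "bounded_linear D'"
    using bounded_linear_compose[OF bl, of "\<lambda>h. (0, h)"] by (simp add: bounded_linear_Pair bounded_linear_zero bounded_linear_ident)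
  obtain K where K: "0 < K" "\<And>h. norm (D' h) \<le> norm h * K" using bounded_linear.pos_bounded[OF D'bl] by blast
  have c0: "c \<noteq> 0"
  proof -
    have "((\<lambda>w. (w, \<psi>)) has_derivative (\<lambda>w. (w, 0))) (at z)"
      by (intro has_derivative_Pair has_derivative_ident has_derivative_const)
    from has_derivative_compose[OF this d]
    have "((\<lambda>w. chi_N w \<psi>) has_field_derivative c) (at z)"
      by (simp add: F_def has_field_derivative_def linear_0[OF bounded_linear.linear[OF D'bl]])
    then show ?thesis using simple[OF \<psi>] DERIV_imp_deriv z_def by blast
  qed
  define L where "L h = - (D' h) / c" for h
  have Lbl: "bounded_linear L"
    unfolding L_def by (intro bounded_linear_compose[OF bounded_linear_divide] bounded_linear_minus D'bl)
  \<comment> \<open>Absorbing half of |c| |\<Delta>| below gives |\<Delta>| \<le> (2K/|c| + 1) |h|;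
    with |h| added, the factor becomes M.\<close>
  define M where "M = 2 * K / norm c + 2"
  have M: "0 < M" using K c0 by (simp add: M_def add_pos_pos)
  have "(\<nu> has_derivative L) (at \<psi>)"
    unfolding has_derivative_at_alt
  proof (intro conjI Lbl allI impI)
    fix e :: real assume e: "0 < e"
    \<comment> \<open>The first entry allows the absorption of |\<Delta>|, the second yields the
      final bound e |h|.\<close>
    define \<epsilon> where "\<epsilon> = min (norm c / 2) (e * norm c / M)"
    have \<epsilon>: "0 < \<epsilon>" "\<epsilon> \<le> norm c / 2" "\<epsilon> * M \<le> e * norm c"
      using e c0 M by (auto simp: \<epsilon>_def min_def field_simps)
    obtain d1 where d1: "0 < d1"
      "\<And>y. norm (y - (z, \<psi>)) < d1 \<Longrightarrow> norm (F y - F (z, \<psi>) - (c * fst (y - (z, \<psi>)) + D' (snd (y - (z, \<psi>))))) \<le> \<epsilon> * norm (y - (z, \<psi>))"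
      using d \<epsilon>(1) unfolding has_derivative_at_alt by blast
    obtain d2 where d2: "0 < d2" "\<And>\<phi>. dist \<phi> \<psi> < d2 \<Longrightarrow> dist (\<nu> \<phi>) (\<nu> \<psi>) < d1 / 2"
      using cont d1(1) unfolding continuous_at_eps_delta by (metis half_gt_zero)
    obtain d3 where d3: "0 < d3" "ball \<psi> d3 \<subseteq> W" using W \<psi> openE by blast
    show "\<exists>d>0. \<forall>\<phi>. norm (\<phi> - \<psi>) < d \<longrightarrow> norm (\<nu> \<phi> - \<nu> \<psi> - L (\<phi> - \<psi>)) \<le> e * norm (\<phi> - \<psi>)"
    proof (intro exI[of _ "min (d1 / 2) (min d2 d3)"] conjI allI impI)
      show "0 < min (d1 / 2) (min d2 d3)" using d1 d2 d3 by simp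
      fix \<phi> assume \<phi>: "norm (\<phi> - \<psi>) < min (d1 / 2) (min d2 d3)"
      define \<Delta> where "\<Delta> = \<nu> \<phi> - \<nu> \<psi>"
      define h where "h = \<phi> - \<psi>"
      have \<phi>W: "\<phi> \<in> W" using \<phi> d3(2) by (auto simp: dist_norm norm_minus_commute)
      have \<Delta>1: "norm \<Delta> < d1 / 2" using d2(2)[of \<phi>] \<phi> by (simp add: dist_norm \<Delta>_def)
      have eqp: "(\<nu> \<phi>, \<phi>) - (z, \<psi>) = (\<Delta>, h)" by (simp add: \<Delta>_def h_def z_def)
      have np: "norm (\<Delta>, h) \<le> norm \<Delta> + norm h" by (rule norm_Pair_le)
      then have "norm ((\<nu> \<phi>, \<phi>) - (z, \<psi>)) < d1" using \<Delta>1 \<phi> unfolding eqp by (simp add: h_def)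
      from d1(2)[OF this] have "norm (c * \<Delta> + D' h) \<le> \<epsilon> * norm (\<Delta>, h)"
        using root(2)[OF \<phi>W] root(2)[OF \<psi>] norm_minus_cancel[of "c * \<Delta> + D' h"] unfolding eqp
        by (simp add: F_def z_def)
      also have "\<dots> \<le> \<epsilon> * (norm \<Delta> + norm h)" using np \<epsilon>(1) by (intro mult_left_mono) auto
      finally have main: "norm (c * \<Delta> + D' h) \<le> \<epsilon> * (norm \<Delta> + norm h)" .
      have "norm c * norm \<Delta> \<le> norm (c * \<Delta> + D' h) + norm (D' h)"
        using norm_triangle_ineq4[of "c * \<Delta> + D' h" "D' h"] by (simp add: norm_mult)
      also have "\<dots> \<le> norm c / 2 * (norm \<Delta> + norm h) + norm h * K"
        using main mult_right_mono[OF \<epsilon>(2), of "norm \<Delta> + norm h"] K(2)[of h] by simp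
      also have "\<dots> = norm c * norm \<Delta> / 2 + (norm c * norm h / 2 + norm h * K)" by (simp add: algebra_simps)
      finally have "norm c * norm \<Delta> / 2 \<le> norm c * norm h / 2 + norm h * K" by simp
      then have "norm c * norm \<Delta> \<le> (norm c + 2 * K) * norm h" by (simp add: algebra_simps)
      then have "norm \<Delta> \<le> (norm c + 2 * K) * norm h / norm c"
        using c0 by (simp add: pos_le_divide_eq mult.commute)
      also have "\<dots> = (M - 1) * norm h" using c0 by (simp add: M_def field_simps)
      finally have "norm \<Delta> + norm h \<le> M * norm h" by (simp add: algebra_simps)
      then have "\<epsilon> * (norm \<Delta> + norm h) \<le> \<epsilon> * (M * norm h)" using \<epsilon>(1) by (intro mult_left_mono) auto
      also have "\<dots> \<le> (e * norm c) * norm h"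
        using mult_right_mono[OF \<epsilon>(3), of "norm h"] by (simp add: mult_ac)
      finally have "norm (c * \<Delta> + D' h) \<le> norm c * (e * norm h)" using main by (simp add: mult_ac)
      moreover have "c * \<Delta> + D' h = c * (\<Delta> - L h)" using c0 by (simp add: L_def field_simps)
      ultimately have "norm (\<Delta> - L h) \<le> e * norm h" using c0 by (simp add: norm_mult)
      then show "norm (\<nu> \<phi> - \<nu> \<psi> - L (\<phi> - \<psi>)) \<le> e * norm (\<phi> - \<psi>)" by (simp add: \<Delta>_def h_def)
    qed
  qed
  moreover have "L (potential_scaleC k h) = k * L h" for k h by (simp add: L_def D')
  ultimately show "\<exists>D. (\<nu> has_derivative D) (at \<psi>) \<and> (\<forall>c h. D (potential_scaleC c h) = c * D h)" by blast
qed

text \<open>For |n| > N the label is independent of the sorted list: throughout W the eigenvalue is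
  the only one in a fixed disc. Multiplicity 1 supplies the nonzero derivative.\<close>

lemma analytic_on_potentials_neumann_ev:
  assumes W: "open W" and c: "\<And>\<psi>. \<psi> \<in> W \<Longrightarrow> counting_property \<psi> N"
    and i: "i \<in> {1, 2}" and n: "\<bar>n\<bar> > int N"
  shows "analytic_on_potentials (neumann_ev i n) W"
proof (rule analytic_on_potentials_unique_root[OF W bounded_D_disc])
  fix \<psi> assume \<psi>: "\<psi> \<in> W"
  have n': "\<bar>n\<bar> > int (neumann_N \<psi>)" using neumann_N_le[OF c[OF \<psi>]] n by linarith
  show inD: "neumann_ev i n \<psi> \<in> D_disc i n" by (rule neumann_ev_outer(1)[OF c[OF \<psi>] i n'])
  have sp: "neumann_ev i n \<psi> \<in> neumann_spectrum \<psi>" by (rule neumann_ev_outer(2)[OF c[OF \<psi>] i n'])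
  then show "chi_N (neumann_ev i n \<psi>) \<psi> = 0" by (simp add: neumann_spectrum_def)
  show "z = neumann_ev i n \<psi>" if "z \<in> closure (D_disc i n)" "chi_N z \<psi> = 0" for z
  proof -
    have zs: "z \<in> neumann_spectrum \<psi>" using that(2) by (simp add: neumann_spectrum_def)
    have "z \<in> D_disc i n" by (rule closure_D_disc_spectrum[OF c[OF \<psi>] i n that(1) zs])
    then show ?thesis using counting_propertyD(1)[OF c[OF \<psi>] i n] inD sp zs by blast
  qed
  have "neumann_mult \<psi> (neumann_ev i n \<psi>) = 1" by (rule counting_propertyD(2)[OF c[OF \<psi>] i n inD sp])
  then have z1: "zorder (\<lambda>z. chi_N z \<psi>) (neumann_ev i n \<psi>) = 1"
    using sp by (simp add: neumann_mult_def)
  obtain w where "chi_N w \<psi> \<noteq> 0" by (rule counting_property_nonzero[OF c[OF \<psi>]])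
  then show "deriv (\<lambda>z. chi_N z \<psi>) (neumann_ev i n \<psi>) \<noteq> 0"
    using zorder_eq_1_iff_deriv[OF holomorphic_on_chi_N[of \<psi> UNIV] open_UNIV connected_UNIV UNIV_I UNIV_I, of w] z1 sp
    by (simp add: neumann_spectrum_def)
qed

section \<open>Asymptotics of the eigenvalues\<close>

lemma counting_property_uniform:
  obtains N where "\<And>\<psi>. norm \<psi> \<le> R \<Longrightarrow> counting_property \<psi> N"
proof -
  obtain C where C: "0 \<le> C"
    "\<And>z \<psi>. norm \<psi> \<le> R \<Longrightarrow> norm (chi_N z \<psi> - sin (2 * z\<^sup>2)) \<le> C * exp \<bar>Im (2 * z\<^sup>2)\<bar> / (1 + norm z)"
    using chi_N_asymptotic[of R] by blast
  \<comment> \<open>Outside \<open>B_disc N\<close> one has |z|^2 \<ge> N, so C/(1 + |z|) stays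
    below the threshold 1/8 of \<open>counting_propertyI\<close>.\<close>
  obtain N :: nat where N: "(8 * C)\<^sup>2 \<le> real N" using real_arch_simple by blast
  show ?thesis
  proof (rule that[of N], rule counting_propertyI)
    fix \<psi> :: potential and z assume \<psi>: "norm \<psi> \<le> R" and "z \<notin> B_disc N"
    then have z: "(real N + 1 / 4) * pi \<le> 2 * (norm z)\<^sup>2" by (simp add: B_disc_iff norm_mult norm_power)
    have "real N * 2 \<le> (real N + 1 / 4) * pi" using pi_gt3 by (intro mult_mono) auto
    then have "(8 * C)\<^sup>2 \<le> (norm z)\<^sup>2" using z N by linarith
    then have "8 * C \<le> norm z" by (rule power2_le_imp_le) simp
    then have 1: "8 * C < 1 + norm z" by simp
    have p: "0 < 1 + norm z" using norm_ge_zero[of z] by linarith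
    have "norm (chi_N z \<psi> - sin (2 * z\<^sup>2)) \<le> C * exp \<bar>Im (2 * z\<^sup>2)\<bar> / (1 + norm z)" by (rule C(2)[OF \<psi>])
    also have "\<dots> < exp \<bar>Im (2 * z\<^sup>2)\<bar> / 8"
      using mult_strict_right_mono[OF 1, of "exp \<bar>Im (2 * z\<^sup>2)\<bar>"] p by (simp add: divide_less_eq mult_ac)
    finally show "norm (chi_N z \<psi> - sin (2 * z\<^sup>2)) < exp \<bar>Im (2 * z\<^sup>2)\<bar> / 8" .
  qed
qed

text \<open>The Taylor remainder is at most 3 (pi/4)^2 |d| / 2, which is below (19/20) |d|, and 1/20
  is what remains. The decimal 0.7854 lies just above pi/4.\<close>

lemma norm_sin_lower:
  fixes d :: complex
  assumes "norm d \<le> pi / 4"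
  shows "norm d / 20 \<le> norm (sin d)"
proof -
  have p: "pi / 4 \<le> 7854 / 10000" using pi_approx by simp
  have s: "(\<Sum>k\<le>2. complex_of_real (sin_coeff k) * d ^ k) = d"
    by (simp add: numeral_2_eq_2 sin_coeff_def)
  have "norm (sin d - d) \<le> exp \<bar>Im d\<bar> * norm d ^ Suc 2 / fact 2"
    using Taylor_sin[of d 2] unfolding s .
  also have "\<dots> \<le> 3 * ((7854 / 10000)\<^sup>2 * norm d) / 2"
  proof -
    have "\<bar>Im d\<bar> \<le> 1" using abs_Im_le_cmod[of d] assms p by linarith
    then have "exp \<bar>Im d\<bar> \<le> 3" using exp_le order_trans[of "exp \<bar>Im d\<bar>" "exp 1" 3] by simp
    moreover have "norm d ^ Suc 2 \<le> (7854 / 10000)\<^sup>2 * norm d"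
    proof -
      have "(norm d)\<^sup>2 \<le> (7854 / 10000)\<^sup>2" using assms p by (intro power_mono) auto
      then have "(norm d)\<^sup>2 * norm d \<le> (7854 / 10000)\<^sup>2 * norm d" by (rule mult_right_mono) simp
      then show ?thesis by (simp add: power2_eq_square power3_eq_cube mult_ac)
    qed
    ultimately have "exp \<bar>Im d\<bar> * norm d ^ Suc 2 \<le> 3 * ((7854 / 10000)\<^sup>2 * norm d)"
      by (intro mult_mono) auto
    then show ?thesis by (simp add: fact_2 divide_right_mono)
  qed
  also have "\<dots> \<le> (19 / 20) * norm d" by (simp add: power2_eq_square)
  finally show ?thesis
    using norm_triangle_ineq2[of d "sin d"] by (simp add: norm_minus_commute)
qed

lemma norm_sin_shift: "norm (sin (w + of_int m * of_real pi)) = norm (sin w)" for w :: complex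
proof -
  have s: "sin (of_int m * of_real pi :: complex) = 0"
    by (simp add: sin_eq_0)
  then have "(cos (of_int m * of_real pi :: complex))\<^sup>2 = 1"
    using sin_cos_squared_add[of "of_int m * of_real pi :: complex"] by simp
  then have "cos (of_int m * of_real pi :: complex) = 1 \<or> cos (of_int m * of_real pi :: complex) = -1"
    by (simp add: power2_eq_1_iff)
  then show ?thesis using s by (auto simp: sin_add)
qed

text \<open>At an eigenvalue |sin 2 z^2| is itself the error of the asymptotics. This bounds d, the
  difference of 2 z^2 and its free value, by 60 C / sqrt k, where 60 is 20 from
  \<open>norm_sin_lower\<close> times 3 from exp 1 \<le> 3. Since z and the free eigenvalue lie in
  the same half plane, their sum has size at least sqrt k, and dividing by it gains the second
  root.\<close>

lemma eigenvalue_asymptotic: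
  obtains C where "0 \<le> C"
    "\<And>\<psi> i n z. norm \<psi> \<le> R \<Longrightarrow> n \<noteq> 0 \<Longrightarrow> z \<in> D_disc i n \<Longrightarrow> z \<in> neumann_spectrum \<psi> \<Longrightarrow>
      norm (z - root_param i n (of_int \<bar>n\<bar> * of_real pi)) \<le> C / of_int \<bar>n\<bar>"
proof -
  obtain C where C: "0 \<le> C"
    "\<And>z \<psi>. norm \<psi> \<le> R \<Longrightarrow> norm (chi_N z \<psi> - sin (2 * z\<^sup>2)) \<le> C * exp \<bar>Im (2 * z\<^sup>2)\<bar> / (1 + norm z)"
    using chi_N_asymptotic[of R] by blast
  show ?thesis
  proof (rule that[of "60 * C"])
    show "0 \<le> 60 * C" using C by simp
    fix \<psi> :: potential and i n z
    assume \<psi>: "norm \<psi> \<le> R" and n: "n \<noteq> 0" and zD: "z \<in> D_disc i n" and zs: "z \<in> neumann_spectrum \<psi>"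
    let ?s = "sector_unit i n"
    define z0 where "z0 = root_param i n (of_int \<bar>n\<bar> * of_real pi)"
    define k where "k = real_of_int \<bar>n\<bar>"
    have k: "1 \<le> k" using n unfolding k_def by linarith
    define d where "d = 2 * z\<^sup>2 - of_int (disc_index i n) * of_real pi"
    have d: "norm d < pi / 4" unfolding d_def by (rule D_disc_index[OF n zD])
    have z0sq: "2 * z0\<^sup>2 = of_int (disc_index i n) * of_real pi"
      unfolding z0_def two_root_param_sq[OF n] mult.assoc[symmetric] sector_unit_simps(4)[OF n, symmetric] ..
    have "k \<le> (norm z)\<^sup>2"
      unfolding k_def by (rule D_disc_bounds(3)[OF n, of z i]) (use d in \<open>simp add: d_def\<close>)
    then have zk: "sqrt k \<le> norm z" using real_sqrt_le_mono[of k "(norm z)\<^sup>2"] by simp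
    have sk: "0 < sqrt k" using k by simp
    have im: "\<bar>Im (2 * z\<^sup>2)\<bar> \<le> 1"
    proof -
      have "Im (2 * z\<^sup>2) = Im d" by (simp add: d_def)
      then show ?thesis using abs_Im_le_cmod[of d] d pi_less_4 by linarith
    qed
    have "norm d / 20 \<le> norm (sin d)" using d by (intro norm_sin_lower) simp
    also have "norm (sin d) = norm (sin (2 * z\<^sup>2))"
      using norm_sin_shift[of d "disc_index i n"] by (simp add: d_def)
    also have "\<dots> = norm (chi_N z \<psi> - sin (2 * z\<^sup>2))" using zs by (simp add: neumann_spectrum_def)
    also have "\<dots> \<le> C * exp \<bar>Im (2 * z\<^sup>2)\<bar> / (1 + norm z)" by (rule C(2)[OF \<psi>])
    also have "\<dots> \<le> C * 3 / sqrt k"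
    proof (rule frac_le)
      have "exp \<bar>Im (2 * z\<^sup>2)\<bar> \<le> 3" using im exp_le order_trans[of "exp \<bar>Im (2 * z\<^sup>2)\<bar>" "exp 1" 3] by simp
      then show "C * exp \<bar>Im (2 * z\<^sup>2)\<bar> \<le> C * 3" using C(1) by (rule mult_left_mono)
    qed (use zk sk C in auto)
    finally have dk: "norm d \<le> 60 * C / sqrt k" by simp
    have Re0: "Re (z0 / ?s) = sqrt (k * pi / 2)"
    proof -
      have "z0 / ?s = csqrt (of_real (k * pi / 2))"
        using sector_unit_simps(1)[OF n, of i] by (simp add: z0_def root_param_def k_def)
      also have "\<dots> = of_real (sqrt (k * pi / 2))" using k by (intro csqrt_of_real) simp
      finally show ?thesis by (simp only: Re_complex_of_real)
    qed
    have "k * 1 \<le> k * (pi / 2)" using k pi_gt3 by (intro mult_left_mono) auto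
    then have "sqrt k \<le> Re (z0 / ?s)" unfolding Re0 by simp
    moreover have "0 < Re (z / ?s)" using zD D_disc_iff[OF n] by blast
    ultimately have "sqrt k \<le> Re ((z + z0) / ?s)" by (simp add: add_divide_distrib)
    also have "\<dots> \<le> norm ((z + z0) / ?s)" by (rule complex_Re_le_cmod)
    also have "\<dots> = norm (z + z0)" using sector_unit_simps(2)[OF n, of i] by (simp add: norm_divide)
    finally have zz: "sqrt k \<le> norm (z + z0)" .
    have "(z - z0) * (z + z0) = d / 2"
      using z0sq by (simp add: d_def power2_eq_square algebra_simps)
    then have "norm (z - z0) * norm (z + z0) = norm d / 2"
      by (metis norm_mult norm_divide norm_numeral)
    then have "norm (z - z0) * sqrt k \<le> norm d / 2"
      using mult_left_mono[OF zz norm_ge_zero[of "z - z0"]] by simp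
    also have "\<dots> \<le> 60 * C / sqrt k" using dk norm_ge_zero[of d] by linarith
    finally have "norm (z - z0) \<le> 60 * C / sqrt k / sqrt k" using sk by (simp only: pos_le_divide_eq)
    also have "\<dots> = 60 * C / (sqrt k * sqrt k)" by (simp only: divide_divide_eq_left)
    also have "sqrt k * sqrt k = k" using k by simp
    finally show "norm (z - root_param i n (of_int \<bar>n\<bar> * of_real pi)) \<le> 60 * C / of_int \<bar>n\<bar>"
      by (simp add: z0_def k_def)
  qed
qed

section \<open>Free eigenvalues and estimates for the labeled eigenvalues\<close>

lemma counting_property_zero: "counting_property 0 0"
  by (rule counting_propertyI) (simp add: chi_N_0)

lemma neumann_ev_in_D_disc:
  assumes "counting_property \<psi> 0" "i \<in> {1, 2}"
  shows "neumann_ev i n \<psi> \<in> D_disc i n"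
proof (cases "n = 0")
  case True
  have "neumann_ev i 0 \<psi> \<in> B_disc 0" by (rule neumann_ev_B_disc[OF assms]) simp
  then show ?thesis using True assms(2) D_disc_1_0 by auto
next
  case False
  then show ?thesis using neumann_N_le[OF assms(1)] by (intro neumann_ev_outer(1)[OF assms]) auto
qed

text \<open>For nonzero n, uniqueness in the disc decides. For n = 0 the conditions sin(2 z^2) = 0
  and |2 z^2| < pi/4 leave only z = 0.\<close>

lemma neumann_ev_zero:
  assumes "i \<in> {1, 2}"
  shows "neumann_ev i n 0 = root_param i n (of_int \<bar>n\<bar> * of_real pi)"
proof -
  let ?z = "neumann_ev i n 0"
  have zD: "?z \<in> D_disc i n" by (rule neumann_ev_in_D_disc[OF counting_property_zero assms])
  have zs: "?z \<in> neumann_spectrum 0" by (rule neumann_ev_spectrum[OF counting_property_zero assms])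
  show ?thesis
  proof (cases "n = 0")
    case True
    then have "norm (2 * ?z\<^sup>2) < pi / 4" using zD D_disc_0_index by simp
    moreover have "sin (2 * ?z\<^sup>2) = 0" using zs by (simp add: neumann_spectrum_def chi_N_0)
    then obtain m :: int where m: "2 * ?z\<^sup>2 = of_real (m * pi)" by (auto simp: sin_eq_0)
    ultimately have "0 = m"
      by (intro near_multiple_of_pi_unique[of "2 * ?z\<^sup>2" 0 "pi/4" m 0]) auto
    then have "?z = 0" using m by simp
    then show ?thesis using True by (simp add: root_param_def)
  next
    case False
    have "root_param i n (of_int \<bar>n\<bar> * of_real pi) \<in> D_disc i n \<inter> neumann_spectrum 0"
      using free_zero(1,3)[OF False, of i] by (simp add: neumann_spectrum_def chi_N_0)
    then show ?thesis
      using counting_propertyD(1)[OF counting_property_zero assms, of n] zD zs False by auto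
  qed
qed

lemma root_param_free:
  assumes "i \<in> {1, 2}"
  shows "root_param i n (of_int \<bar>n\<bar> * of_real pi)
    = of_int (sgn n) * csqrt ((-1) ^ (i - 1) * of_int \<bar>n\<bar> * of_real pi / 2)"
proof -
  have e: "(of_int \<bar>n\<bar> * of_real pi / 2 :: complex) = of_real (of_int \<bar>n\<bar> * pi / 2)"
    by (simp only: of_real_divide of_real_mult of_real_of_int_eq of_real_numeral)
  \<comment> \<open>The branch of \<open>csqrt\<close> on the negative axis agrees with the stated
    convention that the root of -x is i sqrt x.\<close>
  have m: "csqrt (- of_real x) = \<i> * csqrt (of_real x)" if "0 \<le> x" for x :: real
    using that by (simp add: csqrt_of_real)
  from assms consider "i = 1" | "i = 2" by blast
  then show ?thesis
  proof cases
    case 1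
    then show ?thesis by (simp add: root_param_def sector_unit_def)
  next
    case 2
    have "csqrt ((-1) ^ (2 - 1) * of_int \<bar>n\<bar> * of_real pi / 2) = csqrt (- of_real (of_int \<bar>n\<bar> * pi / 2))"
      by (simp add: e[symmetric])
    also have "\<dots> = \<i> * csqrt (of_int \<bar>n\<bar> * of_real pi / 2)" unfolding e by (rule m) simp
    finally show ?thesis using 2 by (simp only: root_param_def sector_unit_def) (simp add: mult_ac)
  qed
qed

text \<open>Beyond N the discs localize the eigenvalues. The finitely many other labels come from
  the sorted list and may jump with the potential, but they all stay in one fixed disc, which is
  enough for a bound.\<close>

lemma neumann_ev_asymptotic:
  obtains C where "0 \<le> C"
    "\<And>\<psi> i n. norm \<psi> \<le> R \<Longrightarrow> i \<in> {1, 2} \<Longrightarrow>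
      sqrt (1 + (of_int n)\<^sup>2) * norm (neumann_ev i n \<psi> - neumann_ev i n 0) \<le> C"
proof -
  obtain N where N: "\<And>\<psi>. norm \<psi> \<le> R \<Longrightarrow> counting_property \<psi> N" using counting_property_uniform by blast
  obtain C where C: "0 \<le> C"
    "\<And>\<psi> i n z. norm \<psi> \<le> R \<Longrightarrow> n \<noteq> 0 \<Longrightarrow> z \<in> D_disc i n \<Longrightarrow> z \<in> neumann_spectrum \<psi> \<Longrightarrow>
      norm (z - root_param i n (of_int \<bar>n\<bar> * of_real pi)) \<le> C / of_int \<bar>n\<bar>"
    using eigenvalue_asymptotic[of R] by blast
  define r where "r = sqrt ((real N + 1 / 4) * pi / 2)"
  have r: "0 \<le> r" by (simp add: r_def)
  define C' where "C' = sqrt (1 + (real N)\<^sup>2) * (2 * r)"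
  have C': "0 \<le> C'" using r by (simp add: C'_def)
  show ?thesis
  proof (rule that[of "2 * C + C'"])
    show "0 \<le> 2 * C + C'" using C(1) C' by simp
    fix \<psi> :: potential and i n assume \<psi>: "norm \<psi> \<le> R" and i: "i \<in> {1::nat, 2}"
    have c: "counting_property \<psi> N" by (rule N[OF \<psi>])
    show "sqrt (1 + (of_int n)\<^sup>2) * norm (neumann_ev i n \<psi> - neumann_ev i n 0) \<le> 2 * C + C'"
    proof (cases "\<bar>n\<bar> > int N")
      case True
      then have n0: "n \<noteq> 0" and n: "\<bar>n\<bar> > int (neumann_N \<psi>)" using neumann_N_le[OF c] by auto
      define k where "k = real_of_int \<bar>n\<bar>"
      have k: "1 \<le> k" using n0 unfolding k_def by linarith
      have "norm (neumann_ev i n \<psi> - neumann_ev i n 0) \<le> C / k"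
        unfolding neumann_ev_zero[OF i] k_def by (rule C(2)[OF \<psi> n0 neumann_ev_outer[OF c i n]])
      moreover have "sqrt (1 + (of_int n)\<^sup>2) \<le> 2 * k"
      proof (rule real_le_lsqrt)
        have "1 \<le> k\<^sup>2" using k by simp
        moreover have "(real_of_int n)\<^sup>2 = k\<^sup>2" by (simp add: k_def)
        ultimately show "1 + (real_of_int n)\<^sup>2 \<le> (2 * k)\<^sup>2" by (simp add: power_mult_distrib)
      qed (use k in auto)
      ultimately have "sqrt (1 + (of_int n)\<^sup>2) * norm (neumann_ev i n \<psi> - neumann_ev i n 0) \<le> (2 * k) * (C / k)"
        using k by (intro mult_mono) auto
      also have "\<dots> = 2 * C" using k by simp
      finally show ?thesis using C' by simp
    next
      case False
      then have n: "\<bar>n\<bar> \<le> int N" by simp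
      have B: "norm z < r" if "z \<in> B_disc N" for z using that by (simp add: B_disc_def r_def)
      have "norm (neumann_ev i n \<psi>) < r" by (rule B[OF neumann_ev_B_disc[OF c i n]])
      moreover have "norm (neumann_ev i n 0) < r"
        by (rule B, rule D_disc_subset_B_disc[OF n], rule neumann_ev_in_D_disc[OF counting_property_zero i])
      ultimately have "norm (neumann_ev i n \<psi> - neumann_ev i n 0) \<le> 2 * r"
        using norm_triangle_ineq4[of "neumann_ev i n \<psi>" "neumann_ev i n 0"] by linarith
      moreover have "sqrt (1 + (of_int n)\<^sup>2) \<le> sqrt (1 + (real N)\<^sup>2)"
      proof -
        have "\<bar>real_of_int n\<bar> \<le> \<bar>real N\<bar>" using n by linarith
        then have "(real_of_int n)\<^sup>2 \<le> (real N)\<^sup>2" unfolding abs_le_square_iff .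
        then show ?thesis by simp
      qed
      ultimately have "sqrt (1 + (of_int n)\<^sup>2) * norm (neumann_ev i n \<psi> - neumann_ev i n 0) \<le> C'"
        unfolding C'_def by (intro mult_mono) auto
      then show ?thesis using C(1) by simp
    qed
  qed
qed

text \<open>The estimate is made on balls because W need not be convex and Cauchy's estimate needs
  room: a bound on the ball of radius 2R is turned into a Lipschitz bound on the ball of radius R.
  Subtracting the free eigenvalue makes the function itself O(1/n), so the Lipschitz constant
  inherits the weight.\<close>

lemma neumann_ev_lipschitz:
  assumes R: "0 < R"
  obtains N C where "0 \<le> C"
    "\<And>\<psi> \<phi> i n. norm \<psi> < R \<Longrightarrow> norm \<phi> < R \<Longrightarrow> i \<in> {1, 2} \<Longrightarrow> \<bar>n\<bar> > int N \<Longrightarrow>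
      sqrt (1 + (of_int n)\<^sup>2) * norm (neumann_ev i n \<psi> - neumann_ev i n \<phi>) \<le> C * norm (\<psi> - \<phi>)"
proof -
  obtain N where N: "\<And>\<psi>. norm \<psi> \<le> 2 * R \<Longrightarrow> counting_property \<psi> N" using counting_property_uniform by blast
  obtain C where C: "0 \<le> C" "\<And>\<psi> i n. norm \<psi> \<le> 2 * R \<Longrightarrow> i \<in> {1, 2} \<Longrightarrow>
      sqrt (1 + (of_int n)\<^sup>2) * norm (neumann_ev i n \<psi> - neumann_ev i n 0) \<le> C"
    using neumann_ev_asymptotic[of "2 * R"] by blast
  show ?thesis
  proof (rule that[of "2 * C / R" N])
    show "0 \<le> 2 * C / R" using C(1) R by simp
    fix \<psi> \<phi> :: potential and i n
    assume a: "norm \<psi> < R" "norm \<phi> < R" "i \<in> {1::nat, 2}" "\<bar>n\<bar> > int N"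
    define w where "w = sqrt (1 + (real_of_int n)\<^sup>2)"
    have w: "0 < w" by (simp add: w_def add_pos_nonneg)
    have "analytic_on_potentials (neumann_ev i n) (ball 0 (2 * R))"
      by (rule analytic_on_potentials_neumann_ev[OF open_ball N a(3,4)]) simp
    then have an: "analytic_on_potentials (\<lambda>\<psi>. neumann_ev i n \<psi> - neumann_ev i n 0) (ball 0 (2 * R))"
      by (rule analytic_on_potentials_diff_const)
    have "norm ((neumann_ev i n \<psi> - neumann_ev i n 0) - (neumann_ev i n \<phi> - neumann_ev i n 0))
        \<le> 2 * (C / w) / R * norm (\<psi> - \<phi>)"
    proof (rule analytic_on_potentials_lipschitz[OF an R _ a(1,2)])
      show "norm (neumann_ev i n \<theta> - neumann_ev i n 0) \<le> C / w" if "norm \<theta> < 2 * R" for \<theta>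
        using C(2)[of \<theta> i n] that a(3) w by (simp add: pos_le_divide_eq w_def mult.commute)
    qed
    then have "norm (neumann_ev i n \<psi> - neumann_ev i n \<phi>) \<le> 2 * (C / w) / R * norm (\<psi> - \<phi>)" by simp
    then have "w * norm (neumann_ev i n \<psi> - neumann_ev i n \<phi>) \<le> w * (2 * (C / w) / R * norm (\<psi> - \<phi>))"
      using w by (intro mult_left_mono) auto
    also have "\<dots> = 2 * C / R * norm (\<psi> - \<phi>)" using w by simp
    finally show "sqrt (1 + (of_int n)\<^sup>2) * norm (neumann_ev i n \<psi> - neumann_ev i n \<phi>) \<le> 2 * C / R * norm (\<psi> - \<phi>)"
      by (simp add: w_def)
  qed
qed

lemma neumann_ev_sequence_limit:
  fixes \<psi>s :: "nat \<Rightarrow> potential"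
  assumes W: "bounded W" "open W" and c: "\<And>\<psi>. \<psi> \<in> W \<Longrightarrow> counting_property \<psi> 0"
    and i: "i \<in> {1, 2}" and \<psi>: "\<psi> \<in> W" "\<And>k. \<psi>s k \<in> W" and lim: "\<psi>s \<longlonglongrightarrow> \<psi>"
  shows "(\<lambda>k. SUP n\<in>UNIV - {0::int}.
      ereal (sqrt (1 + (of_int n)\<^sup>2) * norm (neumann_ev i n (\<psi>s k) - neumann_ev i n \<psi>))) \<longlonglongrightarrow> 0"
proof -
  obtain R where R: "0 < R" "\<And>\<psi>. \<psi> \<in> W \<Longrightarrow> norm \<psi> < R"
    using W(1) unfolding bounded_pos_less by blast
  obtain N C where C: "0 \<le> C"
    "\<And>\<psi> \<phi> i n. norm \<psi> < R \<Longrightarrow> norm \<phi> < R \<Longrightarrow> i \<in> {1, 2} \<Longrightarrow> \<bar>n\<bar> > int N \<Longrightarrow>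
      sqrt (1 + (of_int n)\<^sup>2) * norm (neumann_ev i n \<psi> - neumann_ev i n \<phi>) \<le> C * norm (\<psi> - \<phi>)"
    by (rule neumann_ev_lipschitz[OF R(1)], rule that)
  define t where "t n k = sqrt (1 + (real_of_int n)\<^sup>2) * norm (neumann_ev i n (\<psi>s k) - neumann_ev i n \<psi>)" for n k
  define I where "I = {- int N..int N} - {0}"
  \<comment> \<open>A majorant of the supremum over n. The Lipschitz bound covers all |n| > N at
    once; the finite sum of the other terms tends to 0 by continuity of each eigenvalue, which holds
    for every nonzero n because the counting property is available with 0.\<close>
  define a where "a k = C * norm (\<psi>s k - \<psi>) + (\<Sum>n\<in>I. t n k)" for k
  have t0: "0 \<le> t n k" for n k by (simp add: t_def)
  have tlim: "(\<lambda>k. t n k) \<longlonglongrightarrow> 0" if "n \<noteq> 0" for n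
  proof -
    have "analytic_on_potentials (neumann_ev i n) W"
      by (rule analytic_on_potentials_neumann_ev[OF W(2) c i]) (use that in auto)
    then obtain D where "(neumann_ev i n has_derivative D) (at \<psi>)"
      using \<psi>(1) unfolding analytic_on_potentials_def by blast
    then have "isCont (neumann_ev i n) \<psi>" by (rule has_derivative_continuous)
    from isCont_tendsto_compose[OF this lim]
    have "(\<lambda>k. norm (neumann_ev i n (\<psi>s k) - neumann_ev i n \<psi>)) \<longlonglongrightarrow> 0"
      by (intro tendsto_norm_zero) (simp add: LIM_zero_iff)
    then show ?thesis unfolding t_def by (rule tendsto_mult_right_zero)
  qed
  have alim: "a \<longlonglongrightarrow> 0"
  proof -
    have "(\<lambda>k. norm (\<psi>s k - \<psi>)) \<longlonglongrightarrow> 0" using lim by (intro tendsto_norm_zero) (simp add: LIM_zero_iff)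
    then have "(\<lambda>k. C * norm (\<psi>s k - \<psi>)) \<longlonglongrightarrow> 0" by (rule tendsto_mult_right_zero)
    moreover have "(\<lambda>k. \<Sum>n\<in>I. t n k) \<longlonglongrightarrow> 0" by (rule tendsto_null_sum) (auto simp: I_def tlim)
    ultimately show ?thesis unfolding a_def by (rule tendsto_add_zero)
  qed
  have ta: "t n k \<le> a k" if "n \<noteq> 0" for n k
  proof (cases "\<bar>n\<bar> > int N")
    case True
    have "t n k \<le> C * norm (\<psi>s k - \<psi>)"
      unfolding t_def by (rule C(2)[OF R(2)[OF \<psi>(2)] R(2)[OF \<psi>(1)] i True])
    also have "\<dots> \<le> a k" unfolding a_def using t0 by (simp add: sum_nonneg)
    finally show ?thesis .
  next
    case False
    then have "n \<in> I" using that by (auto simp: I_def)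
    then have "t n k \<le> (\<Sum>n\<in>I. t n k)" using t0 by (intro member_le_sum) (auto simp: I_def)
    also have "\<dots> \<le> a k" unfolding a_def using C(1) by simp
    finally show ?thesis .
  qed
  have "(\<lambda>k. SUP n\<in>UNIV - {0::int}. ereal (t n k)) \<longlonglongrightarrow> 0"
  proof (rule tendsto_sandwich[where f = "\<lambda>_. 0" and h = "\<lambda>k. ereal (a k)"])
    show "\<forall>\<^sub>F k in sequentially. 0 \<le> (SUP n\<in>UNIV - {0::int}. ereal (t n k))"
      using t0 by (intro always_eventually allI SUP_upper2[of 1]) auto
    show "\<forall>\<^sub>F k in sequentially. (SUP n\<in>UNIV - {0::int}. ereal (t n k)) \<le> ereal (a k)"
      using ta by (intro always_eventually allI SUP_least) auto
    show "(\<lambda>k. ereal (a k)) \<longlonglongrightarrow> 0" using alim by (simp add: zero_ereal_def)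
  qed simp
  then show ?thesis by (simp add: t_def)
qed

theorem theorem3p9:
  fixes B :: "potential set"
  assumes "bounded B" and "0 \<in> interior B"
  shows
    "(\<forall>i\<in>{1, 2}.
        (SUP \<psi>\<in>B. SUP n::int.
           ereal (sqrt (1 + (of_int n)\<^sup>2) * norm (neumann_ev i n \<psi> - neumann_ev i n 0))) < \<infinity> \<and>
        (\<forall>n::int. neumann_ev i n 0 =
           of_int (sgn n) * csqrt ((-1) ^ (i - 1) * of_int \<bar>n\<bar> * of_real pi / 2)))
     \<and>
     (\<exists>W\<subseteq>B. 0 \<in> interior W \<and>
        (\<forall>\<psi>\<in>W. \<forall>i\<in>{1, 2}.
           (\<forall>n::int. \<bar>n\<bar> \<ge> 1 \<longrightarrow> neumann_ev i n \<psi> \<in> D_disc i n) \<and>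
           neumann_ev i 0 \<psi> \<in> D_disc i 0))
     \<and>
     (\<forall>W\<subseteq>B. open W \<and> 0 \<in> W \<and>
        (\<forall>\<psi>\<in>W. \<forall>i\<in>{1, 2}.
           (\<forall>n::int. \<bar>n\<bar> \<ge> 1 \<longrightarrow> neumann_ev i n \<psi> \<in> D_disc i n) \<and>
           neumann_ev i 0 \<psi> \<in> D_disc i 0) \<longrightarrow>
        (\<forall>i\<in>{1, 2}.
           (\<forall>n::int. n \<noteq> 0 \<longrightarrow> analytic_on_potentials (neumann_ev i n) W) \<and>
           (\<forall>\<psi>\<in>W. \<forall>\<psi>s :: nat \<Rightarrow> potential. (\<forall>k. \<psi>s k \<in> W) \<and> \<psi>s \<longlonglongrightarrow> \<psi> \<longrightarrow>
              (\<lambda>k. SUP n\<in>UNIV - {0::int}.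
                 ereal (sqrt (1 + (of_int n)\<^sup>2) * norm (neumann_ev i n (\<psi>s k) - neumann_ev i n \<psi>)))
              \<longlonglongrightarrow> 0)))"
proof (intro conjI)
  obtain R where R: "\<And>\<psi>. \<psi> \<in> B \<Longrightarrow> norm \<psi> \<le> R" using assms(1) unfolding bounded_iff by blast
  obtain C where C: "0 \<le> C" "\<And>\<psi> i n. norm \<psi> \<le> R \<Longrightarrow> i \<in> {1, 2} \<Longrightarrow>
      sqrt (1 + (of_int n)\<^sup>2) * norm (neumann_ev i n \<psi> - neumann_ev i n 0) \<le> C"
    using neumann_ev_asymptotic[of R] by blast
  show "\<forall>i\<in>{1, 2}.
        (SUP \<psi>\<in>B. SUP n::int.
           ereal (sqrt (1 + (of_int n)\<^sup>2) * norm (neumann_ev i n \<psi> - neumann_ev i n 0))) < \<infinity> \<and>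
        (\<forall>n::int. neumann_ev i n 0 =
           of_int (sgn n) * csqrt ((-1) ^ (i - 1) * of_int \<bar>n\<bar> * of_real pi / 2))"
  proof (intro ballI conjI allI)
    fix i :: nat assume i: "i \<in> {1, 2}"
    have "(SUP \<psi>\<in>B. SUP n::int.
        ereal (sqrt (1 + (of_int n)\<^sup>2) * norm (neumann_ev i n \<psi> - neumann_ev i n 0))) \<le> ereal C"
      by (intro SUP_least ereal_less_eq(3)[THEN iffD2] C(2) R i)
    also have "\<dots> < \<infinity>" by simp
    finally show "(SUP \<psi>\<in>B. SUP n::int.
        ereal (sqrt (1 + (of_int n)\<^sup>2) * norm (neumann_ev i n \<psi> - neumann_ev i n 0))) < \<infinity>" .
    show "neumann_ev i n 0 = of_int (sgn n) * csqrt ((-1) ^ (i - 1) * of_int \<bar>n\<bar> * of_real pi / 2)" for n :: int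
      unfolding neumann_ev_zero[OF i] by (rule root_param_free[OF i])
  qed
next
  obtain \<delta> where \<delta>: "0 < \<delta>" "ball 0 \<delta> \<subseteq> B" using assms(2) by (auto simp: mem_interior)
  obtain C where C: "0 \<le> C"
    "\<And>z \<psi>. norm \<psi> < 1 \<Longrightarrow> norm (chi_N z \<psi> - sin (2 * z\<^sup>2)) \<le> C * norm \<psi> * exp \<bar>Im (2 * z\<^sup>2)\<bar>"
    using chi_N_near_zero by blast
  \<comment> \<open>With this radius C |\<psi>| is below 1/8 for every z at once, so that
    \<open>counting_propertyI\<close> applies with N = 0.\<close>
  define \<rho> where "\<rho> = min \<delta> (1 / (8 * (C + 1)))"
  have \<rho>: "0 < \<rho>" using \<delta> C by (simp add: \<rho>_def)
  have "counting_property \<psi> 0" if "\<psi> \<in> ball 0 \<rho>" for \<psi>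
  proof (rule counting_propertyI)
    fix z
    have n: "norm \<psi> < 1 / (8 * (C + 1))" using that by (simp add: \<rho>_def)
    then have p: "norm \<psi> * (8 * (C + 1)) < 1" using C(1) by (simp add: pos_less_divide_eq)
    moreover have "0 \<le> norm \<psi> * C" using C(1) by simp
    ultimately have n1: "norm \<psi> < 1" by (simp add: distrib_left)
    have "C * norm \<psi> < 1 / 8"
    proof (cases "\<psi> = 0")
      case False
      then have "0 < norm \<psi>" by simp
      moreover have "norm \<psi> * (8 * (C + 1)) = 8 * (C * norm \<psi>) + 8 * norm \<psi>" by (simp add: algebra_simps)
      ultimately show ?thesis using p by linarith
    qed simp
    then have "C * norm \<psi> * exp \<bar>Im (2 * z\<^sup>2)\<bar> < 1 / 8 * exp \<bar>Im (2 * z\<^sup>2)\<bar>"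
      by (rule mult_strict_right_mono) simp
    then show "norm (chi_N z \<psi> - sin (2 * z\<^sup>2)) < exp \<bar>Im (2 * z\<^sup>2)\<bar> / 8"
      using C(2)[OF n1, of z] by linarith
  qed
  then have "\<forall>\<psi>\<in>ball 0 \<rho>. \<forall>i\<in>{1, 2}.
      (\<forall>n::int. \<bar>n\<bar> \<ge> 1 \<longrightarrow> neumann_ev i n \<psi> \<in> D_disc i n) \<and> neumann_ev i 0 \<psi> \<in> D_disc i 0"
    by (blast intro: neumann_ev_in_D_disc)
  moreover have "ball 0 \<rho> \<subseteq> B" using \<delta>(2) subset_ball[of \<rho> \<delta> "0::potential"] by (auto simp: \<rho>_def)
  moreover have "(0::potential) \<in> interior (ball 0 \<rho>)" using \<rho> by simp
  ultimately show "\<exists>W\<subseteq>B. 0 \<in> interior W \<and>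
        (\<forall>\<psi>\<in>W. \<forall>i\<in>{1, 2}.
           (\<forall>n::int. \<bar>n\<bar> \<ge> 1 \<longrightarrow> neumann_ev i n \<psi> \<in> D_disc i n) \<and>
           neumann_ev i 0 \<psi> \<in> D_disc i 0)" by blast
next
  obtain R where R: "\<And>\<psi>. \<psi> \<in> B \<Longrightarrow> norm \<psi> \<le> R" using assms(1) unfolding bounded_iff by blast
  obtain N where N: "\<And>\<psi>. norm \<psi> \<le> R \<Longrightarrow> counting_property \<psi> N" using counting_property_uniform by blast
  show "\<forall>W\<subseteq>B. open W \<and> 0 \<in> W \<and>
        (\<forall>\<psi>\<in>W. \<forall>i\<in>{1, 2}.
           (\<forall>n::int. \<bar>n\<bar> \<ge> 1 \<longrightarrow> neumann_ev i n \<psi> \<in> D_disc i n) \<and>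
           neumann_ev i 0 \<psi> \<in> D_disc i 0) \<longrightarrow>
        (\<forall>i\<in>{1, 2}.
           (\<forall>n::int. n \<noteq> 0 \<longrightarrow> analytic_on_potentials (neumann_ev i n) W) \<and>
           (\<forall>\<psi>\<in>W. \<forall>\<psi>s :: nat \<Rightarrow> potential. (\<forall>k. \<psi>s k \<in> W) \<and> \<psi>s \<longlonglongrightarrow> \<psi> \<longrightarrow>
              (\<lambda>k. SUP n\<in>UNIV - {0::int}.
                 ereal (sqrt (1 + (of_int n)\<^sup>2) * norm (neumann_ev i n (\<psi>s k) - neumann_ev i n \<psi>)))
              \<longlonglongrightarrow> 0))"
  proof (intro allI impI)
    fix W assume WB: "W \<subseteq> B" and "open W \<and> 0 \<in> W \<and>
        (\<forall>\<psi>\<in>W. \<forall>i\<in>{1, 2}.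
           (\<forall>n::int. \<bar>n\<bar> \<ge> 1 \<longrightarrow> neumann_ev i n \<psi> \<in> D_disc i n) \<and>
           neumann_ev i 0 \<psi> \<in> D_disc i 0)"
    then have W: "open W" and ev: "\<And>\<psi> i n. \<psi> \<in> W \<Longrightarrow> i \<in> {1, 2} \<Longrightarrow> \<bar>n\<bar> \<ge> 1 \<Longrightarrow> neumann_ev i n \<psi> \<in> D_disc i n"
      and ev0: "\<And>\<psi> i. \<psi> \<in> W \<Longrightarrow> i \<in> {1, 2} \<Longrightarrow> neumann_ev i 0 \<psi> \<in> D_disc i 0" by blast+
    \<comment> \<open>The N that is uniform on B ensures that the labeling is well defined; the disc
      hypothesis on W then lowers it to 0.\<close>
    have c: "counting_property \<psi> 0" if \<psi>: "\<psi> \<in> W" for \<psi>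
    proof (rule counting_property_0I)
      show "counting_property \<psi> N" using \<psi> WB by (intro N R) auto
      show "neumann_ev i n \<psi> \<in> D_disc i n" if i: "i \<in> {1, 2}" for i n
        using ev[OF \<psi> i, of n] ev0[OF \<psi> i] by (cases "n = 0") auto
    qed
    show "\<forall>i\<in>{1, 2}.
           (\<forall>n::int. n \<noteq> 0 \<longrightarrow> analytic_on_potentials (neumann_ev i n) W) \<and>
           (\<forall>\<psi>\<in>W. \<forall>\<psi>s :: nat \<Rightarrow> potential. (\<forall>k. \<psi>s k \<in> W) \<and> \<psi>s \<longlonglongrightarrow> \<psi> \<longrightarrow>
              (\<lambda>k. SUP n\<in>UNIV - {0::int}.
                 ereal (sqrt (1 + (of_int n)\<^sup>2) * norm (neumann_ev i n (\<psi>s k) - neumann_ev i n \<psi>)))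
              \<longlonglongrightarrow> 0)"
    proof (intro ballI conjI allI impI)
      fix i :: nat assume i: "i \<in> {1, 2}"
      show "analytic_on_potentials (neumann_ev i n) W" if "n \<noteq> 0" for n
        by (rule analytic_on_potentials_neumann_ev[OF W c i]) (use that in auto)
      fix \<psi> and \<psi>s :: "nat \<Rightarrow> potential"
      assume "\<psi> \<in> W" "(\<forall>k. \<psi>s k \<in> W) \<and> \<psi>s \<longlonglongrightarrow> \<psi>"
      then show "(\<lambda>k. SUP n\<in>UNIV - {0::int}.
          ereal (sqrt (1 + (of_int n)\<^sup>2) * norm (neumann_ev i n (\<psi>s k) - neumann_ev i n \<psi>))) \<longlonglongrightarrow> 0"
        by (intro neumann_ev_sequence_limit[OF bounded_subset[OF assms(1) WB] W c i]) auto
    qed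
  qed
qed

end
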